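(* Let $K:\mathbb{B}\rightarrow\mathbb{A}$ be a functor such that $\mathbb{B}$ is a small category and $\mathbb{A}$ is a category with small hom-sets. Then there is an adjunction $Lan_K\dashv Set^K$, with $Lan_K:Set^\mathbb{B}\rightarrow Set^\mathbb{A}$ given by left Kan extensions along $K$ and $Set^K:Set^\mathbb{A}\rightarrow Set^\mathbb{B}$ given by precomposition with $K$. If the left adjoint $Lan_K$ preserves pullbacks and $Lan_K\circ y$ is faithful, where $y:\mathbb{B}^{op}\rightarrow Set^\mathbb{B}$ is the Yoneda embedding, then there is an induced reflection with stable units $I:Set^\mathbb{B}\rightarrow Mono(Lan_K)$ (left adjoint to the full inclusion $H$) and a monotone-light factorization system $(\mathcal{E}'_I,\mathcal{M}^*_I)$ on $Set^\mathbb{B}$.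
   Context: Let $\theta:1\rightarrow Set^K\circ Lan_K$ be the unit of the adjunction. $Mono(Lan_K)$ is the full subcategory of $Set^\mathbb{B}$ determined by the objects $M$ for which $\theta_M:M\rightarrow Lan_K(M)\circ K$ is a monomorphism. The induced reflection $I$ is the one whose unit $\eta$ is obtained by factorizing each $\theta_M=\mu_M\circ\eta_M$ componentwise as a surjection followed by an injection. For a full reflection $I\dashv H:\mathbb{M}\rightarrow\mathbb{C}$ of a category $\mathbb{C}$ with pullbacks: $\mathcal{E}_I$ is the class of morphisms $f$ of $\mathbb{C}$ with $If$ an isomorphism; $\mathcal{M}_I$ is the class of morphisms $m$ right orthogonal to every $e\in\mathcal{E}_I$ (for every commutative square $v\circ e=m\circ u$ there is a unique $w$ with $w\circ e=u$, $m\circ w=v$); $\mathcal{E}'_I$ is the class of morphisms all of whose pullbacks lie in $\mathcal{E}_I$; $\mathcal{M}^*_I$ is the class of morphisms $f:A\rightarrow B$ for which there is an effective descent morphism $p:E\rightarrow B$ such that the pullback $p^*(f)$ of $f$ along $p$ lies in $\mathcal{M}_I$. A morphism $p:E\rightarrow B$ is an effective descent morphism if the pullback functor $p^*:\mathbb{C}/B\rightarrow\mathbb{C}/E$ is monadic. The reflection has stable units if every unit morphism $\eta_C$ belongs to $\mathcal{E}'_I$. A monotone-light factorization system exists when $(\mathcal{E}'_I,\mathcal{M}^*_I)$ is an (orthogonal) factorization system on $\mathbb{C}$. *)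

theory Defs
  imports Main "HOL-Library.FuncSet"
begin

section \<open>Categories, functors, natural transformations\<close>

text \<open>
  As in dependent type theory, a morphism is always considered relative to a given hom-set;
  hom-sets of different pairs of objects need not be disjoint. For this reason the action of a
  functor on morphisms, and likewise a class of morphisms, takes the domain and the codomain
  as additional arguments. Composition is written in the order \<open>cmp C g f = g \<circ> f\<close>.
\<close>

record ('o, 'm) cat =
  obj :: "'o set"
  hom :: "'o \<Rightarrow> 'o \<Rightarrow> 'm set"
  idn :: "'o \<Rightarrow> 'm"
  cmp :: "'m \<Rightarrow> 'm \<Rightarrow> 'm"

definition category :: "('o, 'm) cat \<Rightarrow> bool" where
  "category C \<longleftrightarrow>
     (\<forall>x y f. f \<in> hom C x y \<longrightarrow> x \<in> obj C \<and> y \<in> obj C) \<and>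
     (\<forall>x\<in>obj C. idn C x \<in> hom C x x) \<and>
     (\<forall>x y z f g. f \<in> hom C x y \<longrightarrow> g \<in> hom C y z \<longrightarrow> cmp C g f \<in> hom C x z) \<and>
     (\<forall>x y f. f \<in> hom C x y \<longrightarrow> cmp C f (idn C x) = f \<and> cmp C (idn C y) f = f) \<and>
     (\<forall>w x y z f g h. f \<in> hom C w x \<longrightarrow> g \<in> hom C x y \<longrightarrow> h \<in> hom C y z \<longrightarrow>
        cmp C h (cmp C g f) = cmp C (cmp C h g) f)"

definition op_cat :: "('o, 'm) cat \<Rightarrow> ('o, 'm) cat" where
  "op_cat C = \<lparr> obj = obj C, hom = (\<lambda>x y. hom C y x), idn = idn C, cmp = (\<lambda>g f. cmp C f g) \<rparr>"

definition full_sub :: "('o, 'm) cat \<Rightarrow> 'o set \<Rightarrow> ('o, 'm) cat" where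
  "full_sub C S =
     \<lparr> obj = obj C \<inter> S,
       hom = (\<lambda>x y. if x \<in> S \<and> y \<in> S then hom C x y else {}),
       idn = idn C, cmp = cmp C \<rparr>"

definition is_iso :: "('o, 'm) cat \<Rightarrow> 'o \<Rightarrow> 'o \<Rightarrow> 'm \<Rightarrow> bool" where
  "is_iso C x y f \<longleftrightarrow>
     f \<in> hom C x y \<and> (\<exists>g\<in>hom C y x. cmp C g f = idn C x \<and> cmp C f g = idn C y)"

definition is_mono :: "('o, 'm) cat \<Rightarrow> 'o \<Rightarrow> 'o \<Rightarrow> 'm \<Rightarrow> bool" where
  "is_mono C x y f \<longleftrightarrow>
     f \<in> hom C x y \<and>
     (\<forall>w. \<forall>g\<in>hom C w x. \<forall>h\<in>hom C w x. cmp C f g = cmp C f h \<longrightarrow> g = h)"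

text \<open>The square \<open>f \<circ> p = g \<circ> q\<close> with \<open>f : X \<rightarrow> Z\<close>, \<open>g : Y \<rightarrow> Z\<close>, \<open>p : P \<rightarrow> X\<close>, \<open>q : P \<rightarrow> Y\<close>.\<close>

definition is_pullback ::
  "('o, 'm) cat \<Rightarrow> 'o \<Rightarrow> 'o \<Rightarrow> 'o \<Rightarrow> 'm \<Rightarrow> 'm \<Rightarrow> 'o \<Rightarrow> 'm \<Rightarrow> 'm \<Rightarrow> bool" where
  "is_pullback C X Y Z f g P p q \<longleftrightarrow>
     f \<in> hom C X Z \<and> g \<in> hom C Y Z \<and> p \<in> hom C P X \<and> q \<in> hom C P Y \<and>
     cmp C f p = cmp C g q \<and>
     (\<forall>W. \<forall>u\<in>hom C W X. \<forall>v\<in>hom C W Y. cmp C f u = cmp C g v \<longrightarrow>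
        (\<exists>!h. h \<in> hom C W P \<and> cmp C p h = u \<and> cmp C q h = v))"

record ('o, 'm, 'p, 'n) fnctr =
  on_obj :: "'o \<Rightarrow> 'p"
  on_arr :: "'o \<Rightarrow> 'o \<Rightarrow> 'm \<Rightarrow> 'n"

definition is_functor ::
  "('o, 'm) cat \<Rightarrow> ('p, 'n) cat \<Rightarrow> ('o, 'm, 'p, 'n) fnctr \<Rightarrow> bool" where
  "is_functor C D F \<longleftrightarrow>
     (\<forall>x\<in>obj C. on_obj F x \<in> obj D) \<and>
     (\<forall>x y f. f \<in> hom C x y \<longrightarrow> on_arr F x y f \<in> hom D (on_obj F x) (on_obj F y)) \<and>
     (\<forall>x\<in>obj C. on_arr F x x (idn C x) = idn D (on_obj F x)) \<and>
     (\<forall>x y z f g. f \<in> hom C x y \<longrightarrow> g \<in> hom C y z \<longrightarrow>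
        on_arr F x z (cmp C g f) = cmp D (on_arr F y z g) (on_arr F x y f))"

text \<open>Also used as the inclusion functor of a full subcategory.\<close>

definition id_fun :: "('o, 'm, 'o, 'm) fnctr" where
  "id_fun = \<lparr> on_obj = (\<lambda>x. x), on_arr = (\<lambda>x y f. f) \<rparr>"

definition comp_fun ::
  "('p, 'n, 'q, 'k) fnctr \<Rightarrow> ('o, 'm, 'p, 'n) fnctr \<Rightarrow> ('o, 'm, 'q, 'k) fnctr" where
  "comp_fun G F =
     \<lparr> on_obj = (\<lambda>x. on_obj G (on_obj F x)),
       on_arr = (\<lambda>x y f. on_arr G (on_obj F x) (on_obj F y) (on_arr F x y f)) \<rparr>"

definition faithful :: "('o, 'm) cat \<Rightarrow> ('o, 'm, 'p, 'n) fnctr \<Rightarrow> bool" where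
  "faithful C F \<longleftrightarrow> (\<forall>x\<in>obj C. \<forall>y\<in>obj C. inj_on (on_arr F x y) (hom C x y))"

definition preserves_pullbacks ::
  "('o, 'm) cat \<Rightarrow> ('p, 'n) cat \<Rightarrow> ('o, 'm, 'p, 'n) fnctr \<Rightarrow> bool" where
  "preserves_pullbacks C D F \<longleftrightarrow>
     (\<forall>X Y Z f g P p q. is_pullback C X Y Z f g P p q \<longrightarrow>
        is_pullback D (on_obj F X) (on_obj F Y) (on_obj F Z) (on_arr F X Z f) (on_arr F Y Z g)
          (on_obj F P) (on_arr F P X p) (on_arr F P Y q))"

definition nat_trans ::
  "('o, 'm) cat \<Rightarrow> ('p, 'n) cat \<Rightarrow> ('o, 'm, 'p, 'n) fnctr \<Rightarrow> ('o, 'm, 'p, 'n) fnctr \<Rightarrow>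
   ('o \<Rightarrow> 'n) \<Rightarrow> bool" where
  "nat_trans C D F G \<tau> \<longleftrightarrow>
     (\<forall>x\<in>obj C. \<tau> x \<in> hom D (on_obj F x) (on_obj G x)) \<and>
     (\<forall>x y f. f \<in> hom C x y \<longrightarrow>
        cmp D (\<tau> y) (on_arr F x y f) = cmp D (on_arr G x y f) (\<tau> x))"

definition nat_iso ::
  "('o, 'm) cat \<Rightarrow> ('p, 'n) cat \<Rightarrow> ('o, 'm, 'p, 'n) fnctr \<Rightarrow> ('o, 'm, 'p, 'n) fnctr \<Rightarrow>
   ('o \<Rightarrow> 'n) \<Rightarrow> bool" where
  "nat_iso C D F G \<tau> \<longleftrightarrow>
     nat_trans C D F G \<tau> \<and> (\<forall>x\<in>obj C. is_iso D (on_obj F x) (on_obj G x) (\<tau> x))"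

definition is_equivalence ::
  "('o, 'm) cat \<Rightarrow> ('p, 'n) cat \<Rightarrow> ('o, 'm, 'p, 'n) fnctr \<Rightarrow> bool" where
  "is_equivalence C D F \<longleftrightarrow>
     is_functor C D F \<and>
     (\<exists>G \<sigma> \<tau>. is_functor D C G \<and>
        nat_iso C C (comp_fun G F) id_fun \<sigma> \<and> nat_iso D D (comp_fun F G) id_fun \<tau>)"

text \<open>\<open>L : C \<rightarrow> D\<close> is left adjoint to \<open>R : D \<rightarrow> C\<close> with unit \<open>\<eta>\<close> and counit \<open>\<epsilon>\<close>.\<close>

definition adjunction ::
  "('o, 'm) cat \<Rightarrow> ('p, 'n) cat \<Rightarrow> ('o, 'm, 'p, 'n) fnctr \<Rightarrow> ('p, 'n, 'o, 'm) fnctr \<Rightarrow>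
   ('o \<Rightarrow> 'm) \<Rightarrow> ('p \<Rightarrow> 'n) \<Rightarrow> bool" where
  "adjunction C D L R \<eta> \<epsilon> \<longleftrightarrow>
     is_functor C D L \<and> is_functor D C R \<and>
     nat_trans C C id_fun (comp_fun R L) \<eta> \<and> nat_trans D D (comp_fun L R) id_fun \<epsilon> \<and>
     (\<forall>x\<in>obj C.
        cmp D (\<epsilon> (on_obj L x)) (on_arr L x (on_obj R (on_obj L x)) (\<eta> x)) = idn D (on_obj L x)) \<and>
     (\<forall>y\<in>obj D.
        cmp C (on_arr R (on_obj L (on_obj R y)) y (\<epsilon> y)) (\<eta> (on_obj R y)) = idn C (on_obj R y))"


section \<open>Functor categories and Kan extensions\<close>

text \<open>
  Functors and natural transformations that are objects and morphisms of a functor category are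
  \<open>undefined\<close> outside their domain, so that HOL equality is equality of functors and of
  natural transformations.
\<close>

definition restrict_fun :: "('o, 'm) cat \<Rightarrow> ('o, 'm, 'p, 'n) fnctr \<Rightarrow> ('o, 'm, 'p, 'n) fnctr" where
  "restrict_fun C F =
     \<lparr> on_obj = restrict (on_obj F) (obj C),
       on_arr = (\<lambda>x y. restrict (on_arr F x y) (hom C x y)) \<rparr>"

definition functors :: "('o, 'm) cat \<Rightarrow> ('p, 'n) cat \<Rightarrow> ('o, 'm, 'p, 'n) fnctr set" where
  "functors C D =
     {F. is_functor C D F \<and> on_obj F \<in> extensional (obj C) \<and>
         (\<forall>x y. on_arr F x y \<in> extensional (hom C x y))}"

definition functor_cat ::
  "('o, 'm) cat \<Rightarrow> ('p, 'n) cat \<Rightarrow> (('o, 'm, 'p, 'n) fnctr, 'o \<Rightarrow> 'n) cat" where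
  "functor_cat C D =
     \<lparr> obj = functors C D,
       hom = (\<lambda>F G. {\<tau>. F \<in> functors C D \<and> G \<in> functors C D \<and>
                        nat_trans C D F G \<tau> \<and> \<tau> \<in> extensional (obj C)}),
       idn = (\<lambda>F. \<lambda>x\<in>obj C. idn D (on_obj F x)),
       cmp = (\<lambda>\<sigma> \<tau>. \<lambda>x\<in>obj C. cmp D (\<sigma> x) (\<tau> x)) \<rparr>"

text \<open>Precomposition with \<open>K : B \<rightarrow> A\<close>, as a functor from \<open>functor_cat A C\<close> to \<open>functor_cat B C\<close>.\<close>

definition precomp ::
  "('b, 'f) cat \<Rightarrow> ('b, 'f, 'a, 'g) fnctr \<Rightarrow>
   (('a, 'g, 'p, 'n) fnctr, 'a \<Rightarrow> 'n, ('b, 'f, 'p, 'n) fnctr, 'b \<Rightarrow> 'n) fnctr" where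
  "precomp B K =
     \<lparr> on_obj = (\<lambda>N. restrict_fun B (comp_fun N K)),
       on_arr = (\<lambda>N N' \<tau>. \<lambda>b\<in>obj B. \<tau> (on_obj K b)) \<rparr>"

definition is_left_Kan_extension ::
  "('b, 'f) cat \<Rightarrow> ('a, 'g) cat \<Rightarrow> ('p, 'n) cat \<Rightarrow> ('b, 'f, 'a, 'g) fnctr \<Rightarrow>
   ('b, 'f, 'p, 'n) fnctr \<Rightarrow> ('a, 'g, 'p, 'n) fnctr \<Rightarrow> ('b \<Rightarrow> 'n) \<Rightarrow> bool" where
  "is_left_Kan_extension B A C K M N \<theta> \<longleftrightarrow>
     N \<in> obj (functor_cat A C) \<and>
     \<theta> \<in> hom (functor_cat B C) M (on_obj (precomp B K) N) \<and>
     (\<forall>N'\<in>obj (functor_cat A C). \<forall>\<sigma>\<in>hom (functor_cat B C) M (on_obj (precomp B K) N').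
        \<exists>!\<tau>. \<tau> \<in> hom (functor_cat A C) N N' \<and>
             cmp (functor_cat B C) (on_arr (precomp B K) N N' \<tau>) \<theta> = \<sigma>)"


section \<open>Monadicity and effective descent\<close>

text \<open>
  Eilenberg--Moore category of the monad on \<open>D\<close> with functor \<open>T\<close>, unit \<open>\<eta>\<close>, multiplication \<open>\<mu>\<close>.
\<close>

definition EM_algebras ::
  "('p, 'n) cat \<Rightarrow> ('p, 'n, 'p, 'n) fnctr \<Rightarrow> ('p \<Rightarrow> 'n) \<Rightarrow> ('p \<Rightarrow> 'n) \<Rightarrow> ('p \<times> 'n) set" where
  "EM_algebras D T \<eta> \<mu> =
     {(x, a). x \<in> obj D \<and> a \<in> hom D (on_obj T x) x \<and>
        cmp D a (\<eta> x) = idn D x \<and>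
        cmp D a (on_arr T (on_obj T x) x a) = cmp D a (\<mu> x)}"

definition EM_cat ::
  "('p, 'n) cat \<Rightarrow> ('p, 'n, 'p, 'n) fnctr \<Rightarrow> ('p \<Rightarrow> 'n) \<Rightarrow> ('p \<Rightarrow> 'n) \<Rightarrow> ('p \<times> 'n, 'n) cat" where
  "EM_cat D T \<eta> \<mu> =
     \<lparr> obj = EM_algebras D T \<eta> \<mu>,
       hom = (\<lambda>X Y. {h. X \<in> EM_algebras D T \<eta> \<mu> \<and> Y \<in> EM_algebras D T \<eta> \<mu> \<and>
                        h \<in> hom D (fst X) (fst Y) \<and>
                        cmp D h (snd X) = cmp D (snd Y) (on_arr T (fst X) (fst Y) h)}),
       idn = (\<lambda>X. idn D (fst X)),
       cmp = cmp D \<rparr>"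

text \<open>
  For \<open>L : D \<rightarrow> C\<close> left adjoint to \<open>R : C \<rightarrow> D\<close> with counit \<open>\<epsilon>\<close>: the multiplication \<open>R \<epsilon> L\<close>
  of the induced monad \<open>R L\<close>, and the comparison functor \<open>c \<mapsto> (R c, R \<epsilon>\<^sub>c)\<close>.
\<close>

definition monad_mult ::
  "('p, 'n, 'o, 'm) fnctr \<Rightarrow> ('o, 'm, 'p, 'n) fnctr \<Rightarrow> ('o \<Rightarrow> 'm) \<Rightarrow> 'p \<Rightarrow> 'n" where
  "monad_mult L R \<epsilon> =
     (\<lambda>x. on_arr R (on_obj L (on_obj R (on_obj L x))) (on_obj L x) (\<epsilon> (on_obj L x)))"

definition comparison ::
  "('p, 'n, 'o, 'm) fnctr \<Rightarrow> ('o, 'm, 'p, 'n) fnctr \<Rightarrow> ('o \<Rightarrow> 'm) \<Rightarrow> ('o, 'm, 'p \<times> 'n, 'n) fnctr" where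
  "comparison L R \<epsilon> =
     \<lparr> on_obj = (\<lambda>c. (on_obj R c, on_arr R (on_obj L (on_obj R c)) c (\<epsilon> c))),
       on_arr = on_arr R \<rparr>"

definition monadic :: "('o, 'm) cat \<Rightarrow> ('p, 'n) cat \<Rightarrow> ('o, 'm, 'p, 'n) fnctr \<Rightarrow> bool" where
  "monadic C D R \<longleftrightarrow>
     (\<exists>L \<eta> \<epsilon>. adjunction D C L R \<eta> \<epsilon> \<and>
        is_equivalence C (EM_cat D (comp_fun R L) \<eta> (monad_mult L R \<epsilon>)) (comparison L R \<epsilon>))"

definition slice_cat :: "('o, 'm) cat \<Rightarrow> 'o \<Rightarrow> ('o \<times> 'm, 'm) cat" where
  "slice_cat C B =
     \<lparr> obj = {(X, f). f \<in> hom C X B},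
       hom = (\<lambda>(X, f) (Y, g). {h \<in> hom C X Y. f \<in> hom C X B \<and> g \<in> hom C Y B \<and> cmp C g h = f}),
       idn = (\<lambda>(X, f). idn C X),
       cmp = cmp C \<rparr>"

text \<open>
  \<open>P\<close> is a pullback functor \<open>C/B \<rightarrow> C/E\<close> along \<open>p : E \<rightarrow> B\<close>, for the choice of pullbacks with
  second projections \<open>q\<close>.
\<close>

definition is_pullback_functor ::
  "('o, 'm) cat \<Rightarrow> 'o \<Rightarrow> 'o \<Rightarrow> 'm \<Rightarrow> ('o \<times> 'm, 'm, 'o \<times> 'm, 'm) fnctr \<Rightarrow> bool" where
  "is_pullback_functor C E B p P \<longleftrightarrow>
     is_functor (slice_cat C B) (slice_cat C E) P \<and>
     (\<exists>q. (\<forall>X f. f \<in> hom C X B \<longrightarrow>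
             is_pullback C E X B p f (fst (on_obj P (X, f))) (snd (on_obj P (X, f))) (q (X, f))) \<and>
          (\<forall>X f Y g h. h \<in> hom (slice_cat C B) (X, f) (Y, g) \<longrightarrow>
             cmp C (q (Y, g)) (on_arr P (X, f) (Y, g) h) = cmp C h (q (X, f))))"

definition effective_descent :: "('o, 'm) cat \<Rightarrow> 'o \<Rightarrow> 'o \<Rightarrow> 'm \<Rightarrow> bool" where
  "effective_descent C E B p \<longleftrightarrow>
     p \<in> hom C E B \<and>
     (\<exists>P. is_pullback_functor C E B p P \<and> monadic (slice_cat C B) (slice_cat C E) P)"


section \<open>Factorization systems and reflections\<close>

type_synonym ('o, 'm) arrow_class = "'o \<Rightarrow> 'o \<Rightarrow> 'm \<Rightarrow> bool"

definition orthogonal :: "('o, 'm) cat \<Rightarrow> 'o \<Rightarrow> 'o \<Rightarrow> 'm \<Rightarrow> 'o \<Rightarrow> 'o \<Rightarrow> 'm \<Rightarrow> bool" where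
  "orthogonal C a b e x y m \<longleftrightarrow>
     (\<forall>u\<in>hom C a x. \<forall>v\<in>hom C b y. cmp C v e = cmp C m u \<longrightarrow>
        (\<exists>!w. w \<in> hom C b x \<and> cmp C w e = u \<and> cmp C m w = v))"

definition factorization_system ::
  "('o, 'm) cat \<Rightarrow> ('o, 'm) arrow_class \<Rightarrow> ('o, 'm) arrow_class \<Rightarrow> bool" where
  "factorization_system C E M \<longleftrightarrow>
     (\<forall>x y f. E x y f \<longrightarrow> f \<in> hom C x y) \<and>
     (\<forall>x y f. M x y f \<longrightarrow> f \<in> hom C x y) \<and>
     (\<forall>x y f. is_iso C x y f \<longrightarrow> E x y f \<and> M x y f) \<and>
     (\<forall>x y z f g. E x y f \<longrightarrow> E y z g \<longrightarrow> E x z (cmp C g f)) \<and>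
     (\<forall>x y z f g. M x y f \<longrightarrow> M y z g \<longrightarrow> M x z (cmp C g f)) \<and>
     (\<forall>a b e x y m. E a b e \<longrightarrow> M x y m \<longrightarrow> orthogonal C a b e x y m) \<and>
     (\<forall>x y f. f \<in> hom C x y \<longrightarrow> (\<exists>z e m. E x z e \<and> M z y m \<and> f = cmp C m e))"

text \<open>
  Below, \<open>I : C \<rightarrow> D\<close> is the reflection onto a full subcategory \<open>D\<close> of \<open>C\<close>, with unit \<open>\<eta>\<close>.
\<close>

definition E_cls ::
  "('o, 'm) cat \<Rightarrow> ('o, 'm) cat \<Rightarrow> ('o, 'm, 'o, 'm) fnctr \<Rightarrow> ('o, 'm) arrow_class" where
  "E_cls C D I x y f \<longleftrightarrow> f \<in> hom C x y \<and> is_iso D (on_obj I x) (on_obj I y) (on_arr I x y f)"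

definition M_cls ::
  "('o, 'm) cat \<Rightarrow> ('o, 'm) cat \<Rightarrow> ('o, 'm, 'o, 'm) fnctr \<Rightarrow> ('o, 'm) arrow_class" where
  "M_cls C D I x y m \<longleftrightarrow>
     m \<in> hom C x y \<and> (\<forall>a b e. E_cls C D I a b e \<longrightarrow> orthogonal C a b e x y m)"

definition E'_cls ::
  "('o, 'm) cat \<Rightarrow> ('o, 'm) cat \<Rightarrow> ('o, 'm, 'o, 'm) fnctr \<Rightarrow> ('o, 'm) arrow_class" where
  "E'_cls C D I x y f \<longleftrightarrow>
     f \<in> hom C x y \<and>
     (\<forall>z g P p q. is_pullback C z x y g f P p q \<longrightarrow> E_cls C D I P z p)"

definition Mstar_cls ::
  "('o, 'm) cat \<Rightarrow> ('o, 'm) cat \<Rightarrow> ('o, 'm, 'o, 'm) fnctr \<Rightarrow> ('o, 'm) arrow_class" where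
  "Mstar_cls C D I x y f \<longleftrightarrow>
     f \<in> hom C x y \<and>
     (\<exists>E p P r q. effective_descent C E y p \<and> is_pullback C E x y p f P r q \<and> M_cls C D I P E r)"

definition stable_units ::
  "('o, 'm) cat \<Rightarrow> ('o, 'm) cat \<Rightarrow> ('o, 'm, 'o, 'm) fnctr \<Rightarrow> ('o \<Rightarrow> 'm) \<Rightarrow> bool" where
  "stable_units C D I \<eta> \<longleftrightarrow> (\<forall>x\<in>obj C. E'_cls C D I x (on_obj I x) (\<eta> x))"


section \<open>Small sets and set-valued functors\<close>

text \<open>
  The type \<open>'u\<close> plays the role of the universe and \<open>U\<close> is the collection of its small subsets.
  These are the closure properties of a Grothendieck universe that are needed here; closure under
  power sets and the axiom of infinity are not required, so that, besides
  Grothendieck universes, also the collections of all sets of cardinality at most (or below) an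
  infinite (respectively infinite regular) cardinal are covered.
\<close>

definition set_universe :: "'u set set \<Rightarrow> bool" where
  "set_universe U \<longleftrightarrow>
     infinite (UNIV :: 'u set) \<and>
     (\<forall>x y. {x, y} \<in> U) \<and>
     (\<forall>X Y. X \<in> U \<longrightarrow> Y \<subseteq> X \<longrightarrow> Y \<in> U) \<and>
     (\<forall>X (f :: 'u \<Rightarrow> 'u). X \<in> U \<longrightarrow> f ` X \<in> U) \<and>
     (\<forall>X F. X \<in> U \<longrightarrow> (\<forall>x\<in>X. F x \<in> U) \<longrightarrow> (\<Union>x\<in>X. F x) \<in> U)"

text \<open>Functions \<open>X \<rightarrow> Y\<close> are represented as partial maps with domain exactly \<open>X\<close>.\<close>

definition Set_cat :: "'u set set \<Rightarrow> ('u set, 'u \<rightharpoonup> 'u) cat" where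
  "Set_cat U =
     \<lparr> obj = U,
       hom = (\<lambda>X Y. {f. X \<in> U \<and> Y \<in> U \<and> dom f = X \<and> ran f \<subseteq> Y}),
       idn = (\<lambda>X. Some |` X),
       cmp = (\<lambda>g f. g \<circ>\<^sub>m f) \<rparr>"

definition small_category :: "'u set set \<Rightarrow> ('u, 'u) cat \<Rightarrow> bool" where
  "small_category U B \<longleftrightarrow>
     category B \<and> obj B \<in> U \<and> (\<forall>x\<in>obj B. \<forall>y\<in>obj B. hom B x y \<in> U)"

definition locally_small_category :: "'u set set \<Rightarrow> ('a, 'u) cat \<Rightarrow> bool" where
  "locally_small_category U A \<longleftrightarrow>
     category A \<and> (\<forall>x\<in>obj A. \<forall>y\<in>obj A. hom A x y \<in> U)"

type_synonym ('b, 'u) copresheaf = "('b, 'u, 'u set, 'u \<rightharpoonup> 'u) fnctr"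
type_synonym ('b, 'u) copresheaf_map = "'b \<Rightarrow> ('u \<rightharpoonup> 'u)"

abbreviation Set_pow ::
  "'u set set \<Rightarrow> ('b, 'u) cat \<Rightarrow> (('b, 'u) copresheaf, ('b, 'u) copresheaf_map) cat" where
  "Set_pow U B \<equiv> functor_cat B (Set_cat U)"

definition yoneda ::
  "('b, 'u) cat \<Rightarrow> ('b, 'u, ('b, 'u) copresheaf, ('b, 'u) copresheaf_map) fnctr" where
  "yoneda B =
     \<lparr> on_obj = (\<lambda>b. restrict_fun B
         \<lparr> on_obj = (\<lambda>c. hom B b c),
           on_arr = (\<lambda>c d f. (\<lambda>g. if g \<in> hom B b c then Some (cmp B f g) else None)) \<rparr>),
       on_arr = (\<lambda>b b' f. \<lambda>c\<in>obj B. (\<lambda>g. if g \<in> hom B b c then Some (cmp B g f) else None)) \<rparr>"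

type_synonym ('b, 'a, 'u) Kan_functor =
  "(('b, 'u) copresheaf, ('b, 'u) copresheaf_map, ('a, 'u) copresheaf, ('a, 'u) copresheaf_map) fnctr"

text \<open>
  \<open>Lan\<close> is the functor \<open>Lan\<^sub>K : Set\<^sup>B \<rightarrow> Set\<^sup>A\<close> given by left Kan extensions along \<open>K\<close>, left
  adjoint to \<open>Set\<^sup>K\<close> with unit \<open>\<theta>\<close> and counit \<open>\<epsilon>\<close>.
\<close>

definition Lan_adjunction ::
  "'u set set \<Rightarrow> ('b, 'u) cat \<Rightarrow> ('a, 'u) cat \<Rightarrow> ('b, 'u, 'a, 'u) fnctr \<Rightarrow>
   ('b, 'a, 'u) Kan_functor \<Rightarrow> (('b, 'u) copresheaf \<Rightarrow> ('b, 'u) copresheaf_map) \<Rightarrow>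
   (('a, 'u) copresheaf \<Rightarrow> ('a, 'u) copresheaf_map) \<Rightarrow> bool" where
  "Lan_adjunction U B A K Lan \<theta> \<epsilon> \<longleftrightarrow>
     adjunction (Set_pow U B) (Set_pow U A) Lan (precomp B K) \<theta> \<epsilon> \<and>
     (\<forall>M\<in>obj (Set_pow U B). is_left_Kan_extension B A (Set_cat U) K M (on_obj Lan M) (\<theta> M))"

definition Mono_cat ::
  "'u set set \<Rightarrow> ('b, 'u) cat \<Rightarrow> ('b, 'u, 'a, 'u) fnctr \<Rightarrow> ('b, 'a, 'u) Kan_functor \<Rightarrow>
   (('b, 'u) copresheaf \<Rightarrow> ('b, 'u) copresheaf_map) \<Rightarrow>
   (('b, 'u) copresheaf, ('b, 'u) copresheaf_map) cat" where
  "Mono_cat U B K Lan \<theta> =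
     full_sub (Set_pow U B)
       {M. is_mono (Set_pow U B) M (on_obj (precomp B K) (on_obj Lan M)) (\<theta> M)}"

definition induced_reflection ::
  "'u set set \<Rightarrow> ('b, 'u) cat \<Rightarrow> ('b, 'u, 'a, 'u) fnctr \<Rightarrow> ('b, 'a, 'u) Kan_functor \<Rightarrow>
   (('b, 'u) copresheaf \<Rightarrow> ('b, 'u) copresheaf_map) \<Rightarrow>
   (('b, 'u) copresheaf, ('b, 'u) copresheaf_map, ('b, 'u) copresheaf, ('b, 'u) copresheaf_map) fnctr \<Rightarrow>
   (('b, 'u) copresheaf \<Rightarrow> ('b, 'u) copresheaf_map) \<Rightarrow>
   (('b, 'u) copresheaf \<Rightarrow> ('b, 'u) copresheaf_map) \<Rightarrow> bool" where
  "induced_reflection U B K Lan \<theta> I \<eta> \<epsilon> \<longleftrightarrow>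
     adjunction (Set_pow U B) (Mono_cat U B K Lan \<theta>) I id_fun \<eta> \<epsilon> \<and>
     (\<forall>M\<in>obj (Set_pow U B).
        \<exists>\<mu>\<in>hom (Set_pow U B) (on_obj I M) (on_obj (precomp B K) (on_obj Lan M)).
          \<theta> M = cmp (Set_pow U B) \<mu> (\<eta> M) \<and>
          (\<forall>b\<in>obj B. ran (\<eta> M b) = on_obj (on_obj I M) b \<and>
                     inj_on (\<mu> b) (on_obj (on_obj I M) b)))"

end

theory Submission
  imports Defs
begin

text \<open>
  Write \<open>T = Set\<^sup>K \<circ> Lan\<^sub>K\<close>, and for a functor \<open>M : B \<rightarrow> Set\<close> call two elements of \<open>M b\<close>
  \<^emph>\<open>indistinguishable\<close> if \<open>\<theta>\<^sub>M\<close> identifies them. This is a congruence on \<open>M\<close>, all natural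
  transformations preserve it, and \<open>Mono(Lan\<^sub>K)\<close> consists of the \<open>M\<close> on which it is equality
  (\<open>separated\<close>). The whole theorem is a computation with this congruence, in which preservation of
  pullbacks by \<open>Lan\<^sub>K\<close> enters in two ways. Two elements of a pullback are indistinguishable as soon
  as both of their projections are (\<open>k_pullback\<close>). And a map \<open>e : X \<rightarrow> Y\<close> that identifies only
  indistinguishable elements reflects indistinguishability (\<open>k_reflect\<close>): \<open>\<theta>\<^sub>X\<close> equalises the two
  projections of the kernel pair of \<open>e\<close>, so \<open>Lan\<^sub>K\<close> sends both to the same map by adjointness; as
  \<open>T\<close> preserves the kernel pair, \<open>T e\<close> is injective.

  The reflection of \<open>M\<close> is its quotient by indistinguishability, which is separated by
  \<open>k_reflect\<close>. Representables are separated because \<open>Lan\<^sub>K \<circ> y\<close> is faithful, and so are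
  coproducts of representables: different summands are told apart by the map to a constant functor,
  which is a restriction along \<open>K\<close>, and inside one summand it suffices that \<open>T\<close> preserves
  injections. Hence every \<open>N\<close> has a surjection \<open>p : E \<rightarrow> N\<close> from a separated \<open>E\<close>
  (\<open>separated_cover\<close>). Pulling back along such covers describes both classes explicitly: \<open>E'\<close>
  consists of the surjections that identify only indistinguishable elements (\<open>E'_iff\<close>), and \<open>M*\<close>
  of the maps that never identify two different indistinguishable elements (\<open>Mstar_iff\<close>). The units
  are visibly of the first kind, which is the stability of the units. Given \<open>f : M \<rightarrow> N\<close>, dividing
  \<open>M\<close> by the intersection of the kernel of \<open>f\<close> with indistinguishability produces the
  factorization, and orthogonality is immediate from the descriptions.

  The description of \<open>M*\<close> uses that the effective descent morphisms of functors to sets are the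
  surjections. If \<open>p\<^sup>*\<close> is monadic then it reflects isomorphisms, and it turns the inclusion
  of the image of \<open>p\<close> into an isomorphism. Conversely, for surjective \<open>p\<close>, an algebra of the
  induced monad is a functor over \<open>E\<close> with transport along the fibres of \<open>p\<close>, and the quotient by
  this transport is the descended object.

  The adjunction itself is obtained by taking for \<open>Lan\<^sub>K M\<close> at \<open>a\<close> the set of triples
  \<open>(b, g : K b \<rightarrow> a, x \<in> M b)\<close>, two of which are identified when every map from \<open>M\<close> to a
  restriction along \<open>K\<close> makes them equal.
\<close>

section \<open>Categories, adjunctions and equivalences\<close>

lemma hom_obj:
  assumes "category C" "f \<in> hom C x y"
  shows "x \<in> obj C" "y \<in> obj C"
  using assms unfolding category_def by blast+

lemma idn_hom: "category C \<Longrightarrow> x \<in> obj C \<Longrightarrow> idn C x \<in> hom C x x"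
  unfolding category_def by blast

lemma cmp_hom: "category C \<Longrightarrow> f \<in> hom C x y \<Longrightarrow> g \<in> hom C y z \<Longrightarrow> cmp C g f \<in> hom C x z"
  unfolding category_def by blast

lemma cmp_idr: "category C \<Longrightarrow> f \<in> hom C x y \<Longrightarrow> cmp C f (idn C x) = f"
  unfolding category_def by blast

lemma cmp_idl: "category C \<Longrightarrow> f \<in> hom C x y \<Longrightarrow> cmp C (idn C y) f = f"
  unfolding category_def by blast

lemma cmp_assoc:
  assumes "category C" "f \<in> hom C w x" "g \<in> hom C x y" "h \<in> hom C y z"
  shows "cmp C (cmp C h g) f = cmp C h (cmp C g f)"
proof -
  have "\<forall>w x y z f g h. f \<in> hom C w x \<longrightarrow> g \<in> hom C x y \<longrightarrow> h \<in> hom C y z \<longrightarrow>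
        cmp C h (cmp C g f) = cmp C (cmp C h g) f"
    using assms(1) unfolding category_def by blast
  then show ?thesis using assms(2-4) by metis
qed

lemma functor_obj: "is_functor C D F \<Longrightarrow> x \<in> obj C \<Longrightarrow> on_obj F x \<in> obj D"
  unfolding is_functor_def by blast

lemma functor_hom:
  "is_functor C D F \<Longrightarrow> f \<in> hom C x y \<Longrightarrow> on_arr F x y f \<in> hom D (on_obj F x) (on_obj F y)"
  unfolding is_functor_def by blast

lemma functor_idn:
  "is_functor C D F \<Longrightarrow> x \<in> obj C \<Longrightarrow> on_arr F x x (idn C x) = idn D (on_obj F x)"
  unfolding is_functor_def by blast

lemma functor_cmp:
  "is_functor C D F \<Longrightarrow> f \<in> hom C x y \<Longrightarrow> g \<in> hom C y z \<Longrightarrow>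
   on_arr F x z (cmp C g f) = cmp D (on_arr F y z g) (on_arr F x y f)"
  unfolding is_functor_def by blast

lemma comp_fun_simps [simp]:
  "on_obj (comp_fun G F) x = on_obj G (on_obj F x)"
  "on_arr (comp_fun G F) x y f = on_arr G (on_obj F x) (on_obj F y) (on_arr F x y f)"
  by (simp_all add: comp_fun_def)

lemma id_fun_simps [simp]: "on_obj id_fun x = x" "on_arr id_fun x y f = f"
  by (simp_all add: id_fun_def)

lemma is_functor_comp:
  assumes "is_functor C D F" "is_functor D E G"
  shows "is_functor C E (comp_fun G F)"
  using assms unfolding is_functor_def comp_fun_simps by metis

text \<open>
  The left adjoint acts on \<open>f : x \<rightarrow> y\<close> by factoring \<open>\<eta> y \<circ> f\<close> through \<open>\<eta> x\<close>, and the counit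
  factors identities; every law to be checked is an equation between maps out of some \<open>L x\<close>, which
  the uniqueness of factorizations reduces to an equation after composition with \<open>\<eta> x\<close>.
\<close>

lemma adjunction_from_universal_arrows:
  assumes C: "category C" and D: "category D" and R: "is_functor D C R"
    and L: "\<And>x. x \<in> obj C \<Longrightarrow> L x \<in> obj D"
    and \<eta>: "\<And>x. x \<in> obj C \<Longrightarrow> \<eta> x \<in> hom C x (on_obj R (L x))"
    and univ: "\<And>x y f. x \<in> obj C \<Longrightarrow> y \<in> obj D \<Longrightarrow> f \<in> hom C x (on_obj R y) \<Longrightarrow>
      \<exists>!g. g \<in> hom D (L x) y \<and> cmp C (on_arr R (L x) y g) (\<eta> x) = f"
  shows "\<exists>F \<epsilon>. on_obj F = L \<and> adjunction C D F R \<eta> \<epsilon>"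
proof -
  let ?P = "\<lambda>x y f g. g \<in> hom D (L x) y \<and> cmp C (on_arr R (L x) y g) (\<eta> x) = f"
  define tr where "tr x y f = (THE g. ?P x y f g)" for x y f
  have tr: "?P x y f (tr x y f)" if "x \<in> obj C" "y \<in> obj D" "f \<in> hom C x (on_obj R y)" for x y f
    using theI'[OF univ[OF that]] unfolding tr_def .
  have tr_hom: "tr x y f \<in> hom D (L x) y"
    if "x \<in> obj C" "y \<in> obj D" "f \<in> hom C x (on_obj R y)" for x y f
    using tr[OF that] by blast
  have tr_eq: "cmp C (on_arr R (L x) y (tr x y f)) (\<eta> x) = f"
    if "x \<in> obj C" "y \<in> obj D" "f \<in> hom C x (on_obj R y)" for x y f
    using tr[OF that] by blast
  have uniq: "g = h"
    if x: "x \<in> obj C" and g: "g \<in> hom D (L x) y" and h: "h \<in> hom D (L x) y"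
      and e: "cmp C (on_arr R (L x) y g) (\<eta> x) = cmp C (on_arr R (L x) y h) (\<eta> x)" for x y g h
  proof -
    have y: "y \<in> obj D" using hom_obj[OF D g] by blast
    have "cmp C (on_arr R (L x) y h) (\<eta> x) \<in> hom C x (on_obj R y)"
      using cmp_hom[OF C \<eta>[OF x] functor_hom[OF R h]] .
    from univ[OF x y this] show ?thesis using g h e by blast
  qed
  have R2: "cmp C (on_arr R (L x) z (cmp D h g)) (\<eta> x) =
            cmp C (on_arr R y z h) (cmp C (on_arr R (L x) y g) (\<eta> x))"
    if x: "x \<in> obj C" and g: "g \<in> hom D (L x) y" and h: "h \<in> hom D y z" for x y z g h
    using functor_cmp[OF R g h] cmp_assoc[OF C \<eta>[OF x] functor_hom[OF R g] functor_hom[OF R h]]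
    by simp
  define F :: "('a, 'b, 'c, 'd) fnctr"
    where "F = \<lparr> on_obj = L, on_arr = (\<lambda>x y f. tr x (L y) (cmp C (\<eta> y) f)) \<rparr>"
  define \<epsilon> where "\<epsilon> y = tr (on_obj R y) y (idn C (on_obj R y))" for y
  have FL [simp]: "on_obj F = L" by (simp add: F_def)
  have Fa: "on_arr F x y f = tr x (L y) (cmp C (\<eta> y) f)" for x y f by (simp add: F_def)
  have nf: "cmp C (\<eta> y) f \<in> hom C x (on_obj R (L y))" if "f \<in> hom C x y" for x y f
    using cmp_hom[OF C that \<eta>] hom_obj[OF C that] by blast
  have Fhom: "on_arr F x y f \<in> hom D (L x) (L y)" if f: "f \<in> hom C x y" for x y f
    unfolding Fa using tr_hom[OF _ L nf[OF f]] hom_obj[OF C f] by blast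
  have Feq: "cmp C (on_arr R (L x) (L y) (on_arr F x y f)) (\<eta> x) = cmp C (\<eta> y) f"
    if f: "f \<in> hom C x y" for x y f
    unfolding Fa using tr_eq[OF _ L nf[OF f]] hom_obj[OF C f] by blast
  have Ro: "on_obj R y \<in> obj C" if "y \<in> obj D" for y using functor_obj[OF R that] .
  have ehom: "\<epsilon> y \<in> hom D (L (on_obj R y)) y" if y: "y \<in> obj D" for y
    unfolding \<epsilon>_def using tr_hom[OF Ro[OF y] y idn_hom[OF C Ro[OF y]]] .
  have eeq: "cmp C (on_arr R (L (on_obj R y)) y (\<epsilon> y)) (\<eta> (on_obj R y)) = idn C (on_obj R y)"
    if y: "y \<in> obj D" for y
    unfolding \<epsilon>_def using tr_eq[OF Ro[OF y] y idn_hom[OF C Ro[OF y]]] .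
  have "is_functor C D F"
    unfolding is_functor_def
  proof (intro conjI allI impI ballI)
    fix x assume x: "x \<in> obj C"
    show "on_obj F x \<in> obj D" using L[OF x] by simp
    show "on_arr F x x (idn C x) = idn D (on_obj F x)"
    proof (rule uniq[OF x])
      show "on_arr F x x (idn C x) \<in> hom D (L x) (L x)" using Fhom[OF idn_hom[OF C x]] .
      show "idn D (on_obj F x) \<in> hom D (L x) (L x)" using idn_hom[OF D L[OF x]] by simp
      show "cmp C (on_arr R (L x) (L x) (on_arr F x x (idn C x))) (\<eta> x) =
            cmp C (on_arr R (L x) (L x) (idn D (on_obj F x))) (\<eta> x)"
        using Feq[OF idn_hom[OF C x]] cmp_idr[OF C \<eta>[OF x]] cmp_idl[OF C \<eta>[OF x]]
          functor_idn[OF R L[OF x]] by simp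
    qed
  next
    fix x y f assume "f \<in> hom C x y"
    then show "on_arr F x y f \<in> hom D (on_obj F x) (on_obj F y)" using Fhom by simp
  next
    fix x y z f g assume f: "f \<in> hom C x y" and g: "g \<in> hom C y z"
    note gf = cmp_hom[OF C f g]
    note x = hom_obj(1)[OF C f] and y = hom_obj(2)[OF C f] and z = hom_obj(2)[OF C g]
    show "on_arr F x z (cmp C g f) = cmp D (on_arr F y z g) (on_arr F x y f)"
    proof (rule uniq[OF x Fhom[OF gf] cmp_hom[OF D Fhom[OF f] Fhom[OF g]]])
      have "cmp C (on_arr R (L x) (L z) (cmp D (on_arr F y z g) (on_arr F x y f))) (\<eta> x) =
          cmp C (on_arr R (L y) (L z) (on_arr F y z g)) (cmp C (\<eta> y) f)"
        using R2[OF x Fhom[OF f] Fhom[OF g]] Feq[OF f] by simp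
      also have "\<dots> = cmp C (cmp C (\<eta> z) g) f"
        using cmp_assoc[OF C f \<eta>[OF y] functor_hom[OF R Fhom[OF g]]] Feq[OF g] by simp
      also have "\<dots> = cmp C (\<eta> z) (cmp C g f)" using cmp_assoc[OF C f g \<eta>[OF z]] .
      finally show "cmp C (on_arr R (L x) (L z) (on_arr F x z (cmp C g f))) (\<eta> x) =
         cmp C (on_arr R (L x) (L z) (cmp D (on_arr F y z g) (on_arr F x y f))) (\<eta> x)"
        using Feq[OF gf] by simp
    qed
  qed
  moreover have "nat_trans C C id_fun (comp_fun R F) \<eta>"
    unfolding nat_trans_def using \<eta> Feq by simp
  moreover have "nat_trans D D (comp_fun F R) id_fun \<epsilon>"
    unfolding nat_trans_def
  proof (intro conjI allI impI ballI)
    fix y assume "y \<in> obj D"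
    then show "\<epsilon> y \<in> hom D (on_obj (comp_fun F R) y) (on_obj id_fun y)" using ehom by simp
  next
    fix x y f assume f: "f \<in> hom D x y"
    note x = hom_obj(1)[OF D f] and y = hom_obj(2)[OF D f]
    note Rf = functor_hom[OF R f]
    have "cmp D (\<epsilon> y) (on_arr F (on_obj R x) (on_obj R y) (on_arr R x y f)) = cmp D f (\<epsilon> x)"
    proof (rule uniq[OF Ro[OF x] cmp_hom[OF D Fhom[OF Rf] ehom[OF y]] cmp_hom[OF D ehom[OF x] f]])
      show "cmp C (on_arr R (L (on_obj R x)) y
            (cmp D (\<epsilon> y) (on_arr F (on_obj R x) (on_obj R y) (on_arr R x y f)))) (\<eta> (on_obj R x)) =
        cmp C (on_arr R (L (on_obj R x)) y (cmp D f (\<epsilon> x))) (\<eta> (on_obj R x))"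
        using R2[OF Ro[OF x] Fhom[OF Rf] ehom[OF y]] Feq[OF Rf] R2[OF Ro[OF x] ehom[OF x] f]
          eeq[OF x] eeq[OF y] cmp_idr[OF C Rf] cmp_idl[OF C Rf]
          cmp_assoc[OF C Rf \<eta>[OF Ro[OF y]] functor_hom[OF R ehom[OF y]]] by simp
    qed
    then show "cmp D (\<epsilon> y) (on_arr (comp_fun F R) x y f) = cmp D (on_arr id_fun x y f) (\<epsilon> x)"
      by simp
  qed
  moreover have "cmp D (\<epsilon> (on_obj F x)) (on_arr F x (on_obj R (on_obj F x)) (\<eta> x)) = idn D (on_obj F x)"
    if x: "x \<in> obj C" for x
  proof -
    have "cmp D (\<epsilon> (L x)) (on_arr F x (on_obj R (L x)) (\<eta> x)) = idn D (L x)"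
    proof (rule uniq[OF x cmp_hom[OF D Fhom[OF \<eta>[OF x]] ehom[OF L[OF x]]] idn_hom[OF D L[OF x]]])
      show "cmp C (on_arr R (L x) (L x) (cmp D (\<epsilon> (L x)) (on_arr F x (on_obj R (L x)) (\<eta> x)))) (\<eta> x) =
        cmp C (on_arr R (L x) (L x) (idn D (L x))) (\<eta> x)"
        using R2[OF x Fhom[OF \<eta>[OF x]] ehom[OF L[OF x]]] Feq[OF \<eta>[OF x]] eeq[OF L[OF x]]
          cmp_assoc[OF C \<eta>[OF x] \<eta>[OF Ro[OF L[OF x]]] functor_hom[OF R ehom[OF L[OF x]]]]
          functor_idn[OF R L[OF x]] by simp
    qed
    then show ?thesis by simp
  qed
  ultimately have "adjunction C D F R \<eta> \<epsilon>"
    unfolding adjunction_def using R eeq by simp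
  then show ?thesis using FL by blast
qed

lemma adjunctionD:
  assumes "adjunction C D L R \<eta> \<epsilon>"
  shows "is_functor C D L" "is_functor D C R"
    "x \<in> obj C \<Longrightarrow> \<eta> x \<in> hom C x (on_obj R (on_obj L x))"
    "f \<in> hom C x x' \<Longrightarrow> cmp C (\<eta> x') f = cmp C (on_arr R (on_obj L x) (on_obj L x') (on_arr L x x' f)) (\<eta> x)"
    "y \<in> obj D \<Longrightarrow> \<epsilon> y \<in> hom D (on_obj L (on_obj R y)) y"
    "g \<in> hom D y y' \<Longrightarrow> cmp D (\<epsilon> y') (on_arr L (on_obj R y) (on_obj R y') (on_arr R y y' g)) = cmp D g (\<epsilon> y)"
    "x \<in> obj C \<Longrightarrow> cmp D (\<epsilon> (on_obj L x)) (on_arr L x (on_obj R (on_obj L x)) (\<eta> x)) = idn D (on_obj L x)"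
    "y \<in> obj D \<Longrightarrow> cmp C (on_arr R (on_obj L (on_obj R y)) y (\<epsilon> y)) (\<eta> (on_obj R y)) = idn C (on_obj R y)"
  using assms unfolding adjunction_def nat_trans_def by auto

text \<open>
  A choice of isomorphisms \<open>s y : y \<rightarrow> F (g y)\<close> is a choice of universal arrows, as \<open>F\<close> is fully
  faithful. So \<open>g\<close> extends to a left adjoint of \<open>F\<close>; its unit \<open>s\<close> is invertible, and hence so is
  its counit.
\<close>
lemma equivalence_if_fully_faithful_and_essentially_surjective:
  assumes C: "category C" and D: "category D" and F: "is_functor C D F"
    and ff: "\<And>x y h. x \<in> obj C \<Longrightarrow> y \<in> obj C \<Longrightarrow> h \<in> hom D (on_obj F x) (on_obj F y) \<Longrightarrow>
      \<exists>!g. g \<in> hom C x y \<and> on_arr F x y g = h"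
    and es: "\<And>y. y \<in> obj D \<Longrightarrow> \<exists>x\<in>obj C. \<exists>t. is_iso D (on_obj F x) y t"
  shows "is_equivalence C D F"
proof -
  have "\<forall>y\<in>obj D. \<exists>x t s. x \<in> obj C \<and> t \<in> hom D (on_obj F x) y \<and> s \<in> hom D y (on_obj F x) \<and>
      cmp D s t = idn D (on_obj F x) \<and> cmp D t s = idn D y"
    using es unfolding is_iso_def by blast
  then obtain g t s where g: "\<And>y. y \<in> obj D \<Longrightarrow> g y \<in> obj C"
    and t: "\<And>y. y \<in> obj D \<Longrightarrow> t y \<in> hom D (on_obj F (g y)) y"
    and s: "\<And>y. y \<in> obj D \<Longrightarrow> s y \<in> hom D y (on_obj F (g y))"
    and st: "\<And>y. y \<in> obj D \<Longrightarrow> cmp D (s y) (t y) = idn D (on_obj F (g y))"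
    and ts: "\<And>y. y \<in> obj D \<Longrightarrow> cmp D (t y) (s y) = idn D y" by metis
  have inj: "k = k'" if k: "k \<in> hom C x y" and k': "k' \<in> hom C x y"
    and "on_arr F x y k = on_arr F x y k'" for x y k k'
    using ff[OF hom_obj[OF C k] functor_hom[OF F k']] k k' that by blast
  have cancel1: "cmp D (cmp D f (s y)) (t y) = f"
    if "y \<in> obj D" "f \<in> hom D (on_obj F (g y)) z" for y z f
    using cmp_assoc[OF D t[OF that(1)] s[OF that(1)] that(2)] st[OF that(1)] cmp_idr[OF D that(2)] by metis
  have cancel2: "cmp D (cmp D f (t y)) (s y) = f" if "y \<in> obj D" "f \<in> hom D y z" for y z f
    using cmp_assoc[OF D s[OF that(1)] t[OF that(1)] that(2)] ts[OF that(1)] cmp_idr[OF D that(2)] by metis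
  have "\<exists>G \<epsilon>. on_obj G = g \<and> adjunction D C G F s \<epsilon>"
  proof (rule adjunction_from_universal_arrows[OF D C F g s])
    fix y x f assume y: "y \<in> obj D" and x: "x \<in> obj C" and f: "f \<in> hom D y (on_obj F x)"
    note ft = cmp_hom[OF D t[OF y] f]
    obtain k where k: "k \<in> hom C (g y) x" "on_arr F (g y) x k = cmp D f (t y)"
      using ff[OF g[OF y] x ft] by blast
    show "\<exists>!k. k \<in> hom C (g y) x \<and> cmp D (on_arr F (g y) x k) (s y) = f"
    proof (intro ex1I conjI)
      show "k \<in> hom C (g y) x" "cmp D (on_arr F (g y) x k) (s y) = f"
        using k cancel2[OF y f] by simp_all
      fix l assume l: "l \<in> hom C (g y) x \<and> cmp D (on_arr F (g y) x l) (s y) = f"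
      then have "on_arr F (g y) x l = cmp D f (t y)"
        using cancel1[OF y functor_hom[OF F conjunct1[OF l]]] by metis
      then show "l = k" using inj[of l "g y" x k] l k by metis
    qed
  qed
  then obtain G \<epsilon> where Gg: "on_obj G = g" and adj: "adjunction D C G F s \<epsilon>" by blast
  note a = adjunctionD[OF adj, unfolded Gg]
  have "nat_iso C C (comp_fun G F) id_fun \<epsilon>"
    unfolding nat_iso_def
  proof (intro conjI ballI)
    show "nat_trans C C (comp_fun G F) id_fun \<epsilon>" using adj unfolding adjunction_def by blast
    fix x assume x: "x \<in> obj C"
    note Fx = functor_obj[OF F x] and e = a(5)[OF x]
    note Fe = functor_hom[OF F e]
    obtain r where r: "r \<in> hom C x (g (on_obj F x))" "on_arr F x (g (on_obj F x)) r = s (on_obj F x)"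
      using ff[OF x g[OF Fx] s[OF Fx]] by blast
    \<comment> \<open>By a triangle identity \<open>F \<epsilon>\<close> is left inverse to the isomorphism \<open>s\<close>, so it is \<open>t\<close>.\<close>
    have Fet: "on_arr F (g (on_obj F x)) x (\<epsilon> x) = t (on_obj F x)"
      using cancel1[OF Fx Fe] a(8)[OF x] cmp_idl[OF D t[OF Fx]] by metis
    have "cmp C r (\<epsilon> x) = idn C (g (on_obj F x))"
      by (rule inj[OF cmp_hom[OF C e r(1)] idn_hom[OF C g[OF Fx]]])
        (metis functor_cmp[OF F e r(1)] r(2) Fet st[OF Fx] functor_idn[OF F g[OF Fx]])
    moreover have "cmp C (\<epsilon> x) r = idn C x"
      by (rule inj[OF cmp_hom[OF C r(1) e] idn_hom[OF C x]])
        (metis functor_cmp[OF F r(1) e] r(2) Fet ts[OF Fx] functor_idn[OF F x])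
    ultimately show "is_iso C (on_obj (comp_fun G F) x) (on_obj id_fun x) (\<epsilon> x)"
      unfolding is_iso_def using e r(1) Gg by auto
  qed
  moreover have "nat_iso D D (comp_fun F G) id_fun t"
    unfolding nat_iso_def nat_trans_def
  proof (intro conjI ballI allI impI)
    fix y assume y: "y \<in> obj D"
    show "t y \<in> hom D (on_obj (comp_fun F G) y) (on_obj id_fun y)" using t[OF y] Gg by simp
    show "is_iso D (on_obj (comp_fun F G) y) (on_obj id_fun y) (t y)"
      unfolding is_iso_def using t[OF y] s[OF y] st[OF y] ts[OF y] Gg by auto
  next
    fix y z h assume h: "h \<in> hom D y z"
    note y = hom_obj(1)[OF D h] and z = hom_obj(2)[OF D h]
    let ?k = "on_arr F (g y) (g z) (on_arr G y z h)"
    have k: "?k \<in> hom D (on_obj F (g y)) (on_obj F (g z))"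
      using functor_hom[OF F functor_hom[OF a(1) h]] Gg by simp
    have "cmp D (cmp D (t z) ?k) (s y) = h"
      using cmp_assoc[OF D s[OF y] k t[OF z]] a(4)[OF h] cmp_assoc[OF D h s[OF z] t[OF z]] ts[OF z]
        cmp_idl[OF D h] by metis
    then have "cmp D (t z) ?k = cmp D h (t y)" using cancel1[OF y cmp_hom[OF D k t[OF z]]] by metis
    then show "cmp D (t z) (on_arr (comp_fun F G) y z h) = cmp D (on_arr id_fun y z h) (t y)"
      using Gg by simp
  qed
  ultimately show ?thesis unfolding is_equivalence_def using F a(1) by blast
qed

text \<open>
  The inverse of \<open>G F f\<close> is transported back along the natural isomorphism \<open>G F \<cong> 1\<close>.
\<close>

lemma equivalence_reflects_iso:
  assumes C: "category C" and D: "category D" and F: "is_equivalence C D F"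
    and f: "f \<in> hom C x y" and iso: "is_iso D (on_obj F x) (on_obj F y) (on_arr F x y f)"
  shows "is_iso C x y f"
proof -
  obtain G \<sigma> where FF: "is_functor C D F" and G: "is_functor D C G"
    and \<sigma>: "nat_iso C C (comp_fun G F) id_fun \<sigma>"
    using F unfolding is_equivalence_def by blast
  note x = hom_obj(1)[OF C f] and y = hom_obj(2)[OF C f]
  obtain h where h: "h \<in> hom D (on_obj F y) (on_obj F x)"
    "cmp D h (on_arr F x y f) = idn D (on_obj F x)" "cmp D (on_arr F x y f) h = idn D (on_obj F y)"
    using iso unfolding is_iso_def by blast
  note Ff = functor_hom[OF FF f]
  define Gf where "Gf = on_arr G (on_obj F x) (on_obj F y) (on_arr F x y f)"
  define Gh where "Gh = on_arr G (on_obj F y) (on_obj F x) h"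
  let ?Gx = "on_obj G (on_obj F x)" and ?Gy = "on_obj G (on_obj F y)"
  have Gf: "Gf \<in> hom C ?Gx ?Gy" unfolding Gf_def using functor_hom[OF G Ff] .
  have Gh: "Gh \<in> hom C ?Gy ?Gx" unfolding Gh_def using functor_hom[OF G h(1)] .
  have 1: "cmp C Gh Gf = idn C ?Gx" "cmp C Gf Gh = idn C ?Gy"
    unfolding Gf_def Gh_def
    using functor_cmp[OF G Ff h(1)] functor_cmp[OF G h(1) Ff] h functor_idn[OF G] functor_obj[OF FF] x y
    by simp_all
  have \<sigma>h: "\<sigma> z \<in> hom C (on_obj G (on_obj F z)) z"
    "\<exists>r\<in>hom C z (on_obj G (on_obj F z)). cmp C r (\<sigma> z) = idn C (on_obj G (on_obj F z)) \<and> cmp C (\<sigma> z) r = idn C z"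
    if "z \<in> obj C" for z
    using \<sigma> that unfolding nat_iso_def nat_trans_def is_iso_def by auto
  obtain rx where rx: "rx \<in> hom C x ?Gx" "cmp C rx (\<sigma> x) = idn C ?Gx" "cmp C (\<sigma> x) rx = idn C x"
    using \<sigma>h(2)[OF x] by blast
  obtain ry where ry: "ry \<in> hom C y ?Gy" "cmp C ry (\<sigma> y) = idn C ?Gy" "cmp C (\<sigma> y) ry = idn C y"
    using \<sigma>h(2)[OF y] by blast
  note sx = \<sigma>h(1)[OF x] and sy = \<sigma>h(1)[OF y]
  have nat: "cmp C (\<sigma> y) Gf = cmp C f (\<sigma> x)"
    using \<sigma> f unfolding nat_iso_def nat_trans_def Gf_def by auto
  define k where "k = cmp C (\<sigma> x) (cmp C Gh ry)"
  have Ghry: "cmp C Gh ry \<in> hom C y ?Gx" using cmp_hom[OF C ry(1) Gh] .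
  have k: "k \<in> hom C y x" unfolding k_def using cmp_hom[OF C Ghry sx] .
  have "cmp C f k = cmp C (cmp C (\<sigma> y) Gf) (cmp C Gh ry)"
    unfolding k_def nat using cmp_assoc[OF C Ghry sx f] by simp
  also have "\<dots> = cmp C (\<sigma> y) (cmp C (cmp C Gf Gh) ry)"
    using cmp_assoc[OF C Ghry Gf sy] cmp_assoc[OF C ry(1) Gh Gf] by simp
  also have "\<dots> = idn C y" using 1 ry cmp_idl[OF C ry(1)] by simp
  finally have fk: "cmp C f k = idn C y" .
  have "cmp C ry f = cmp C (cmp C ry f) (cmp C (\<sigma> x) rx)"
    using rx(3) cmp_idr[OF C cmp_hom[OF C f ry(1)]] by simp
  also have "\<dots> = cmp C ry (cmp C (cmp C (\<sigma> y) Gf) rx)"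
    unfolding nat using cmp_assoc[OF C cmp_hom[OF C rx(1) sx] f ry(1)] cmp_assoc[OF C rx(1) sx f] by simp
  also have "\<dots> = cmp C (cmp C ry (\<sigma> y)) (cmp C Gf rx)"
    using cmp_assoc[OF C rx(1) Gf sy] cmp_assoc[OF C cmp_hom[OF C rx(1) Gf] sy ry(1)] by simp
  also have "\<dots> = cmp C Gf rx" using ry(2) cmp_idl[OF C cmp_hom[OF C rx(1) Gf]] by simp
  finally have ryf: "cmp C ry f = cmp C Gf rx" .
  have "cmp C k f = cmp C (\<sigma> x) (cmp C Gh (cmp C ry f))"
    unfolding k_def using cmp_assoc[OF C f Ghry sx] cmp_assoc[OF C f ry(1) Gh] by simp
  also have "\<dots> = cmp C (\<sigma> x) (cmp C (cmp C Gh Gf) rx)"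
    unfolding ryf using cmp_assoc[OF C rx(1) Gf Gh] by simp
  also have "\<dots> = idn C x" using 1 rx cmp_idl[OF C rx(1)] by simp
  finally show ?thesis unfolding is_iso_def using f k fk by blast
qed

section \<open>Algebras and the comparison functor\<close>

lemma category_EM_cat:
  assumes D: "category D" and T: "is_functor D D T"
  shows "category (EM_cat D T \<eta> \<mu>)"
  unfolding category_def
proof (intro conjI allI impI ballI)
  fix x y f assume "f \<in> hom (EM_cat D T \<eta> \<mu>) x y"
  then show "x \<in> obj (EM_cat D T \<eta> \<mu>)" "y \<in> obj (EM_cat D T \<eta> \<mu>)"
    by (auto simp: EM_cat_def)
next
  fix x assume x: "x \<in> obj (EM_cat D T \<eta> \<mu>)"
  then have 1: "fst x \<in> obj D" "snd x \<in> hom D (on_obj T (fst x)) (fst x)"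
    by (auto simp: EM_cat_def EM_algebras_def)
  then show "idn (EM_cat D T \<eta> \<mu>) x \<in> hom (EM_cat D T \<eta> \<mu>) x x"
    using x idn_hom[OF D 1(1)] functor_idn[OF T 1(1)] cmp_idl[OF D 1(2)] cmp_idr[OF D 1(2)]
    by (simp add: EM_cat_def)
next
  fix x y z f g assume f: "f \<in> hom (EM_cat D T \<eta> \<mu>) x y" and g: "g \<in> hom (EM_cat D T \<eta> \<mu>) y z"
  have xyz: "x \<in> EM_algebras D T \<eta> \<mu>" "y \<in> EM_algebras D T \<eta> \<mu>" "z \<in> EM_algebras D T \<eta> \<mu>"
    using f g by (auto simp: EM_cat_def)
  have a: "snd w \<in> hom D (on_obj T (fst w)) (fst w)" if "w \<in> EM_algebras D T \<eta> \<mu>" for w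
    using that by (auto simp: EM_algebras_def)
  have f1: "f \<in> hom D (fst x) (fst y)" and f2: "cmp D f (snd x) = cmp D (snd y) (on_arr T (fst x) (fst y) f)"
    using f by (auto simp: EM_cat_def)
  have g1: "g \<in> hom D (fst y) (fst z)" and g2: "cmp D g (snd y) = cmp D (snd z) (on_arr T (fst y) (fst z) g)"
    using g by (auto simp: EM_cat_def)
  have "cmp D (cmp D g f) (snd x) = cmp D (snd z) (on_arr T (fst x) (fst z) (cmp D g f))"
    using cmp_assoc[OF D a[OF xyz(1)] f1 g1] f2 cmp_assoc[OF D functor_hom[OF T f1] a[OF xyz(2)] g1]
      g2 cmp_assoc[OF D functor_hom[OF T f1] functor_hom[OF T g1] a[OF xyz(3)]] functor_cmp[OF T f1 g1]
    by simp
  then show "cmp (EM_cat D T \<eta> \<mu>) g f \<in> hom (EM_cat D T \<eta> \<mu>) x z"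
    using xyz cmp_hom[OF D f1 g1] by (simp add: EM_cat_def)
next
  fix x y f assume "f \<in> hom (EM_cat D T \<eta> \<mu>) x y"
  then have "f \<in> hom D (fst x) (fst y)" by (auto simp: EM_cat_def)
  then show "cmp (EM_cat D T \<eta> \<mu>) f (idn (EM_cat D T \<eta> \<mu>) x) = f"
    "cmp (EM_cat D T \<eta> \<mu>) (idn (EM_cat D T \<eta> \<mu>) y) f = f"
    using cmp_idl[OF D] cmp_idr[OF D] by (auto simp: EM_cat_def)
next
  fix w x y z f g h
  assume "f \<in> hom (EM_cat D T \<eta> \<mu>) w x" "g \<in> hom (EM_cat D T \<eta> \<mu>) x y" "h \<in> hom (EM_cat D T \<eta> \<mu>) y z"
  then have "f \<in> hom D (fst w) (fst x)" "g \<in> hom D (fst x) (fst y)" "h \<in> hom D (fst y) (fst z)"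
    by (auto simp: EM_cat_def)
  from cmp_assoc[OF D this]
  show "cmp (EM_cat D T \<eta> \<mu>) h (cmp (EM_cat D T \<eta> \<mu>) g f) = cmp (EM_cat D T \<eta> \<mu>) (cmp (EM_cat D T \<eta> \<mu>) h g) f"
    by (simp add: EM_cat_def)
qed

lemma comparison_functor:
  assumes C: "category C" and D: "category D" and adj: "adjunction D C L R \<eta> \<epsilon>"
  shows "is_functor C (EM_cat D (comp_fun R L) \<eta> (monad_mult L R \<epsilon>)) (comparison L R \<epsilon>)"
proof -
  note a = adjunctionD[OF adj]
  let ?E = "EM_algebras D (comp_fun R L) \<eta> (monad_mult L R \<epsilon>)"
  let ?s = "\<lambda>c. on_arr R (on_obj L (on_obj R c)) c (\<epsilon> c)"
  have alg: "(on_obj R c, ?s c) \<in> ?E" if c: "c \<in> obj C" for c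
  proof -
    note Rc = functor_obj[OF a(2) c] and e = a(5)[OF c]
    have "?s c \<in> hom D (on_obj R (on_obj L (on_obj R c))) (on_obj R c)"
      using functor_hom[OF a(2) e] .
    moreover have "cmp D (?s c) (on_arr R (on_obj L (on_obj R (on_obj L (on_obj R c)))) (on_obj L (on_obj R c))
        (on_arr L (on_obj R (on_obj L (on_obj R c))) (on_obj R c) (?s c))) =
      cmp D (?s c) (on_arr R (on_obj L (on_obj R (on_obj L (on_obj R c)))) (on_obj L (on_obj R c)) (\<epsilon> (on_obj L (on_obj R c))))"
      using a(6)[OF e] functor_cmp[OF a(2) functor_hom[OF a(1) functor_hom[OF a(2) e]] e]
        functor_cmp[OF a(2) a(5)[OF functor_obj[OF a(1) Rc]] e] by simp
    ultimately show ?thesis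
      unfolding EM_algebras_def using Rc a(8)[OF c] by (simp add: monad_mult_def)
  qed
  show ?thesis
    unfolding is_functor_def
  proof (intro conjI allI impI ballI)
    fix x assume x: "x \<in> obj C"
    show "on_obj (comparison L R \<epsilon>) x \<in> obj (EM_cat D (comp_fun R L) \<eta> (monad_mult L R \<epsilon>))"
      using alg[OF x] by (simp add: EM_cat_def comparison_def)
    show "on_arr (comparison L R \<epsilon>) x x (idn C x) =
      idn (EM_cat D (comp_fun R L) \<eta> (monad_mult L R \<epsilon>)) (on_obj (comparison L R \<epsilon>) x)"
      using functor_idn[OF a(2) x] by (simp add: EM_cat_def comparison_def)
  next
    fix x y f assume f: "f \<in> hom C x y"
    note x = hom_obj(1)[OF C f] and y = hom_obj(2)[OF C f]
    have "cmp D (on_arr R x y f) (?s x) =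
      cmp D (?s y) (on_arr R (on_obj L (on_obj R x)) (on_obj L (on_obj R y)) (on_arr L (on_obj R x) (on_obj R y) (on_arr R x y f)))"
      using a(6)[OF f] functor_cmp[OF a(2) a(5)[OF x] f]
        functor_cmp[OF a(2) functor_hom[OF a(1) functor_hom[OF a(2) f]] a(5)[OF y]] by simp
    then show "on_arr (comparison L R \<epsilon>) x y f \<in> hom (EM_cat D (comp_fun R L) \<eta> (monad_mult L R \<epsilon>))
        (on_obj (comparison L R \<epsilon>) x) (on_obj (comparison L R \<epsilon>) y)"
      using alg[OF x] alg[OF y] functor_hom[OF a(2) f] by (simp add: EM_cat_def comparison_def)
  next
    fix x y z f g assume f: "f \<in> hom C x y" and g: "g \<in> hom C y z"
    show "on_arr (comparison L R \<epsilon>) x z (cmp C g f) = cmp (EM_cat D (comp_fun R L) \<eta> (monad_mult L R \<epsilon>))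
        (on_arr (comparison L R \<epsilon>) y z g) (on_arr (comparison L R \<epsilon>) x y f)"
      using functor_cmp[OF a(2) f g] by (simp add: EM_cat_def comparison_def)
  qed
qed

text \<open>
  This serves twice: for the reflection of isomorphisms by monadic functors, and to recognise
  descended objects by comparing underlying objects.
\<close>

lemma EM_iso_if_iso:
  assumes D: "category D" and T: "is_functor D D T"
    and h: "h \<in> hom (EM_cat D T \<eta> \<mu>) X Y" and iso: "is_iso D (fst X) (fst Y) h"
  shows "is_iso (EM_cat D T \<eta> \<mu>) X Y h"
proof -
  obtain k where k: "k \<in> hom D (fst Y) (fst X)" "cmp D k h = idn D (fst X)" "cmp D h k = idn D (fst Y)"
    using iso unfolding is_iso_def by blast
  have XY: "X \<in> EM_algebras D T \<eta> \<mu>" "Y \<in> EM_algebras D T \<eta> \<mu>" and h1: "h \<in> hom D (fst X) (fst Y)"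
    and h2: "cmp D h (snd X) = cmp D (snd Y) (on_arr T (fst X) (fst Y) h)"
    using h by (auto simp: EM_cat_def)
  have a: "snd w \<in> hom D (on_obj T (fst w)) (fst w)" if "w \<in> EM_algebras D T \<eta> \<mu>" for w
    using that by (auto simp: EM_algebras_def)
  note Th = functor_hom[OF T h1] and Tk = functor_hom[OF T k(1)]
  have "cmp D k (snd Y) = cmp D k (cmp D (snd Y) (on_arr T (fst Y) (fst Y) (idn D (fst Y))))"
    using functor_idn[OF T hom_obj(2)[OF D h1]] cmp_idr[OF D a[OF XY(2)]] by simp
  also have "\<dots> = cmp D k (cmp D (cmp D (snd Y) (on_arr T (fst X) (fst Y) h)) (on_arr T (fst Y) (fst X) k))"
    using functor_cmp[OF T k(1) h1] k(3) cmp_assoc[OF D Tk Th a[OF XY(2)]] by simp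
  also have "\<dots> = cmp D (cmp D k h) (cmp D (snd X) (on_arr T (fst Y) (fst X) k))"
    using h2[symmetric] cmp_assoc[OF D Tk a[OF XY(1)] h1] cmp_assoc[OF D cmp_hom[OF D Tk a[OF XY(1)]] h1 k(1)]
    by simp
  also have "\<dots> = cmp D (snd X) (on_arr T (fst Y) (fst X) k)"
    using k(2) cmp_idl[OF D cmp_hom[OF D Tk a[OF XY(1)]]] by simp
  finally have "k \<in> hom (EM_cat D T \<eta> \<mu>) Y X"
    using XY k(1) by (simp add: EM_cat_def)
  then show ?thesis unfolding is_iso_def using h k by (auto simp: EM_cat_def)
qed

text \<open>
  The comparison functor acts on maps as \<open>R\<close> does, so an inverse of \<open>R f\<close> is one in the category of
  algebras, and an equivalence reflects it. This is how monadicity of a pullback functor forces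
  surjectivity below.
\<close>

lemma monadic_reflects_iso:
  assumes C: "category C" and D: "category D" and R: "monadic C D R"
    and f: "f \<in> hom C x y" and iso: "is_iso D (on_obj R x) (on_obj R y) (on_arr R x y f)"
  shows "is_iso C x y f"
proof -
  obtain L \<eta> \<epsilon> where adj: "adjunction D C L R \<eta> \<epsilon>"
    and eq: "is_equivalence C (EM_cat D (comp_fun R L) \<eta> (monad_mult L R \<epsilon>)) (comparison L R \<epsilon>)"
    using R unfolding monadic_def by blast
  have T: "is_functor D D (comp_fun R L)"
    using is_functor_comp adjunctionD(1,2)[OF adj] by blast
  have "is_functor C (EM_cat D (comp_fun R L) \<eta> (monad_mult L R \<epsilon>)) (comparison L R \<epsilon>)"
    using comparison_functor[OF C D adj] .
  from EM_iso_if_iso[OF D T functor_hom[OF this f]] iso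
  have "is_iso (EM_cat D (comp_fun R L) \<eta> (monad_mult L R \<epsilon>)) (on_obj (comparison L R \<epsilon>) x)
     (on_obj (comparison L R \<epsilon>) y) (on_arr (comparison L R \<epsilon>) x y f)"
    by (simp add: comparison_def)
  then show ?thesis using equivalence_reflects_iso[OF C category_EM_cat[OF D T] eq f] by blast
qed

section \<open>Pullback functors\<close>

lemma slice_obj: "x \<in> obj (slice_cat C Y) \<longleftrightarrow> snd x \<in> hom C (fst x) Y"
  by (cases x) (simp add: slice_cat_def)

lemma slice_hom:
  "h \<in> hom (slice_cat C Y) x y \<longleftrightarrow> h \<in> hom C (fst x) (fst y) \<and> snd x \<in> hom C (fst x) Y \<and>
     snd y \<in> hom C (fst y) Y \<and> cmp C (snd y) h = snd x"
  by (cases x; cases y) (simp add: slice_cat_def)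

lemma slice_idn: "idn (slice_cat C Y) x = idn C (fst x)"
  by (cases x) (simp add: slice_cat_def)

lemma slice_cmp [simp]: "cmp (slice_cat C Y) = cmp C"
  by (simp add: slice_cat_def)

lemma category_slice_cat:
  assumes C: "category C"
  shows "category (slice_cat C Y)"
  unfolding category_def
proof (intro conjI allI impI ballI)
  fix x y f assume "f \<in> hom (slice_cat C Y) x y"
  then show "x \<in> obj (slice_cat C Y)" "y \<in> obj (slice_cat C Y)"
    by (auto simp: slice_hom slice_obj)
next
  fix x assume "x \<in> obj (slice_cat C Y)"
  then show "idn (slice_cat C Y) x \<in> hom (slice_cat C Y) x x"
    using idn_hom[OF C] hom_obj[OF C] cmp_idr[OF C] by (auto simp: slice_hom slice_obj slice_idn)
next
  fix x y z f g assume "f \<in> hom (slice_cat C Y) x y" "g \<in> hom (slice_cat C Y) y z"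
  then show "cmp (slice_cat C Y) g f \<in> hom (slice_cat C Y) x z"
    using cmp_hom[OF C] cmp_assoc[OF C, of f "fst x" "fst y" g "fst z" "snd z" Y] by (auto simp: slice_hom)
next
  fix x y f assume "f \<in> hom (slice_cat C Y) x y"
  then show "cmp (slice_cat C Y) f (idn (slice_cat C Y) x) = f"
    "cmp (slice_cat C Y) (idn (slice_cat C Y) y) f = f"
    using cmp_idr[OF C] cmp_idl[OF C] by (auto simp: slice_hom slice_idn)
next
  fix w x y z f g h
  assume "f \<in> hom (slice_cat C Y) w x" "g \<in> hom (slice_cat C Y) x y" "h \<in> hom (slice_cat C Y) y z"
  then show "cmp (slice_cat C Y) h (cmp (slice_cat C Y) g f) = cmp (slice_cat C Y) (cmp (slice_cat C Y) h g) f"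
    using cmp_assoc[OF C, of f "fst w" "fst x" g "fst y" h "fst z"] by (simp add: slice_hom)
qed

lemma slice_iso:
  assumes C: "category C" and h: "h \<in> hom (slice_cat C Y) x y"
  shows "is_iso (slice_cat C Y) x y h \<longleftrightarrow> is_iso C (fst x) (fst y) h"
proof
  assume "is_iso C (fst x) (fst y) h"
  then obtain k where k: "k \<in> hom C (fst y) (fst x)" "cmp C k h = idn C (fst x)" "cmp C h k = idn C (fst y)"
    unfolding is_iso_def by blast
  have h': "h \<in> hom C (fst x) (fst y)" "snd x \<in> hom C (fst x) Y" "snd y \<in> hom C (fst y) Y"
    "cmp C (snd y) h = snd x" using h by (auto simp: slice_hom)
  have "cmp C (snd x) k = snd y"
    using cmp_assoc[OF C k(1) h'(1,3)] h'(4) k(3) cmp_idr[OF C h'(3)] by simp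
  then show "is_iso (slice_cat C Y) x y h"
    unfolding is_iso_def using h h' k by (auto simp: slice_hom slice_idn intro!: bexI[of _ k])
next
  assume "is_iso (slice_cat C Y) x y h"
  then show "is_iso C (fst x) (fst y) h"
    unfolding is_iso_def by (auto simp: slice_hom slice_idn)
qed

lemma pullback_lift:
  assumes "is_pullback C X Y Z f g P p q" "u \<in> hom C W X" "v \<in> hom C W Y" "cmp C f u = cmp C g v"
  obtains h where "h \<in> hom C W P" "cmp C p h = u" "cmp C q h = v"
  using assms unfolding is_pullback_def by blast

lemma pullback_hom:
  assumes "is_pullback C X Y Z f g P p q"
  shows "f \<in> hom C X Z" "g \<in> hom C Y Z" "p \<in> hom C P X" "q \<in> hom C P Y" "cmp C f p = cmp C g q"
  using assms unfolding is_pullback_def by auto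

lemma pullback_joint_mono:
  assumes C: "category C" and pb: "is_pullback C X Y Z f g P p q"
    and h: "h \<in> hom C W P" and k: "k \<in> hom C W P"
    and e: "cmp C p h = cmp C p k" "cmp C q h = cmp C q k"
  shows "h = k"
proof -
  note p = pullback_hom[OF pb]
  have "cmp C p k \<in> hom C W X" "cmp C q k \<in> hom C W Y" using cmp_hom[OF C k] p by blast+
  moreover have "cmp C f (cmp C p k) = cmp C g (cmp C q k)"
    using cmp_assoc[OF C k p(3,1)] cmp_assoc[OF C k p(4,2)] p(5) by simp
  ultimately have "\<exists>!h. h \<in> hom C W P \<and> cmp C p h = cmp C p k \<and> cmp C q h = cmp C q k"
    using pb unfolding is_pullback_def by blast
  then show ?thesis using h k e by blast
qed

text \<open>
  A pullback functor together with its choice of second projections, which becomes the counit of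
  the adjunction below.
\<close>

definition pullback_choice ::
  "('o, 'm) cat \<Rightarrow> 'o \<Rightarrow> 'o \<Rightarrow> 'm \<Rightarrow> ('o \<times> 'm, 'm, 'o \<times> 'm, 'm) fnctr \<Rightarrow> ('o \<times> 'm \<Rightarrow> 'm) \<Rightarrow> bool" where
  "pullback_choice C E Y p P q \<longleftrightarrow>
     is_functor (slice_cat C Y) (slice_cat C E) P \<and>
     (\<forall>x. snd x \<in> hom C (fst x) Y \<longrightarrow>
        is_pullback C E (fst x) Y p (snd x) (fst (on_obj P x)) (snd (on_obj P x)) (q x)) \<and>
     (\<forall>x y h. h \<in> hom (slice_cat C Y) x y \<longrightarrow> cmp C (q y) (on_arr P x y h) = cmp C h (q x))"

lemma is_pullback_functor_iff:
  "is_pullback_functor C E Y p P \<longleftrightarrow> (\<exists>q. pullback_choice C E Y p P q)"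
  unfolding is_pullback_functor_def pullback_choice_def by auto

lemma pullback_functor_exists:
  assumes C: "category C" and p: "p \<in> hom C E Y"
    and pb: "\<And>X f. f \<in> hom C X Y \<Longrightarrow> \<exists>W r q. is_pullback C E X Y p f W r q"
  shows "\<exists>P q. pullback_choice C E Y p P q"
proof -
  have "\<forall>x. \<exists>w q. snd x \<in> hom C (fst x) Y \<longrightarrow> is_pullback C E (fst x) Y p (snd x) (fst w) (snd w) q"
    using pb by simp
  then obtain w q where wq: "\<And>x. snd x \<in> hom C (fst x) Y \<Longrightarrow>
      is_pullback C E (fst x) Y p (snd x) (fst (w x)) (snd (w x)) (q x)" by metis
  define a where "a x y h = (THE k. k \<in> hom C (fst (w x)) (fst (w y)) \<and> cmp C (snd (w y)) k = snd (w x) \<and>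
      cmp C (q y) k = cmp C h (q x))" for x y h
  have a: "a x y h \<in> hom C (fst (w x)) (fst (w y)) \<and> cmp C (snd (w y)) (a x y h) = snd (w x) \<and>
      cmp C (q y) (a x y h) = cmp C h (q x)" if h: "h \<in> hom (slice_cat C Y) x y" for x y h
  proof -
    have h': "h \<in> hom C (fst x) (fst y)" "snd x \<in> hom C (fst x) Y" "snd y \<in> hom C (fst y) Y"
      "cmp C (snd y) h = snd x" using h by (auto simp: slice_hom)
    note px = pullback_hom[OF wq[OF h'(2)]] and py = pullback_hom[OF wq[OF h'(3)]]
    have "cmp C p (snd (w x)) = cmp C (snd y) (cmp C h (q x))"
      using px(5) h'(4) cmp_assoc[OF C px(4) h'(1,3)] by simp
    then have "\<exists>!k. k \<in> hom C (fst (w x)) (fst (w y)) \<and> cmp C (snd (w y)) k = snd (w x) \<and>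
      cmp C (q y) k = cmp C h (q x)"
      using wq[OF h'(3)] px(3) cmp_hom[OF C px(4) h'(1)] unfolding is_pullback_def by blast
    from theI'[OF this] show ?thesis unfolding a_def .
  qed
  define P where "P = \<lparr> on_obj = w, on_arr = a \<rparr>"
  have Ps [simp]: "on_obj P = w" "on_arr P = a" by (simp_all add: P_def)
  have jm: "k = k'" if "snd y \<in> hom C (fst y) Y" "k \<in> hom C W (fst (w y))" "k' \<in> hom C W (fst (w y))"
    "cmp C (snd (w y)) k = cmp C (snd (w y)) k'" "cmp C (q y) k = cmp C (q y) k'" for y k k' W
    using pullback_joint_mono[OF C wq] that by blast
  have wh: "snd (w x) \<in> hom C (fst (w x)) E" "q x \<in> hom C (fst (w x)) (fst x)" if "snd x \<in> hom C (fst x) Y" for x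
    using pullback_hom[OF wq[OF that]] by blast+
  have "is_functor (slice_cat C Y) (slice_cat C E) P"
    unfolding is_functor_def
  proof (intro conjI allI impI ballI)
    fix x assume x: "x \<in> obj (slice_cat C Y)"
    then have sx: "snd x \<in> hom C (fst x) Y" by (simp add: slice_obj)
    show "on_obj P x \<in> obj (slice_cat C E)" using wh[OF sx] by (simp add: slice_obj)
    have i: "idn (slice_cat C Y) x \<in> hom (slice_cat C Y) x x"
      using idn_hom[OF category_slice_cat[OF C] x] .
    have wo: "fst (w x) \<in> obj C" using hom_obj[OF C wh(1)[OF sx]] by blast
    have "a x x (idn (slice_cat C Y) x) = idn C (fst (w x))"
      by (rule jm[OF sx]) (use a[OF i] idn_hom[OF C wo] cmp_idr[OF C wh(1)[OF sx]] cmp_idr[OF C wh(2)[OF sx]]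
          cmp_idl[OF C wh(2)[OF sx]] in \<open>auto simp: slice_idn\<close>)
    then show "on_arr P x x (idn (slice_cat C Y) x) = idn (slice_cat C E) (on_obj P x)"
      by (simp add: slice_idn)
  next
    fix x y h assume h: "h \<in> hom (slice_cat C Y) x y"
    then have "snd x \<in> hom C (fst x) Y" "snd y \<in> hom C (fst y) Y" by (auto simp: slice_hom)
    then show "on_arr P x y h \<in> hom (slice_cat C E) (on_obj P x) (on_obj P y)"
      using a[OF h] wh by (simp add: slice_hom)
  next
    fix x y z g h assume g: "g \<in> hom (slice_cat C Y) x y" and h: "h \<in> hom (slice_cat C Y) y z"
    have hg: "cmp C h g \<in> hom (slice_cat C Y) x z"
      using cmp_hom[OF category_slice_cat[OF C] g h] by simp
    have x: "snd x \<in> hom C (fst x) Y" and y: "snd y \<in> hom C (fst y) Y" and z: "snd z \<in> hom C (fst z) Y"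
      and g': "g \<in> hom C (fst x) (fst y)" and h': "h \<in> hom C (fst y) (fst z)"
      using g h by (auto simp: slice_hom)
    have ag: "a x y g \<in> hom C (fst (w x)) (fst (w y))" and ah: "a y z h \<in> hom C (fst (w y)) (fst (w z))"
      using a[OF g] a[OF h] by blast+
    have "a x z (cmp C h g) = cmp C (a y z h) (a x y g)"
    proof (rule jm[OF z _ cmp_hom[OF C ag ah]])
      show "a x z (cmp C h g) \<in> hom C (fst (w x)) (fst (w z))" using a[OF hg] by blast
      show "cmp C (snd (w z)) (a x z (cmp C h g)) = cmp C (snd (w z)) (cmp C (a y z h) (a x y g))"
        using a[OF hg] a[OF g] a[OF h] cmp_assoc[OF C ag ah wh(1)[OF z]] by simp
      show "cmp C (q z) (a x z (cmp C h g)) = cmp C (q z) (cmp C (a y z h) (a x y g))"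
        using a[OF hg] a[OF g] a[OF h] cmp_assoc[OF C ag ah wh(2)[OF z]]
          cmp_assoc[OF C ag wh(2)[OF y] h'] cmp_assoc[OF C wh(2)[OF x] g' h'] by simp
    qed
    then show "on_arr P x z (cmp (slice_cat C Y) h g) = cmp (slice_cat C E) (on_arr P y z h) (on_arr P x y g)"
      by simp
  qed
  then have "pullback_choice C E Y p P q" unfolding pullback_choice_def using wq a by simp
  then show ?thesis by blast
qed

definition postcomp_fun :: "('o, 'm) cat \<Rightarrow> 'm \<Rightarrow> ('o \<times> 'm, 'm, 'o \<times> 'm, 'm) fnctr" where
  "postcomp_fun C p = \<lparr> on_obj = (\<lambda>x. (fst x, cmp C p (snd x))), on_arr = (\<lambda>x y h. h) \<rparr>"

lemma postcomp_fun_simps [simp]: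
  "on_obj (postcomp_fun C p) x = (fst x, cmp C p (snd x))" "on_arr (postcomp_fun C p) x y h = h"
  by (simp_all add: postcomp_fun_def)

text \<open>
  Composition with \<open>p\<close> is left adjoint to pullback along \<open>p\<close>. The counit is the second projection;
  the unit at \<open>z\<close> is the map into the pullback with components \<open>z\<close> and the identity, and it is
  determined by these two components, which is why they are part of the conclusion.
\<close>

lemma postcomp_pullback_adjunction:
  assumes C: "category C" and p: "p \<in> hom C E Y" and P: "pullback_choice C E Y p P q"
  obtains \<eta> where "adjunction (slice_cat C E) (slice_cat C Y) (postcomp_fun C p) P \<eta> q"
    and "\<And>z. snd z \<in> hom C (fst z) E \<Longrightarrow>
      cmp C (snd (on_obj P (fst z, cmp C p (snd z)))) (\<eta> z) = snd z \<and>
      cmp C (q (fst z, cmp C p (snd z))) (\<eta> z) = idn C (fst z)"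
proof -
  let ?L = "postcomp_fun C p"
  let ?CE = "slice_cat C E" and ?CY = "slice_cat C Y"
  note CE = category_slice_cat[OF C, of E] and CY = category_slice_cat[OF C, of Y]
  have PF: "is_functor ?CY ?CE P"
    and pb: "\<And>x. snd x \<in> hom C (fst x) Y \<Longrightarrow>
      is_pullback C E (fst x) Y p (snd x) (fst (on_obj P x)) (snd (on_obj P x)) (q x)"
    and qn: "\<And>x y h. h \<in> hom ?CY x y \<Longrightarrow> cmp C (q y) (on_arr P x y h) = cmp C h (q x)"
    using P unfolding pullback_choice_def by auto
  have Lf: "is_functor ?CE ?CY ?L"
    unfolding is_functor_def
    using cmp_hom[OF C _ p] cmp_assoc[OF C _ _ p] by (auto simp: slice_obj slice_hom slice_idn)
  have "\<forall>z. \<exists>e. snd z \<in> hom C (fst z) E \<longrightarrow> e \<in> hom C (fst z) (fst (on_obj P (on_obj ?L z))) \<and>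
      cmp C (snd (on_obj P (on_obj ?L z))) e = snd z \<and> cmp C (q (on_obj ?L z)) e = idn C (fst z)"
  proof
    fix z
    show "\<exists>e. snd z \<in> hom C (fst z) E \<longrightarrow> e \<in> hom C (fst z) (fst (on_obj P (on_obj ?L z))) \<and>
      cmp C (snd (on_obj P (on_obj ?L z))) e = snd z \<and> cmp C (q (on_obj ?L z)) e = idn C (fst z)"
    proof (cases "snd z \<in> hom C (fst z) E")
      case True
      have pz: "cmp C p (snd z) \<in> hom C (fst z) Y" using cmp_hom[OF C True p] .
      have "cmp C p (snd z) = cmp C (cmp C p (snd z)) (idn C (fst z))" using cmp_idr[OF C pz] by simp
      with pullback_lift[OF pb[of "on_obj ?L z"]] True pz idn_hom[OF C hom_obj(1)[OF C True]]
      show ?thesis by (simp, metis)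
    qed simp
  qed
  then obtain \<eta> where \<eta>: "\<And>z. snd z \<in> hom C (fst z) E \<Longrightarrow> \<eta> z \<in> hom C (fst z) (fst (on_obj P (on_obj ?L z))) \<and>
      cmp C (snd (on_obj P (on_obj ?L z))) (\<eta> z) = snd z \<and> cmp C (q (on_obj ?L z)) (\<eta> z) = idn C (fst z)"
    by metis
  have \<eta>h: "\<eta> z \<in> hom C (fst z) (fst (on_obj P (on_obj ?L z)))"
    "cmp C (snd (on_obj P (on_obj ?L z))) (\<eta> z) = snd z" "cmp C (q (on_obj ?L z)) (\<eta> z) = idn C (fst z)"
    if "snd z \<in> hom C (fst z) E" for z using \<eta>[OF that] by blast+
  have jm: "k = k'" if "snd y \<in> hom C (fst y) Y" "k \<in> hom C W (fst (on_obj P y))" "k' \<in> hom C W (fst (on_obj P y))"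
    "cmp C (snd (on_obj P y)) k = cmp C (snd (on_obj P y)) k'" "cmp C (q y) k = cmp C (q y) k'" for y k k' W
    using pullback_joint_mono[OF C pb] that by blast
  have Ph: "on_arr P x y h \<in> hom C (fst (on_obj P x)) (fst (on_obj P y))"
    "cmp C (snd (on_obj P y)) (on_arr P x y h) = snd (on_obj P x)" if "h \<in> hom ?CY x y" for x y h
    using functor_hom[OF PF that] by (auto simp: slice_hom)
  have Pp: "snd (on_obj P x) \<in> hom C (fst (on_obj P x)) E" "q x \<in> hom C (fst (on_obj P x)) (fst x)"
    "cmp C p (snd (on_obj P x)) = cmp C (snd x) (q x)"
    if "snd x \<in> hom C (fst x) Y" for x
    using pullback_hom[OF pb[OF that]] by blast+
  have Lo: "snd (on_obj ?L z) \<in> hom C (fst (on_obj ?L z)) Y" if "snd z \<in> hom C (fst z) E" for z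
    using cmp_hom[OF C that p] by simp
  have qs: "q x \<in> hom ?CY (on_obj ?L (on_obj P x)) x" if x: "snd x \<in> hom C (fst x) Y" for x
    using Pp[OF x] Lo[OF Pp(1)[OF x]] x by (simp add: slice_hom)
  have "nat_trans ?CE ?CE id_fun (comp_fun P ?L) \<eta>"
    unfolding nat_trans_def
  proof (intro conjI allI impI ballI)
    fix z assume "z \<in> obj ?CE"
    then have z: "snd z \<in> hom C (fst z) E" by (simp add: slice_obj)
    then show "\<eta> z \<in> hom ?CE (on_obj id_fun z) (on_obj (comp_fun P ?L) z)"
      using \<eta>h[OF z] Pp(1)[OF Lo[OF z]] by (simp add: slice_hom)
  next
    fix x y h assume h: "h \<in> hom ?CE x y"
    then have x: "snd x \<in> hom C (fst x) E" and y: "snd y \<in> hom C (fst y) E"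
      and h': "h \<in> hom C (fst x) (fst y)" "cmp C (snd y) h = snd x" by (auto simp: slice_hom)
    have Lh: "h \<in> hom ?CY (on_obj ?L x) (on_obj ?L y)" using functor_hom[OF Lf h] by simp
    have "cmp C (\<eta> y) h = cmp C (on_arr P (on_obj ?L x) (on_obj ?L y) h) (\<eta> x)"
    proof (rule jm[OF Lo[OF y] cmp_hom[OF C h'(1) \<eta>h(1)[OF y]] cmp_hom[OF C \<eta>h(1)[OF x] Ph(1)[OF Lh]]])
      show "cmp C (snd (on_obj P (on_obj ?L y))) (cmp C (\<eta> y) h) =
        cmp C (snd (on_obj P (on_obj ?L y))) (cmp C (on_arr P (on_obj ?L x) (on_obj ?L y) h) (\<eta> x))"
        using cmp_assoc[OF C h'(1) \<eta>h(1)[OF y] Pp(1)[OF Lo[OF y]]] \<eta>h(2)[OF y] \<eta>h(2)[OF x] h'(2)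
          cmp_assoc[OF C \<eta>h(1)[OF x] Ph(1)[OF Lh] Pp(1)[OF Lo[OF y]]] Ph(2)[OF Lh] by simp
      show "cmp C (q (on_obj ?L y)) (cmp C (\<eta> y) h) =
        cmp C (q (on_obj ?L y)) (cmp C (on_arr P (on_obj ?L x) (on_obj ?L y) h) (\<eta> x))"
        using cmp_assoc[OF C h'(1) \<eta>h(1)[OF y] Pp(2)[OF Lo[OF y]]] \<eta>h(3)[OF y] \<eta>h(3)[OF x] qn[OF Lh]
          cmp_assoc[OF C \<eta>h(1)[OF x] Ph(1)[OF Lh] Pp(2)[OF Lo[OF y]]] h'(1)
          cmp_assoc[OF C \<eta>h(1)[OF x] Pp(2)[OF Lo[OF x]], of h "fst y"] cmp_idl[OF C h'(1)] cmp_idr[OF C h'(1)] by simp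
    qed
    then show "cmp ?CE (\<eta> y) (on_arr id_fun x y h) = cmp ?CE (on_arr (comp_fun P ?L) x y h) (\<eta> x)"
      by simp
  qed
  moreover have "nat_trans ?CY ?CY (comp_fun ?L P) id_fun q"
    unfolding nat_trans_def using qs qn by (auto simp: slice_obj)
  moreover have "cmp C (on_arr P (on_obj ?L (on_obj P y)) y (q y)) (\<eta> (on_obj P y)) = idn C (fst (on_obj P y))"
    if y: "snd y \<in> hom C (fst y) Y" for y
  proof (rule jm[OF y])
    note Py = Pp(1)[OF y]
    note h = \<eta>h(1)[OF Py] and k = Ph(1)[OF qs[OF y]]
    show "cmp C (on_arr P (on_obj ?L (on_obj P y)) y (q y)) (\<eta> (on_obj P y)) \<in> hom C (fst (on_obj P y)) (fst (on_obj P y))"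
      using cmp_hom[OF C h k] .
    show "idn C (fst (on_obj P y)) \<in> hom C (fst (on_obj P y)) (fst (on_obj P y))"
      using idn_hom[OF C hom_obj(1)[OF C Py]] .
    show "cmp C (snd (on_obj P y)) (cmp C (on_arr P (on_obj ?L (on_obj P y)) y (q y)) (\<eta> (on_obj P y))) =
          cmp C (snd (on_obj P y)) (idn C (fst (on_obj P y)))"
      using cmp_assoc[OF C h k Py] Ph(2)[OF qs[OF y]] \<eta>h(2)[OF Py] cmp_idr[OF C Py] by simp
    show "cmp C (q y) (cmp C (on_arr P (on_obj ?L (on_obj P y)) y (q y)) (\<eta> (on_obj P y))) =
          cmp C (q y) (idn C (fst (on_obj P y)))"
      using cmp_assoc[OF C h k Pp(2)[OF y]] qn[OF qs[OF y]]
        cmp_assoc[OF C h Pp(2)[OF Lo[OF Py]], of "q y" "fst y"] Pp(2)[OF y] \<eta>h(3)[OF Py] by simp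
  qed
  ultimately have "adjunction ?CE ?CY ?L P \<eta> q"
    unfolding adjunction_def using PF Lf \<eta>h by (auto simp: slice_obj slice_idn)
  then show ?thesis using that \<eta>h by simp
qed

section \<open>Functor categories and precomposition\<close>

lemma functor_cat_simps [simp]:
  "obj (functor_cat C D) = functors C D"
  "idn (functor_cat C D) F = (\<lambda>x\<in>obj C. idn D (on_obj F x))"
  "cmp (functor_cat C D) \<sigma> \<tau> = (\<lambda>x\<in>obj C. cmp D (\<sigma> x) (\<tau> x))"
  by (simp_all add: functor_cat_def)

lemma functor_cat_hom:
  "\<tau> \<in> hom (functor_cat C D) F G \<longleftrightarrow>
     F \<in> functors C D \<and> G \<in> functors C D \<and> nat_trans C D F G \<tau> \<and> \<tau> \<in> extensional (obj C)"
  by (simp add: functor_cat_def)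

lemma nat_transD:
  assumes "nat_trans C D F G \<tau>"
  shows "x \<in> obj C \<Longrightarrow> \<tau> x \<in> hom D (on_obj F x) (on_obj G x)"
    "f \<in> hom C x y \<Longrightarrow> cmp D (\<tau> y) (on_arr F x y f) = cmp D (on_arr G x y f) (\<tau> x)"
  using assms unfolding nat_trans_def by blast+

lemma functors_functor: "F \<in> functors C D \<Longrightarrow> is_functor C D F"
  by (simp add: functors_def)

lemma category_functor_cat:
  assumes C: "category C" and D: "category D"
  shows "category (functor_cat C D)"
  unfolding category_def
proof (intro conjI allI impI ballI)
  fix F G \<tau> assume "\<tau> \<in> hom (functor_cat C D) F G"
  then show "F \<in> obj (functor_cat C D)" "G \<in> obj (functor_cat C D)"
    by (auto simp: functor_cat_hom)
next
  fix F assume F: "F \<in> obj (functor_cat C D)"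
  then have Ff: "is_functor C D F" by (simp add: functors_functor)
  have "nat_trans C D F F (idn (functor_cat C D) F)"
    unfolding nat_trans_def
    using functor_obj[OF Ff] functor_hom[OF Ff] hom_obj[OF C] idn_hom[OF D]
      cmp_idl[OF D functor_hom[OF Ff]] cmp_idr[OF D functor_hom[OF Ff]]
    by auto
  then show "idn (functor_cat C D) F \<in> hom (functor_cat C D) F F"
    using F by (simp add: functor_cat_hom)
next
  fix F G H \<sigma> \<tau> assume \<sigma>: "\<sigma> \<in> hom (functor_cat C D) F G" and \<tau>: "\<tau> \<in> hom (functor_cat C D) G H"
  then have F: "is_functor C D F" and G: "is_functor C D G" and H: "is_functor C D H"
    and s: "nat_trans C D F G \<sigma>" and t: "nat_trans C D G H \<tau>"
    by (auto simp: functor_cat_hom functors_functor)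
  have "nat_trans C D F H (cmp (functor_cat C D) \<tau> \<sigma>)"
    unfolding nat_trans_def
  proof (intro conjI allI impI ballI)
    fix x assume x: "x \<in> obj C"
    show "cmp (functor_cat C D) \<tau> \<sigma> x \<in> hom D (on_obj F x) (on_obj H x)"
      using cmp_hom[OF D nat_transD(1)[OF s x] nat_transD(1)[OF t x]] x by simp
  next
    fix x y f assume f: "f \<in> hom C x y"
    note x = hom_obj(1)[OF C f] and y = hom_obj(2)[OF C f]
    have "cmp D (cmp D (\<tau> y) (\<sigma> y)) (on_arr F x y f) = cmp D (\<tau> y) (cmp D (on_arr G x y f) (\<sigma> x))"
      using cmp_assoc[OF D functor_hom[OF F f] nat_transD(1)[OF s y] nat_transD(1)[OF t y]]
        nat_transD(2)[OF s f] by metis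
    also have "\<dots> = cmp D (cmp D (on_arr H x y f) (\<tau> x)) (\<sigma> x)"
      using cmp_assoc[OF D nat_transD(1)[OF s x] functor_hom[OF G f] nat_transD(1)[OF t y]]
        nat_transD(2)[OF t f] by metis
    also have "\<dots> = cmp D (on_arr H x y f) (cmp D (\<tau> x) (\<sigma> x))"
      using cmp_assoc[OF D nat_transD(1)[OF s x] nat_transD(1)[OF t x] functor_hom[OF H f]] .
    finally show "cmp D (cmp (functor_cat C D) \<tau> \<sigma> y) (on_arr F x y f) =
        cmp D (on_arr H x y f) (cmp (functor_cat C D) \<tau> \<sigma> x)"
      using x y by simp
  qed
  then show "cmp (functor_cat C D) \<tau> \<sigma> \<in> hom (functor_cat C D) F H"
    using \<sigma> \<tau> by (simp add: functor_cat_hom)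
next
  fix F G \<tau> assume t: "\<tau> \<in> hom (functor_cat C D) F G"
  then have n: "nat_trans C D F G \<tau>" and e: "\<tau> \<in> extensional (obj C)" by (auto simp: functor_cat_hom)
  show "cmp (functor_cat C D) \<tau> (idn (functor_cat C D) F) = \<tau>"
    using cmp_idr[OF D nat_transD(1)[OF n]] extensional_arb[OF e] by (fastforce simp: restrict_def)
  show "cmp (functor_cat C D) (idn (functor_cat C D) G) \<tau> = \<tau>"
    using cmp_idl[OF D nat_transD(1)[OF n]] extensional_arb[OF e] by (fastforce simp: restrict_def)
next
  fix F G H J \<sigma> \<tau> \<rho> assume "\<sigma> \<in> hom (functor_cat C D) F G" "\<tau> \<in> hom (functor_cat C D) G H"
    "\<rho> \<in> hom (functor_cat C D) H J"
  then have "nat_trans C D F G \<sigma>" "nat_trans C D G H \<tau>" "nat_trans C D H J \<rho>"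
    by (auto simp: functor_cat_hom)
  note n = this[THEN nat_transD(1)]
  show "cmp (functor_cat C D) \<rho> (cmp (functor_cat C D) \<tau> \<sigma>) =
        cmp (functor_cat C D) (cmp (functor_cat C D) \<rho> \<tau>) \<sigma>"
    using cmp_assoc[OF D n] by (auto simp: restrict_def)
qed

lemma restrict_fun_functors:
  assumes C: "category C" and F: "is_functor C D F"
  shows "restrict_fun C F \<in> functors C D"
  using F hom_obj[OF C] idn_hom[OF C] cmp_hom[OF C]
  unfolding functors_def is_functor_def restrict_fun_def by auto

lemma precomp_is_functor:
  assumes B: "category B" and A: "category A" and D: "category D" and K: "is_functor B A K"
  shows "is_functor (functor_cat A D) (functor_cat B D) (precomp B K)"
proof -
  have o: "on_obj (precomp B K) N \<in> functors B D" if "N \<in> functors A D" for N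
    using restrict_fun_functors[OF B is_functor_comp[OF K functors_functor[OF that]]]
    by (simp add: precomp_def)
  show ?thesis
    unfolding is_functor_def
  proof (intro conjI allI impI ballI)
    fix N assume N: "N \<in> obj (functor_cat A D)"
    then show "on_obj (precomp B K) N \<in> obj (functor_cat B D)" using o by simp
    show "on_arr (precomp B K) N N (idn (functor_cat A D) N) = idn (functor_cat B D) (on_obj (precomp B K) N)"
      using functor_obj[OF K] by (auto simp: precomp_def restrict_fun_def restrict_def)
  next
    fix N N' \<tau> assume t: "\<tau> \<in> hom (functor_cat A D) N N'"
    then have n: "nat_trans A D N N' \<tau>" and NN: "N \<in> functors A D" "N' \<in> functors A D"
      by (auto simp: functor_cat_hom)
    have "nat_trans B D (on_obj (precomp B K) N) (on_obj (precomp B K) N') (on_arr (precomp B K) N N' \<tau>)"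
      unfolding nat_trans_def
      using nat_transD[OF n] functor_obj[OF K] functor_hom[OF K] hom_obj[OF B]
      by (auto simp: precomp_def restrict_fun_def)
    then show "on_arr (precomp B K) N N' \<tau> \<in>
        hom (functor_cat B D) (on_obj (precomp B K) N) (on_obj (precomp B K) N')"
      using o NN by (simp add: functor_cat_hom precomp_def)
  next
    fix N N' N'' \<sigma> \<tau>
    show "on_arr (precomp B K) N N'' (cmp (functor_cat A D) \<tau> \<sigma>) =
       cmp (functor_cat B D) (on_arr (precomp B K) N' N'' \<tau>) (on_arr (precomp B K) N N' \<sigma>)"
      using functor_obj[OF K] by (auto simp: precomp_def restrict_def)
  qed
qed

section \<open>Elements of set-valued functors\<close>

lemma Set_cat_simps [simp]:
  "obj (Set_cat U) = U" "idn (Set_cat U) X = Some |` X" "cmp (Set_cat U) g f = g \<circ>\<^sub>m f"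
  by (simp_all add: Set_cat_def)

lemma Set_cat_hom: "f \<in> hom (Set_cat U) X Y \<longleftrightarrow> X \<in> U \<and> Y \<in> U \<and> dom f = X \<and> ran f \<subseteq> Y"
  by (simp add: Set_cat_def)

lemma category_Set_cat: "category (Set_cat U)"
proof -
  have 1: "dom (g \<circ>\<^sub>m f) = dom f" if "ran f \<subseteq> dom g" for f g :: "'a \<rightharpoonup> 'a"
    using that by (fastforce simp: map_comp_def dom_def ran_def split: option.splits)
  have 2: "ran (g \<circ>\<^sub>m f) \<subseteq> ran g" for f g :: "'a \<rightharpoonup> 'a"
    by (auto simp: map_comp_def ran_def split: option.splits)
  have 3: "f \<circ>\<^sub>m (Some |` dom f) = f" for f :: "'a \<rightharpoonup> 'a"
    by (rule ext) (auto simp: map_comp_def restrict_map_def dom_def)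
  have 4: "(Some |` Y) \<circ>\<^sub>m f = f" if "ran f \<subseteq> Y" for Y and f :: "'a \<rightharpoonup> 'a"
    using that by (intro ext) (auto simp: map_comp_def restrict_map_def ran_def split: option.splits)
  have 5: "h \<circ>\<^sub>m (g \<circ>\<^sub>m f) = (h \<circ>\<^sub>m g) \<circ>\<^sub>m f" for f g h :: "'a \<rightharpoonup> 'a"
    by (rule ext) (auto simp: map_comp_def split: option.splits)
  have 6: "ran (Some |` X) \<subseteq> X" for X :: "'a set"
    by (auto simp: ran_def restrict_map_def split: if_splits)
  show ?thesis
    unfolding category_def
  proof (intro conjI allI impI ballI)
    fix X Y and f :: "'a \<rightharpoonup> 'a" assume "f \<in> hom (Set_cat U) X Y"
    then show "X \<in> obj (Set_cat U)" "Y \<in> obj (Set_cat U)"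
      "cmp (Set_cat U) f (idn (Set_cat U) X) = f" "cmp (Set_cat U) (idn (Set_cat U) Y) f = f"
      using 3[of f] 4[of f Y] by (auto simp: Set_cat_hom)
  next
    fix X assume "X \<in> obj (Set_cat U)"
    then show "idn (Set_cat U) X \<in> hom (Set_cat U) X X" using 6 by (simp add: Set_cat_hom)
  next
    fix X Y Z and f g :: "'a \<rightharpoonup> 'a"
    assume "f \<in> hom (Set_cat U) X Y" "g \<in> hom (Set_cat U) Y Z"
    then show "cmp (Set_cat U) g f \<in> hom (Set_cat U) X Z"
      using 1[of f g] 2[of g f] by (auto simp: Set_cat_hom)
  next
    fix f g h :: "'a \<rightharpoonup> 'a"
    show "cmp (Set_cat U) h (cmp (Set_cat U) g f) = cmp (Set_cat U) (cmp (Set_cat U) h g) f"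
      unfolding Set_cat_simps by (rule 5)
  qed
qed

definition act :: "('b, 'u) copresheaf \<Rightarrow> 'b \<Rightarrow> 'b \<Rightarrow> 'u \<Rightarrow> 'u \<Rightarrow> 'u" where
  "act M b c f x = the (on_arr M b c f x)"

definition ap :: "('b, 'u) copresheaf_map \<Rightarrow> 'b \<Rightarrow> 'u \<Rightarrow> 'u" where
  "ap \<tau> b x = the (\<tau> b x)"

lemma Set_cat_hom_the:
  assumes "f \<in> hom (Set_cat U) X Y" "x \<in> X"
  shows "f x = Some (the (f x))" "the (f x) \<in> Y"
  using assms by (auto simp: Set_cat_hom dom_def ran_def)

text \<open>
  Over an infinite type an injective pairing exists; it encodes the elements of products,
  coproducts and coends of sets of elements of the universe type.
\<close>

definition pair :: "'u \<Rightarrow> 'u \<Rightarrow> 'u" where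
  "pair = (SOME p. \<forall>a b c d. p a b = p c d \<longrightarrow> a = c \<and> b = d)"

definition left :: "'u \<Rightarrow> 'u" where "left z = (SOME a. \<exists>b. z = pair a b)"
definition right :: "'u \<Rightarrow> 'u" where "right z = (SOME b. \<exists>a. z = pair a b)"

lemma pair_inj:
  assumes "infinite (UNIV :: 'u set)"
  shows "pair a b = pair c d \<longleftrightarrow> a = (c :: 'u) \<and> b = (d :: 'u)"
proof -
  obtain f :: "'u \<times> 'u \<Rightarrow> 'u" where "bij_betw f (UNIV \<times> UNIV) UNIV"
    using card_of_Times_same_infinite[OF assms] card_of_ordIso by blast
  then have "inj f" by (simp add: bij_betw_def)
  then have "\<forall>a b c d. f (a, b) = f (c, d) \<longrightarrow> a = c \<and> b = d" by (metis injD prod.inject)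
  then have "\<exists>p :: 'u \<Rightarrow> 'u \<Rightarrow> 'u. \<forall>a b c d. p a b = p c d \<longrightarrow> a = c \<and> b = d"
    by (rule exI[of _ "\<lambda>a b. f (a, b)"])
  from someI_ex[OF this] show ?thesis unfolding pair_def by blast
qed

lemma left_pair: "infinite (UNIV :: 'u set) \<Longrightarrow> left (pair a b) = (a :: 'u)"
  unfolding left_def by (rule some_equality) (auto simp: pair_inj)

lemma right_pair: "infinite (UNIV :: 'u set) \<Longrightarrow> right (pair a b) = (b :: 'u)"
  unfolding right_def by (rule some_equality) (auto simp: pair_inj)

definition sigma :: "'u set \<Rightarrow> ('u \<Rightarrow> 'u set) \<Rightarrow> 'u set" where
  "sigma X F = (\<Union>x\<in>X. pair x ` F x)"

lemma set_universe_subset: "set_universe U \<Longrightarrow> X \<in> U \<Longrightarrow> Y \<subseteq> X \<Longrightarrow> Y \<in> U"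
  unfolding set_universe_def by blast

lemma set_universe_image: "set_universe (U :: 'u set set) \<Longrightarrow> X \<in> U \<Longrightarrow> (f :: 'u \<Rightarrow> 'u) ` X \<in> U"
  unfolding set_universe_def by blast

lemma set_universe_Union:
  "set_universe U \<Longrightarrow> X \<in> U \<Longrightarrow> \<forall>x\<in>X. F x \<in> U \<Longrightarrow> (\<Union>x\<in>X. F x) \<in> U"
  unfolding set_universe_def by simp

lemma set_universe_sigma:
  assumes U: "set_universe U" and "X \<in> U" and "\<And>x. x \<in> X \<Longrightarrow> F x \<in> U"
  shows "sigma X F \<in> U"
  unfolding sigma_def
  using set_universe_Union[OF U assms(2)] set_universe_image[OF U assms(3)] by simp

lemma in_sigma: "z \<in> sigma X F \<longleftrightarrow> (\<exists>x y. z = pair x y \<and> x \<in> X \<and> y \<in> F x)"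
  unfolding sigma_def by auto

locale copresheaves =
  fixes U :: "'u set set" and B :: "('b, 'u) cat"
  assumes U: "set_universe U" and B: "category B"
begin

abbreviation C where "C \<equiv> Set_pow U B"

lemma infinite_UNIV: "infinite (UNIV :: 'u set)"
  using U unfolding set_universe_def by blast

lemmas pair_simps [simp] =
  pair_inj[OF infinite_UNIV] left_pair[OF infinite_UNIV] right_pair[OF infinite_UNIV]

lemma C: "category C"
  using category_functor_cat[OF B category_Set_cat] .

lemma hom_objects: "\<tau> \<in> hom C M N \<Longrightarrow> M \<in> obj C \<and> N \<in> obj C"
  using hom_obj[OF C] by blast

lemma on_obj_U: "M \<in> obj C \<Longrightarrow> b \<in> obj B \<Longrightarrow> on_obj M b \<in> U"
  using functor_obj[OF functors_functor, of M B "Set_cat U"] by simp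

lemma act_Some:
  assumes "M \<in> obj C" "f \<in> hom B b c" "x \<in> on_obj M b"
  shows "on_arr M b c f x = Some (act M b c f x)" "act M b c f x \<in> on_obj M c"
  using Set_cat_hom_the[OF functor_hom[OF functors_functor], of M B U f b c x] assms
  unfolding act_def by simp_all

lemma ap_Some:
  assumes "\<tau> \<in> hom C M N" "b \<in> obj B" "x \<in> on_obj M b"
  shows "\<tau> b x = Some (ap \<tau> b x)" "ap \<tau> b x \<in> on_obj N b"
proof -
  have "nat_trans B (Set_cat U) M N \<tau>" using assms by (simp add: functor_cat_hom)
  from Set_cat_hom_the[OF nat_transD(1)[OF this assms(2)] assms(3)]
  show "\<tau> b x = Some (ap \<tau> b x)" "ap \<tau> b x \<in> on_obj N b" unfolding ap_def by simp_all
qed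

lemmas act_in = act_Some(2)
lemmas ap_in = ap_Some(2)

lemma act_idn: "M \<in> obj C \<Longrightarrow> b \<in> obj B \<Longrightarrow> x \<in> on_obj M b \<Longrightarrow> act M b b (idn B b) x = x"
  using functor_idn[OF functors_functor, of M B "Set_cat U" b] unfolding act_def by simp

lemma act_cmp:
  assumes M: "M \<in> obj C" and f: "f \<in> hom B b c" and g: "g \<in> hom B c d" and x: "x \<in> on_obj M b"
  shows "act M b d (cmp B g f) x = act M c d g (act M b c f x)"
  using functor_cmp[OF functors_functor f g, of M "Set_cat U"] M act_Some[OF M f x]
    act_Some[OF M g act_in[OF M f x]]
  unfolding act_def[of M b d] by simp

lemma ap_act:
  assumes t: "\<tau> \<in> hom C M N" and f: "f \<in> hom B b c" and x: "x \<in> on_obj M b"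
  shows "ap \<tau> c (act M b c f x) = act N b c f (ap \<tau> b x)"
proof -
  have M: "M \<in> obj C" and N: "N \<in> obj C" and n: "nat_trans B (Set_cat U) M N \<tau>"
    using t by (auto simp: functor_cat_hom)
  note b = hom_obj(1)[OF B f] and c = hom_obj(2)[OF B f]
  have "(\<tau> c \<circ>\<^sub>m on_arr M b c f) x = (on_arr N b c f \<circ>\<^sub>m \<tau> b) x"
    using nat_transD(2)[OF n f] by simp
  then show ?thesis
    using act_Some[OF M f x] ap_Some[OF t b x] ap_Some[OF t c act_in[OF M f x]]
      act_Some[OF N f ap_in[OF t b x]] by simp
qed

lemma ap_cmp:
  assumes t: "\<tau> \<in> hom C M N" and b: "b \<in> obj B" and x: "x \<in> on_obj M b"
  shows "ap (cmp C \<sigma> \<tau>) b x = ap \<sigma> b (ap \<tau> b x)"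
  using ap_Some[OF t b x] b by (simp add: ap_def)

lemma ap_idn:
  assumes "b \<in> obj B" "x \<in> on_obj M b"
  shows "ap (idn C M) b x = x"
  using assms by (simp add: ap_def)

text \<open>
  Together with the existence lemmas \<open>map_exists\<close> and \<open>obj_exists\<close> below this reduces all later
  reasoning about functors to sets to total functions on elements.
\<close>

lemma map_eqI:
  assumes t: "\<tau> \<in> hom C M N" and s: "\<sigma> \<in> hom C M N'"
    and eq: "\<And>b x. b \<in> obj B \<Longrightarrow> x \<in> on_obj M b \<Longrightarrow> ap \<tau> b x = ap \<sigma> b x"
  shows "\<tau> = \<sigma>"
proof -
  have e: "\<tau> \<in> extensional (obj B)" "\<sigma> \<in> extensional (obj B)" using t s by (auto simp: functor_cat_hom)
  have n: "nat_trans B (Set_cat U) M N \<tau>" "nat_trans B (Set_cat U) M N' \<sigma>"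
    using t s by (auto simp: functor_cat_hom)
  show ?thesis
  proof (rule extensionalityI[OF e])
    fix b assume b: "b \<in> obj B"
    have d: "dom (\<tau> b) = on_obj M b" "dom (\<sigma> b) = on_obj M b"
      using nat_transD(1)[OF n(1) b] nat_transD(1)[OF n(2) b] by (auto simp: Set_cat_hom)
    show "\<tau> b = \<sigma> b"
    proof
      fix x
      show "\<tau> b x = \<sigma> b x"
      proof (cases "x \<in> on_obj M b")
        case True
        then show ?thesis using ap_Some(1)[OF t b] ap_Some(1)[OF s b] eq[OF b] by simp
      next
        case False
        then show ?thesis using d by (metis domIff)
      qed
    qed
  qed
qed

lemma map_exists:
  assumes M: "M \<in> obj C" and N: "N \<in> obj C"
    and in_N: "\<And>b x. b \<in> obj B \<Longrightarrow> x \<in> on_obj M b \<Longrightarrow> \<phi> b x \<in> on_obj N b"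
    and nat: "\<And>b c f x. f \<in> hom B b c \<Longrightarrow> x \<in> on_obj M b \<Longrightarrow>
      \<phi> c (act M b c f x) = act N b c f (\<phi> b x)"
  obtains \<tau> where "\<tau> \<in> hom C M N" "\<And>b x. b \<in> obj B \<Longrightarrow> x \<in> on_obj M b \<Longrightarrow> ap \<tau> b x = \<phi> b x"
proof
  define \<tau> where "\<tau> = (\<lambda>b\<in>obj B. \<lambda>x. if x \<in> on_obj M b then Some (\<phi> b x) else None)"
  show "ap \<tau> b x = \<phi> b x" if "b \<in> obj B" "x \<in> on_obj M b" for b x
    using that by (simp add: ap_def \<tau>_def)
  have "nat_trans B (Set_cat U) M N \<tau>"
    unfolding nat_trans_def
  proof (intro conjI allI impI ballI)
    fix b assume b: "b \<in> obj B"
    then show "\<tau> b \<in> hom (Set_cat U) (on_obj M b) (on_obj N b)"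
      using in_N on_obj_U[OF M] on_obj_U[OF N]
      by (auto simp: Set_cat_hom \<tau>_def dom_def ran_def split: if_splits)
  next
    fix b c f assume f: "f \<in> hom B b c"
    note b = hom_obj(1)[OF B f] and c = hom_obj(2)[OF B f]
    have d: "dom (on_arr M b c f) = on_obj M b"
      using functor_hom[OF functors_functor f, of M "Set_cat U"] M by (simp add: Set_cat_hom)
    show "cmp (Set_cat U) (\<tau> c) (on_arr M b c f) = cmp (Set_cat U) (on_arr N b c f) (\<tau> b)"
    proof
      fix x
      show "cmp (Set_cat U) (\<tau> c) (on_arr M b c f) x = cmp (Set_cat U) (on_arr N b c f) (\<tau> b) x"
      proof (cases "x \<in> on_obj M b")
        case True
        then show ?thesis
          using act_Some[OF M f True] act_Some[OF N f in_N[OF b True]] nat[OF f True] b c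
          by (simp add: \<tau>_def)
      next
        case False
        then have "on_arr M b c f x = None" using d by blast
        then show ?thesis using False b by (simp add: \<tau>_def map_comp_def)
      qed
    qed
  qed
  then show "\<tau> \<in> hom C M N" using M N by (simp add: functor_cat_hom \<tau>_def)
qed

lemma obj_exists:
  assumes X: "\<And>b. b \<in> obj B \<Longrightarrow> X b \<in> U"
    and in_X: "\<And>b c f x. f \<in> hom B b c \<Longrightarrow> x \<in> X b \<Longrightarrow> \<alpha> b c f x \<in> X c"
    and idn: "\<And>b x. b \<in> obj B \<Longrightarrow> x \<in> X b \<Longrightarrow> \<alpha> b b (idn B b) x = x"
    and cmp: "\<And>b c d f g x. f \<in> hom B b c \<Longrightarrow> g \<in> hom B c d \<Longrightarrow> x \<in> X b \<Longrightarrow>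
      \<alpha> b d (cmp B g f) x = \<alpha> c d g (\<alpha> b c f x)"
  obtains M where "M \<in> obj C" "\<And>b. b \<in> obj B \<Longrightarrow> on_obj M b = X b"
    "\<And>b c f x. f \<in> hom B b c \<Longrightarrow> x \<in> X b \<Longrightarrow> act M b c f x = \<alpha> b c f x"
proof
  let ?F = "\<lparr> on_obj = X, on_arr = (\<lambda>b c f x. if x \<in> X b then Some (\<alpha> b c f x) else None) \<rparr>"
  define M :: "('b, 'u) copresheaf" where "M = restrict_fun B ?F"
  have "is_functor B (Set_cat U) ?F"
    unfolding is_functor_def
  proof (intro conjI allI impI ballI)
    fix b assume b: "b \<in> obj B"
    show "on_obj ?F b \<in> obj (Set_cat U)" using X[OF b] by simp
    show "on_arr ?F b b (idn B b) = idn (Set_cat U) (on_obj ?F b)"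
      using idn[OF b] by (auto simp: restrict_map_def)
  next
    fix b c f assume f: "f \<in> hom B b c"
    show "on_arr ?F b c f \<in> hom (Set_cat U) (on_obj ?F b) (on_obj ?F c)"
      using in_X[OF f] X hom_obj[OF B f] by (auto simp: Set_cat_hom dom_def ran_def split: if_splits)
  next
    fix b c d f g assume "f \<in> hom B b c" "g \<in> hom B c d"
    then show "on_arr ?F b d (cmp B g f) = cmp (Set_cat U) (on_arr ?F c d g) (on_arr ?F b c f)"
      using cmp in_X by (auto simp: map_comp_def)
  qed
  then show "M \<in> obj C" unfolding M_def using restrict_fun_functors[OF B] by simp
  show "on_obj M b = X b" if "b \<in> obj B" for b using that by (simp add: M_def restrict_fun_def)
  show "act M b c f x = \<alpha> b c f x" if "f \<in> hom B b c" "x \<in> X b" for b c f x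
    using that by (simp add: act_def M_def restrict_fun_def)
qed

section \<open>Injections, surjections, quotients and pullbacks of set-valued functors\<close>

definition surj_map :: "('b, 'u) copresheaf \<Rightarrow> ('b, 'u) copresheaf \<Rightarrow> ('b, 'u) copresheaf_map \<Rightarrow> bool" where
  "surj_map M N \<tau> \<longleftrightarrow> (\<forall>b\<in>obj B. \<forall>y\<in>on_obj N b. \<exists>x\<in>on_obj M b. ap \<tau> b x = y)"

definition inj_map :: "('b, 'u) copresheaf \<Rightarrow> ('b, 'u) copresheaf_map \<Rightarrow> bool" where
  "inj_map M \<tau> \<longleftrightarrow>
     (\<forall>b\<in>obj B. \<forall>x\<in>on_obj M b. \<forall>x'\<in>on_obj M b. ap \<tau> b x = ap \<tau> b x' \<longrightarrow> x = x')"

lemma surj_mapE: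
  assumes "surj_map M N \<tau>" "b \<in> obj B" "y \<in> on_obj N b"
  obtains x where "x \<in> on_obj M b" "ap \<tau> b x = y"
  using assms unfolding surj_map_def by blast

lemma inj_mapD:
  "inj_map M \<tau> \<Longrightarrow> b \<in> obj B \<Longrightarrow> x \<in> on_obj M b \<Longrightarrow> x' \<in> on_obj M b \<Longrightarrow>
   ap \<tau> b x = ap \<tau> b x' \<Longrightarrow> x = x'"
  unfolding inj_map_def by blast

lemma iso_iff:
  "is_iso C M N \<tau> \<longleftrightarrow> \<tau> \<in> hom C M N \<and> inj_map M \<tau> \<and> surj_map M N \<tau>"
proof (intro iffI conjI)
  assume "is_iso C M N \<tau>"
  then obtain \<sigma> where t: "\<tau> \<in> hom C M N" and s: "\<sigma> \<in> hom C N M"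
    and st: "cmp C \<sigma> \<tau> = idn C M" and ts: "cmp C \<tau> \<sigma> = idn C N" unfolding is_iso_def by blast
  have 1: "ap \<sigma> b (ap \<tau> b x) = x" if "b \<in> obj B" "x \<in> on_obj M b" for b x
    using ap_cmp[OF t that, of \<sigma>] ap_idn[OF that] st by metis
  have 2: "ap \<tau> b (ap \<sigma> b y) = y" if "b \<in> obj B" "y \<in> on_obj N b" for b y
    using ap_cmp[OF s that, of \<tau>] ap_idn[OF that] ts by metis
  show "\<tau> \<in> hom C M N" by fact
  show "inj_map M \<tau>" unfolding inj_map_def using 1 by metis
  show "surj_map M N \<tau>" unfolding surj_map_def using 2 ap_in[OF s] by metis
next
  assume a: "\<tau> \<in> hom C M N \<and> inj_map M \<tau> \<and> surj_map M N \<tau>"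
  then have t: "\<tau> \<in> hom C M N" by blast
  have M: "M \<in> obj C" and N: "N \<in> obj C" using hom_objects[OF t] by auto
  have "\<forall>b y. \<exists>x. b \<in> obj B \<longrightarrow> y \<in> on_obj N b \<longrightarrow> x \<in> on_obj M b \<and> ap \<tau> b x = y"
    using a unfolding surj_map_def by metis
  then obtain s where s: "\<And>b y. b \<in> obj B \<Longrightarrow> y \<in> on_obj N b \<Longrightarrow> s b y \<in> on_obj M b"
    and ts: "\<And>b y. b \<in> obj B \<Longrightarrow> y \<in> on_obj N b \<Longrightarrow> ap \<tau> b (s b y) = y" by metis
  obtain \<sigma> where \<sigma>: "\<sigma> \<in> hom C N M" and \<sigma>s: "\<And>b y. b \<in> obj B \<Longrightarrow> y \<in> on_obj N b \<Longrightarrow> ap \<sigma> b y = s b y"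
  proof (rule map_exists[OF N M, of s])
    fix b c f y assume f: "f \<in> hom B b c" and y: "y \<in> on_obj N b"
    note b = hom_obj(1)[OF B f] and c = hom_obj(2)[OF B f]
    have "ap \<tau> c (s c (act N b c f y)) = ap \<tau> c (act M b c f (s b y))"
      using ts[OF c act_in[OF N f y]] ap_act[OF t f s[OF b y]] ts[OF b y] by simp
    then show "s c (act N b c f y) = act M b c f (s b y)"
      using a inj_mapD[OF _ c s[OF c act_in[OF N f y]] act_in[OF M f s[OF b y]]] by blast
  qed (use s in auto)
  have "cmp C \<tau> \<sigma> = idn C N"
    by (rule map_eqI[OF cmp_hom[OF C \<sigma> t] idn_hom[OF C N]])
      (simp only: ap_cmp[OF \<sigma>] ap_idn \<sigma>s ts)
  moreover have "cmp C \<sigma> \<tau> = idn C M"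
  proof (rule map_eqI[OF cmp_hom[OF C t \<sigma>] idn_hom[OF C M]])
    fix b x assume b: "b \<in> obj B" and x: "x \<in> on_obj M b"
    have "ap \<tau> b (s b (ap \<tau> b x)) = ap \<tau> b x" using ts[OF b ap_in[OF t b x]] .
    then have "s b (ap \<tau> b x) = x" using a inj_mapD[OF _ b s[OF b ap_in[OF t b x]] x] by blast
    then show "ap (cmp C \<sigma> \<tau>) b x = ap (idn C M) b x"
      using ap_cmp[OF t b x, of \<sigma>] ap_idn[OF b x] \<sigma>s[OF b ap_in[OF t b x]] by metis
  qed
  ultimately show "is_iso C M N \<tau>" unfolding is_iso_def using t \<sigma> by blast
qed

definition pointwise_pullback where
  "pointwise_pullback X Y f g P p q \<longleftrightarrow> (\<forall>b\<in>obj B.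
     (\<forall>t\<in>on_obj P b. \<forall>t'\<in>on_obj P b. ap p b t = ap p b t' \<longrightarrow> ap q b t = ap q b t' \<longrightarrow> t = t') \<and>
     (\<forall>x\<in>on_obj X b. \<forall>y\<in>on_obj Y b. ap f b x = ap g b y \<longrightarrow>
        (\<exists>t\<in>on_obj P b. ap p b t = x \<and> ap q b t = y)))"

lemma pullback_exists:
  assumes f: "f \<in> hom C X Z" and g: "g \<in> hom C Y Z"
  obtains P p q where "p \<in> hom C P X" "q \<in> hom C P Y" "cmp C f p = cmp C g q"
    "pointwise_pullback X Y f g P p q"
proof -
  have X: "X \<in> obj C" and Y: "Y \<in> obj C" using hom_objects f g by auto
  define E where "E b = sigma (on_obj X b) (\<lambda>x. {y \<in> on_obj Y b. ap f b x = ap g b y})" for b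
  define \<alpha> where "\<alpha> b c h t = pair (act X b c h (left t)) (act Y b c h (right t))" for b c h t
  obtain P where P: "P \<in> obj C" and PE: "\<And>b. b \<in> obj B \<Longrightarrow> on_obj P b = E b"
    and P\<alpha>: "\<And>b c h t. h \<in> hom B b c \<Longrightarrow> t \<in> E b \<Longrightarrow> act P b c h t = \<alpha> b c h t"
  proof (rule obj_exists[of E \<alpha>])
    fix b assume b: "b \<in> obj B"
    show "E b \<in> U" unfolding E_def
      by (rule set_universe_sigma[OF U on_obj_U[OF X b]])
        (auto intro: set_universe_subset[OF U on_obj_U[OF Y b]])
  next
    fix b c h t assume h: "h \<in> hom B b c" and "t \<in> E b"
    then show "\<alpha> b c h t \<in> E c" unfolding E_def \<alpha>_def
      using act_in[OF X h] act_in[OF Y h] ap_act[OF f h] ap_act[OF g h] by (auto simp: in_sigma)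
  next
    fix b t assume "b \<in> obj B" "t \<in> E b"
    then show "\<alpha> b b (idn B b) t = t" unfolding E_def \<alpha>_def
      using act_idn[OF X] act_idn[OF Y] by (auto simp: in_sigma)
  next
    fix b c d h k t assume "h \<in> hom B b c" "k \<in> hom B c d" "t \<in> E b"
    then show "\<alpha> b d (cmp B k h) t = \<alpha> c d k (\<alpha> b c h t)" unfolding E_def \<alpha>_def
      using act_cmp[OF X] act_cmp[OF Y] by (auto simp: in_sigma)
  qed blast
  have Pt: "left t \<in> on_obj X b \<and> right t \<in> on_obj Y b \<and> ap f b (left t) = ap g b (right t) \<and> t = pair (left t) (right t)"
    if "b \<in> obj B" "t \<in> on_obj P b" for b t
    using that by (auto simp: PE E_def in_sigma)
  have Pa: "act P b c h t = pair (act X b c h (left t)) (act Y b c h (right t))"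
    if "h \<in> hom B b c" "t \<in> on_obj P b" for b c h t
    using P\<alpha>[OF that(1)] that PE[OF hom_obj(1)[OF B that(1)]] by (simp add: \<alpha>_def)
  obtain p where p: "p \<in> hom C P X" and pl: "\<And>b t. b \<in> obj B \<Longrightarrow> t \<in> on_obj P b \<Longrightarrow> ap p b t = left t"
    by (rule map_exists[OF P X, of "\<lambda>_. left"]) (use Pt Pa in auto)
  obtain q where q: "q \<in> hom C P Y" and qr: "\<And>b t. b \<in> obj B \<Longrightarrow> t \<in> on_obj P b \<Longrightarrow> ap q b t = right t"
    by (rule map_exists[OF P Y, of "\<lambda>_. right"]) (use Pt Pa in auto)
  show ?thesis
  proof (rule that[OF p q])
    show "cmp C f p = cmp C g q"
    proof (rule map_eqI[OF cmp_hom[OF C p f] cmp_hom[OF C q g]])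
      fix b t assume b: "b \<in> obj B" and t: "t \<in> on_obj P b"
      show "ap (cmp C f p) b t = ap (cmp C g q) b t"
        unfolding ap_cmp[OF p b t] ap_cmp[OF q b t] pl[OF b t] qr[OF b t] using Pt[OF b t] by simp
    qed
    have "t = t'" if "b \<in> obj B" "t \<in> on_obj P b" "t' \<in> on_obj P b" "ap p b t = ap p b t'" "ap q b t = ap q b t'" for b t t'
      using that pl qr Pt by metis
    moreover have "\<exists>t\<in>on_obj P b. ap p b t = x \<and> ap q b t = y"
      if "b \<in> obj B" "x \<in> on_obj X b" "y \<in> on_obj Y b" "ap f b x = ap g b y" for b x y
      using that by (intro bexI[of _ "pair x y"]) (auto simp: pl qr PE E_def in_sigma)
    ultimately show "pointwise_pullback X Y f g P p q" unfolding pointwise_pullback_def by blast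
  qed
qed

lemma is_pullbackI:
  assumes f: "f \<in> hom C X Z" and g: "g \<in> hom C Y Z" and p: "p \<in> hom C P X" and q: "q \<in> hom C P Y"
    and comm: "cmp C f p = cmp C g q" and pw: "pointwise_pullback X Y f g P p q"
  shows "is_pullback C X Y Z f g P p q"
  unfolding is_pullback_def
proof (intro conjI allI ballI impI f g p q comm)
  have inj: "\<And>b t t'. b \<in> obj B \<Longrightarrow> t \<in> on_obj P b \<Longrightarrow> t' \<in> on_obj P b \<Longrightarrow>
       ap p b t = ap p b t' \<Longrightarrow> ap q b t = ap q b t' \<Longrightarrow> t = t'"
    and ex: "\<And>b x y. b \<in> obj B \<Longrightarrow> x \<in> on_obj X b \<Longrightarrow> y \<in> on_obj Y b \<Longrightarrow> ap f b x = ap g b y \<Longrightarrow>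
       \<exists>t\<in>on_obj P b. ap p b t = x \<and> ap q b t = y"
    using pw unfolding pointwise_pullback_def by blast+
  fix W u v assume u: "u \<in> hom C W X" and v: "v \<in> hom C W Y" and uv: "cmp C f u = cmp C g v"
  have W: "W \<in> obj C" and P: "P \<in> obj C" using hom_objects u p by auto
  have "\<exists>t. b \<in> obj B \<longrightarrow> w \<in> on_obj W b \<longrightarrow> t \<in> on_obj P b \<and> ap p b t = ap u b w \<and> ap q b t = ap v b w" for b w
    using ex[OF _ ap_in[OF u] ap_in[OF v]] ap_cmp[OF u, of b w f] ap_cmp[OF v, of b w g] uv by metis
  then obtain h where h: "\<And>b w. b \<in> obj B \<Longrightarrow> w \<in> on_obj W b \<Longrightarrow>
      h b w \<in> on_obj P b \<and> ap p b (h b w) = ap u b w \<and> ap q b (h b w) = ap v b w" by metis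
  obtain k where k: "k \<in> hom C W P" and kh: "\<And>b w. b \<in> obj B \<Longrightarrow> w \<in> on_obj W b \<Longrightarrow> ap k b w = h b w"
  proof (rule map_exists[OF W P, of h])
    fix b c e w assume e: "e \<in> hom B b c" and w: "w \<in> on_obj W b"
    note b = hom_obj(1)[OF B e] and c = hom_obj(2)[OF B e]
    note hb = h[OF b w] and hc = h[OF c act_in[OF W e w]]
    have "ap p c (h c (act W b c e w)) = ap p c (act P b c e (h b w))"
      using hc hb ap_act[OF u e w] ap_act[OF p e] by metis
    moreover have "ap q c (h c (act W b c e w)) = ap q c (act P b c e (h b w))"
      using hc hb ap_act[OF v e w] ap_act[OF q e] by metis
    ultimately show "h c (act W b c e w) = act P b c e (h b w)"
      using inj[OF c _ act_in[OF P e]] hb hc by blast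
  qed (use h in auto)
  show "\<exists>!h. h \<in> hom C W P \<and> cmp C p h = u \<and> cmp C q h = v"
  proof (intro ex1I conjI)
    show "cmp C p k = u" by (rule map_eqI[OF cmp_hom[OF C k p] u]) (simp only: ap_cmp[OF k] kh h)
    show "cmp C q k = v" by (rule map_eqI[OF cmp_hom[OF C k q] v]) (simp only: ap_cmp[OF k] kh h)
    show "k \<in> hom C W P" by fact
    fix l assume l: "l \<in> hom C W P \<and> cmp C p l = u \<and> cmp C q l = v"
    then have lh: "l \<in> hom C W P" by blast
    show "l = k"
    proof (rule map_eqI[OF lh k])
      fix b w assume b: "b \<in> obj B" and w: "w \<in> on_obj W b"
      show "ap l b w = ap k b w"
        by (rule inj[OF b ap_in[OF lh b w] ap_in[OF k b w]])
          (metis ap_cmp[OF lh b w] h[OF b w] kh[OF b w] l)+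
    qed
  qed
qed

text \<open>
  An abstract pullback is compared with the one consisting of pairs: the two comparison maps are
  mutually inverse.
\<close>

lemma pullback_elements:
  assumes pb: "is_pullback C X Y Z f g P p q" and b: "b \<in> obj B"
  shows "t \<in> on_obj P b \<Longrightarrow> t' \<in> on_obj P b \<Longrightarrow> ap p b t = ap p b t' \<Longrightarrow> ap q b t = ap q b t' \<Longrightarrow> t = t'"
    and "x \<in> on_obj X b \<Longrightarrow> y \<in> on_obj Y b \<Longrightarrow> ap f b x = ap g b y \<Longrightarrow>
       \<exists>t\<in>on_obj P b. ap p b t = x \<and> ap q b t = y"
    and "t \<in> on_obj P b \<Longrightarrow> ap f b (ap p b t) = ap g b (ap q b t)"
proof -
  note h = pullback_hom[OF pb]
  obtain Q r s where r: "r \<in> hom C Q X" and s: "s \<in> hom C Q Y" and rs: "cmp C f r = cmp C g s"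
    and pw: "pointwise_pullback X Y f g Q r s"
    by (rule pullback_exists[OF h(1,2)])
  have injQ: "\<And>t t'. t \<in> on_obj Q b \<Longrightarrow> t' \<in> on_obj Q b \<Longrightarrow>
       ap r b t = ap r b t' \<Longrightarrow> ap s b t = ap s b t' \<Longrightarrow> t = t'"
    and exQ: "\<And>x y. x \<in> on_obj X b \<Longrightarrow> y \<in> on_obj Y b \<Longrightarrow> ap f b x = ap g b y \<Longrightarrow>
       \<exists>t\<in>on_obj Q b. ap r b t = x \<and> ap s b t = y"
    using pw b unfolding pointwise_pullback_def by blast+
  have Q: "is_pullback C X Y Z f g Q r s" by (rule is_pullbackI[OF h(1,2) r s rs pw])
  obtain k where k: "k \<in> hom C Q P" "cmp C p k = r" "cmp C q k = s"
    using pullback_lift[OF pb r s rs] .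
  obtain l where l: "l \<in> hom C P Q" "cmp C r l = p" "cmp C s l = q"
    using pullback_lift[OF Q h(3-5)] .
  have "cmp C k l = idn C P"
  proof (rule pullback_joint_mono[OF C pb cmp_hom[OF C l(1) k(1)] idn_hom[OF C]])
    show "P \<in> obj C" using hom_objects[OF h(3)] by blast
    show "cmp C p (cmp C k l) = cmp C p (idn C P)"
      using cmp_assoc[OF C l(1) k(1) h(3)] k l cmp_idr[OF C h(3)] by metis
    show "cmp C q (cmp C k l) = cmp C q (idn C P)"
      using cmp_assoc[OF C l(1) k(1) h(4)] k l cmp_idr[OF C h(4)] by metis
  qed
  then have kl: "ap k b (ap l b t) = t" if "t \<in> on_obj P b" for t
    using ap_cmp[OF l(1) b that, of k] ap_idn[OF b that] by metis
  show "t = t'" if t: "t \<in> on_obj P b" and t': "t' \<in> on_obj P b"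
    and "ap p b t = ap p b t'" "ap q b t = ap q b t'"
  proof -
    have "ap l b t = ap l b t'"
      using injQ[OF ap_in[OF l(1) b t] ap_in[OF l(1) b t']] that(3,4)
        ap_cmp[OF l(1) b t, of r] ap_cmp[OF l(1) b t', of r] ap_cmp[OF l(1) b t, of s] ap_cmp[OF l(1) b t', of s] l
      by metis
    then show ?thesis using kl t t' by metis
  qed
  show "\<exists>t\<in>on_obj P b. ap p b t = x \<and> ap q b t = y"
    if "x \<in> on_obj X b" "y \<in> on_obj Y b" "ap f b x = ap g b y"
    using exQ[OF that] ap_in[OF k(1) b] ap_cmp[OF k(1) b] k by metis
  show "ap f b (ap p b t) = ap g b (ap q b t)" if "t \<in> on_obj P b"
    using ap_cmp[OF h(3) b that, of f] ap_cmp[OF h(4) b that, of g] h(5) by metis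
qed

lemma is_pullback_exists:
  assumes f: "f \<in> hom C X Z" and g: "g \<in> hom C Y Z"
  obtains P p q where "is_pullback C X Y Z f g P p q"
proof -
  obtain P p q where "p \<in> hom C P X" "q \<in> hom C P Y" "cmp C f p = cmp C g q"
    "pointwise_pullback X Y f g P p q"
    by (rule pullback_exists[OF f g])
  from that[OF is_pullbackI[OF f g this]] show ?thesis .
qed

text \<open>
  A monomorphism equalises the projections of its kernel pair, whose elements are the pairs that it
  identifies.
\<close>

lemma mono_iff: "is_mono C M N \<tau> \<longleftrightarrow> \<tau> \<in> hom C M N \<and> inj_map M \<tau>"
proof (intro iffI conjI)
  assume m: "is_mono C M N \<tau>"
  then show t: "\<tau> \<in> hom C M N" unfolding is_mono_def by blast
  obtain P p q where pb: "is_pullback C M M N \<tau> \<tau> P p q" using is_pullback_exists[OF t t] .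
  note h = pullback_hom[OF pb]
  have "p = q" using m h(3-5) unfolding is_mono_def by blast
  then show "inj_map M \<tau>" unfolding inj_map_def using pullback_elements(2)[OF pb] by metis
next
  assume a: "\<tau> \<in> hom C M N \<and> inj_map M \<tau>"
  show "is_mono C M N \<tau>"
    unfolding is_mono_def
  proof (intro conjI allI ballI impI)
    show "\<tau> \<in> hom C M N" using a by blast
    fix W g h assume g: "g \<in> hom C W M" and h: "h \<in> hom C W M" and e: "cmp C \<tau> g = cmp C \<tau> h"
    show "g = h"
    proof (rule map_eqI[OF g h])
      fix b x assume b: "b \<in> obj B" and x: "x \<in> on_obj W b"
      have "ap \<tau> b (ap g b x) = ap \<tau> b (ap h b x)" using ap_cmp[OF g b x] ap_cmp[OF h b x] e by metis
      then show "ap g b x = ap h b x" using a inj_mapD[OF _ b ap_in[OF g b x] ap_in[OF h b x]] by blast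
    qed
  qed
qed

lemma quotient_exists:
  assumes M: "M \<in> obj C"
    and refl: "\<And>b x. b \<in> obj B \<Longrightarrow> x \<in> on_obj M b \<Longrightarrow> R b x x"
    and sym: "\<And>b x y. b \<in> obj B \<Longrightarrow> x \<in> on_obj M b \<Longrightarrow> y \<in> on_obj M b \<Longrightarrow> R b x y \<Longrightarrow> R b y x"
    and trans: "\<And>b x y z. b \<in> obj B \<Longrightarrow> x \<in> on_obj M b \<Longrightarrow> y \<in> on_obj M b \<Longrightarrow> z \<in> on_obj M b \<Longrightarrow>
      R b x y \<Longrightarrow> R b y z \<Longrightarrow> R b x z"
    and compat: "\<And>b c f x y. f \<in> hom B b c \<Longrightarrow> x \<in> on_obj M b \<Longrightarrow> y \<in> on_obj M b \<Longrightarrow> R b x y \<Longrightarrow>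
      R c (act M b c f x) (act M b c f y)"
  obtains Q e where "e \<in> hom C M Q" "surj_map M Q e"
    "\<And>b x y. b \<in> obj B \<Longrightarrow> x \<in> on_obj M b \<Longrightarrow> y \<in> on_obj M b \<Longrightarrow> ap e b x = ap e b y \<longleftrightarrow> R b x y"
proof -
  \<comment> \<open>The quotient is realised on a system of representatives, so that it stays inside the universe.\<close>
  define r where "r b x = (SOME y. y \<in> on_obj M b \<and> R b x y)" for b x
  have r: "r b x \<in> on_obj M b" "R b x (r b x)" if "b \<in> obj B" "x \<in> on_obj M b" for b x
    using someI[of "\<lambda>y. y \<in> on_obj M b \<and> R b x y" x] refl[OF that] that unfolding r_def by blast+
  have req: "r b x = r b y \<longleftrightarrow> R b x y" if b: "b \<in> obj B" and x: "x \<in> on_obj M b" and y: "y \<in> on_obj M b" for b x y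
  proof
    assume "r b x = r b y"
    then show "R b x y" using r[OF b x] r[OF b y] sym[OF b] trans[OF b] x y by metis
  next
    assume xy: "R b x y"
    have "(\<lambda>z. z \<in> on_obj M b \<and> R b x z) = (\<lambda>z. z \<in> on_obj M b \<and> R b y z)"
      using xy sym[OF b] trans[OF b] x y by (intro ext) metis
    then show "r b x = r b y" unfolding r_def by simp
  qed
  have rr: "r b (r b x) = r b x" if "b \<in> obj B" "x \<in> on_obj M b" for b x
    using req[OF that(1) that(2) r(1)[OF that]] r(2)[OF that] by simp
  obtain Q where Q: "Q \<in> obj C" and Qo: "\<And>b. b \<in> obj B \<Longrightarrow> on_obj Q b = r b ` on_obj M b"
    and Qa: "\<And>b c f x. f \<in> hom B b c \<Longrightarrow> x \<in> r b ` on_obj M b \<Longrightarrow> act Q b c f x = r c (act M b c f x)"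
  proof (rule obj_exists[of "\<lambda>b. r b ` on_obj M b" "\<lambda>b c f x. r c (act M b c f x)"])
    fix b assume "b \<in> obj B"
    then show "r b ` on_obj M b \<in> U" using set_universe_image[OF U on_obj_U[OF M]] by blast
  next
    fix b c f x assume f: "f \<in> hom B b c" and "x \<in> r b ` on_obj M b"
    then have "x \<in> on_obj M b" using r(1)[OF hom_obj(1)[OF B f]] by blast
    then show "r c (act M b c f x) \<in> r c ` on_obj M c" using act_in[OF M f] by blast
  next
    fix b x assume b: "b \<in> obj B" and "x \<in> r b ` on_obj M b"
    then show "r b (act M b b (idn B b) x) = x" using rr[OF b] act_idn[OF M b] r(1)[OF b] by auto
  next
    fix b c d f g x assume f: "f \<in> hom B b c" and g: "g \<in> hom B c d" and "x \<in> r b ` on_obj M b"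
    then have x: "x \<in> on_obj M b" using r(1)[OF hom_obj(1)[OF B f]] by blast
    note c = hom_obj(1)[OF B g] and d = hom_obj(2)[OF B g]
    note fx = act_in[OF M f x]
    have "R d (act M c d g (act M b c f x)) (act M c d g (r c (act M b c f x)))"
      using compat[OF g fx r(1)[OF c fx] r(2)[OF c fx]] .
    then show "r d (act M b d (cmp B g f) x) = r d (act M c d g (r c (act M b c f x)))"
      using req[OF d act_in[OF M g fx] act_in[OF M g r(1)[OF c fx]]] act_cmp[OF M f g x] by simp
  qed blast
  obtain e where e: "e \<in> hom C M Q" and er: "\<And>b x. b \<in> obj B \<Longrightarrow> x \<in> on_obj M b \<Longrightarrow> ap e b x = r b x"
  proof (rule map_exists[OF M Q, of r])
    fix b c f x assume f: "f \<in> hom B b c" and x: "x \<in> on_obj M b"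
    note b = hom_obj(1)[OF B f] and c = hom_obj(2)[OF B f]
    show "r c (act M b c f x) = act Q b c f (r b x)"
      using Qa[OF f imageI[OF x, of "r b"]] req[OF c act_in[OF M f x] act_in[OF M f r(1)[OF b x]]]
        compat[OF f x r(1)[OF b x] r(2)[OF b x]] by simp
  qed (use Qo in auto)
  show ?thesis
  proof (rule that[OF e])
    show "surj_map M Q e" unfolding surj_map_def using Qo er by auto
    show "ap e b x = ap e b y \<longleftrightarrow> R b x y" if "b \<in> obj B" "x \<in> on_obj M b" "y \<in> on_obj M b" for b x y
      using er req that by simp
  qed
qed

text \<open>
  A surjection is the coequalizer of its kernel pair.
\<close>

lemma descend:
  assumes e: "e \<in> hom C M Q" and surj: "surj_map M Q e" and u: "u \<in> hom C M N"
    and ker: "\<And>b x y. b \<in> obj B \<Longrightarrow> x \<in> on_obj M b \<Longrightarrow> y \<in> on_obj M b \<Longrightarrow> ap e b x = ap e b y \<Longrightarrow>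
      ap u b x = ap u b y"
  obtains w where "w \<in> hom C Q N" "cmp C w e = u"
    "\<And>b x. b \<in> obj B \<Longrightarrow> x \<in> on_obj M b \<Longrightarrow> ap w b (ap e b x) = ap u b x"
proof -
  have M: "M \<in> obj C" and Q: "Q \<in> obj C" and N: "N \<in> obj C" using hom_objects e u by auto
  have "\<forall>b y. \<exists>x. b \<in> obj B \<longrightarrow> y \<in> on_obj Q b \<longrightarrow> x \<in> on_obj M b \<and> ap e b x = y"
    using surj unfolding surj_map_def by metis
  then obtain s where s: "\<And>b y. b \<in> obj B \<Longrightarrow> y \<in> on_obj Q b \<Longrightarrow> s b y \<in> on_obj M b"
    and es: "\<And>b y. b \<in> obj B \<Longrightarrow> y \<in> on_obj Q b \<Longrightarrow> ap e b (s b y) = y" by metis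
  obtain w where w: "w \<in> hom C Q N" and ws: "\<And>b y. b \<in> obj B \<Longrightarrow> y \<in> on_obj Q b \<Longrightarrow> ap w b y = ap u b (s b y)"
  proof (rule map_exists[OF Q N, of "\<lambda>b y. ap u b (s b y)"])
    fix b c f y assume f: "f \<in> hom B b c" and y: "y \<in> on_obj Q b"
    note b = hom_obj(1)[OF B f] and c = hom_obj(2)[OF B f]
    have "ap u c (s c (act Q b c f y)) = ap u c (act M b c f (s b y))"
      by (rule ker[OF c s[OF c act_in[OF Q f y]] act_in[OF M f s[OF b y]]])
        (simp add: es[OF c act_in[OF Q f y]] ap_act[OF e f s[OF b y]] es[OF b y])
    then show "ap u c (s c (act Q b c f y)) = act N b c f (ap u b (s b y))"
      using ap_act[OF u f s[OF b y]] by simp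
  qed (use ap_in[OF u _ s] in auto)
  have we: "ap w b (ap e b x) = ap u b x" if b: "b \<in> obj B" and x: "x \<in> on_obj M b" for b x
    using ws[OF b ap_in[OF e b x]] ker[OF b s[OF b ap_in[OF e b x]] x es[OF b ap_in[OF e b x]]] by simp
  show ?thesis
  proof (rule that[OF w _ we])
    show "cmp C w e = u"
      by (rule map_eqI[OF cmp_hom[OF C e w] u]) (simp only: ap_cmp[OF e] we)
  qed
qed

lemma surj_cancel:
  assumes e: "e \<in> hom C M Q" and surj: "surj_map M Q e" and v: "v \<in> hom C Q N" and w: "w \<in> hom C Q N"
    and eq: "cmp C v e = cmp C w e"
  shows "v = w"
proof (rule map_eqI[OF v w])
  fix b y assume b: "b \<in> obj B" and y: "y \<in> on_obj Q b"
  obtain x where x: "x \<in> on_obj M b" "ap e b x = y" using surj_mapE[OF surj b y] .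
  show "ap v b y = ap w b y" using ap_cmp[OF e b x(1), of v] ap_cmp[OF e b x(1), of w] eq x(2) by simp
qed

lemma subobject_exists:
  assumes M: "M \<in> obj C" and S: "\<And>b. b \<in> obj B \<Longrightarrow> S b \<subseteq> on_obj M b"
    and closed: "\<And>b c f x. f \<in> hom B b c \<Longrightarrow> x \<in> S b \<Longrightarrow> act M b c f x \<in> S c"
  obtains N i where "i \<in> hom C N M" "inj_map N i"
    "\<And>b. b \<in> obj B \<Longrightarrow> ap i b ` on_obj N b = S b"
proof -
  have SM: "x \<in> on_obj M b" if "b \<in> obj B" "x \<in> S b" for b x using S that by blast
  obtain N where N: "N \<in> obj C" and No: "\<And>b. b \<in> obj B \<Longrightarrow> on_obj N b = S b"
    and Na: "\<And>b c f x. f \<in> hom B b c \<Longrightarrow> x \<in> S b \<Longrightarrow> act N b c f x = act M b c f x"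
  proof (rule obj_exists[of S "act M"])
    show "S b \<in> U" if "b \<in> obj B" for b
      using set_universe_subset[OF U on_obj_U[OF M that] S[OF that]] .
    show "act M b b (idn B b) x = x" if "b \<in> obj B" "x \<in> S b" for b x
      using act_idn[OF M that(1) SM[OF that]] .
    show "act M b d (cmp B g f) x = act M c d g (act M b c f x)"
      if f: "f \<in> hom B b c" and g: "g \<in> hom B c d" and x: "x \<in> S b" for b c d f g x
      using act_cmp[OF M f g SM[OF hom_obj(1)[OF B f] x]] .
  qed (use closed in auto)
  obtain i where i: "i \<in> hom C N M" "\<And>b x. b \<in> obj B \<Longrightarrow> x \<in> on_obj N b \<Longrightarrow> ap i b x = x"
    by (rule map_exists[OF N M, of "\<lambda>_ x. x"]) (use No Na SM hom_obj(1)[OF B] in auto)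
  show ?thesis by (rule that[OF i(1)]) (use i No in \<open>auto simp: inj_map_def\<close>)
qed

end

section \<open>Left Kan extensions of set-valued functors\<close>

locale kan_setting =
  fixes U :: "'u set set" and B :: "('u, 'u) cat" and A :: "('a, 'u) cat"
    and K :: "('u, 'u, 'a, 'u) fnctr"
  assumes universe: "set_universe U" and small: "small_category U B"
    and loc_small: "locally_small_category U A" and K: "is_functor B A K"
begin

sublocale copresheaves U B
  using universe small by unfold_locales (auto simp: small_category_def)

sublocale SA: copresheaves U A
  using universe loc_small by unfold_locales (auto simp: locally_small_category_def)

abbreviation R :: "(('a, 'u) copresheaf, ('a, 'u) copresheaf_map, ('u, 'u) copresheaf, ('u, 'u) copresheaf_map) fnctr"
  where "R \<equiv> precomp B K"

lemma R_functor: "is_functor SA.C C R"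
  using precomp_is_functor[OF B SA.B category_Set_cat K] .

lemma K_obj: "b \<in> obj B \<Longrightarrow> on_obj K b \<in> obj A"
  using functor_obj[OF K] .

lemma K_hom: "f \<in> hom B b c \<Longrightarrow> on_arr K b c f \<in> hom A (on_obj K b) (on_obj K c)"
  using functor_hom[OF K] .

lemma R_on_obj: "b \<in> obj B \<Longrightarrow> on_obj (on_obj R N) b = on_obj N (on_obj K b)"
  by (simp add: precomp_def restrict_fun_def)

lemma R_act: "f \<in> hom B b c \<Longrightarrow>
    act (on_obj R N) b c f x = act N (on_obj K b) (on_obj K c) (on_arr K b c f) x"
  by (simp add: precomp_def restrict_fun_def act_def)

lemma R_ap: "b \<in> obj B \<Longrightarrow> ap (on_arr R N N' \<tau>) b x = ap \<tau> (on_obj K b) x"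
  by (simp add: precomp_def ap_def)

text \<open>
  The coend formula for \<open>Lan\<^sub>K M\<close> asks for the equivalence relation on triples \<open>(b, g, x)\<close> that is
  generated by moving maps of \<open>B\<close> across. Instead of generating it, two triples are identified when
  all maps \<open>\<sigma> : M \<rightarrow> N K\<close> give them the same value; then each \<open>\<sigma>\<close> factors through the quotient
  by definition, and uniqueness holds because every triple is obtained by acting with \<open>g\<close> on
  \<open>\<theta>\<^sub>b x\<close>.
\<close>

lemma left_Kan_extension_exists:
  assumes M: "M \<in> obj C"
  shows "\<exists>L \<theta>. is_left_Kan_extension B A (Set_cat U) K M L \<theta>"
proof -
  define tri :: "'u \<Rightarrow> 'u \<Rightarrow> 'u \<Rightarrow> 'u" where "tri b g x = pair b (pair g x)" for b g x
  define X where "X a = sigma (obj B) (\<lambda>b. sigma (hom A (on_obj K b) a) (\<lambda>_. on_obj M b))" for a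
  define \<alpha> where "\<alpha> a a' h t = tri (left t) (cmp A h (left (right t))) (right (right t))" for a a' :: 'a and h t
  have X_iff: "t \<in> X a \<longleftrightarrow> (\<exists>b g x. t = tri b g x \<and> b \<in> obj B \<and> g \<in> hom A (on_obj K b) a \<and> x \<in> on_obj M b)" for t a
    unfolding X_def tri_def in_sigma by blast
  have \<alpha>_tri: "\<alpha> a a' h (tri b g x) = tri b (cmp A h g) x" for a a' h b g x
    unfolding \<alpha>_def tri_def by simp
  obtain G where G: "G \<in> obj SA.C" and Go: "\<And>a. a \<in> obj A \<Longrightarrow> on_obj G a = X a"
    and Ga: "\<And>a a' h t. h \<in> hom A a a' \<Longrightarrow> t \<in> X a \<Longrightarrow> act G a a' h t = \<alpha> a a' h t"
  proof (rule SA.obj_exists[of X \<alpha>])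
    fix a assume a: "a \<in> obj A"
    show "X a \<in> U" unfolding X_def
    proof (intro set_universe_sigma[OF universe])
      show "obj B \<in> U" using small by (simp add: small_category_def)
      show "hom A (on_obj K b) a \<in> U" if "b \<in> obj B" for b
        using loc_small K_obj[OF that] a by (simp add: locally_small_category_def)
      show "on_obj M b \<in> U" if "b \<in> obj B" for b using on_obj_U[OF M that] .
    qed
  next
    fix a a' h t assume h: "h \<in> hom A a a'" and "t \<in> X a"
    then show "\<alpha> a a' h t \<in> X a'" unfolding X_iff using \<alpha>_tri cmp_hom[OF SA.B _ h] by metis
  next
    fix a t assume "a \<in> obj A" "t \<in> X a"
    then show "\<alpha> a a (idn A a) t = t" unfolding X_iff using \<alpha>_tri cmp_idl[OF SA.B] by metis
  next
    fix a a' a'' h k t assume "h \<in> hom A a a'" "k \<in> hom A a' a''" "t \<in> X a"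
    then show "\<alpha> a a'' (cmp A k h) t = \<alpha> a' a'' k (\<alpha> a a' h t)"
      unfolding X_iff using \<alpha>_tri cmp_assoc[OF SA.B] by metis
  qed blast
  have G_iff: "t \<in> on_obj G a \<longleftrightarrow> (\<exists>b g x. t = tri b g x \<and> b \<in> obj B \<and> g \<in> hom A (on_obj K b) a \<and> x \<in> on_obj M b)"
    if "a \<in> obj A" for t a using Go[OF that] X_iff by simp
  have tri_in: "tri b g x \<in> on_obj G a" if "b \<in> obj B" "g \<in> hom A (on_obj K b) a" "x \<in> on_obj M b" for b g x a
    using G_iff[OF hom_obj(2)[OF SA.B that(2)]] that by blast
  have act_tri: "act G a a' h (tri b g x) = tri b (cmp A h g) x"
    if "h \<in> hom A a a'" "b \<in> obj B" "g \<in> hom A (on_obj K b) a" "x \<in> on_obj M b" for a a' h b g x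
    using Ga[OF that(1)] X_iff \<alpha>_tri that by metis
  \<comment> \<open>The value at a triple of the map out of the Kan extension that \<open>\<sigma> : M \<rightarrow> N K\<close> has to induce.\<close>
  define val where "val N \<sigma> a t = act N (on_obj K (left t)) a (left (right t)) (ap \<sigma> (left t) (right (right t)))"
    for N :: "('a, 'u) copresheaf" and \<sigma> :: "('u, 'u) copresheaf_map" and a t
  have val_tri: "val N \<sigma> a (tri b g x) = act N (on_obj K b) a g (ap \<sigma> b x)" for N \<sigma> a b g x
    unfolding val_def tri_def by simp
  have \<sigma>x: "ap \<sigma> b x \<in> on_obj N (on_obj K b)"
    if "\<sigma> \<in> hom C M (on_obj R N)" "b \<in> obj B" "x \<in> on_obj M b" for N \<sigma> b x
    using ap_in[OF that] R_on_obj[OF that(2)] by simp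
  have val_in: "val N \<sigma> a t \<in> on_obj N a"
    if N: "N \<in> obj SA.C" and s: "\<sigma> \<in> hom C M (on_obj R N)" and a: "a \<in> obj A" and t: "t \<in> on_obj G a" for N \<sigma> a t
    using t unfolding G_iff[OF a] using val_tri SA.act_in[OF N _ \<sigma>x[OF s]] by auto
  have val_act: "val N \<sigma> a' (act G a a' h t) = act N a a' h (val N \<sigma> a t)"
    if N: "N \<in> obj SA.C" and s: "\<sigma> \<in> hom C M (on_obj R N)" and h: "h \<in> hom A a a'" and t: "t \<in> on_obj G a" for N \<sigma> a a' h t
    using t unfolding G_iff[OF hom_obj(1)[OF SA.B h]]
    using val_tri act_tri[OF h] SA.act_cmp[OF N _ h \<sigma>x[OF s]] by auto
  define rel where "rel a t t' \<longleftrightarrow> (\<forall>N\<in>obj SA.C. \<forall>\<sigma>\<in>hom C M (on_obj R N). val N \<sigma> a t = val N \<sigma> a t')" for a t t'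
  obtain L e where e: "e \<in> hom SA.C G L" and es: "SA.surj_map G L e"
    and ek: "\<And>a t t'. a \<in> obj A \<Longrightarrow> t \<in> on_obj G a \<Longrightarrow> t' \<in> on_obj G a \<Longrightarrow> ap e a t = ap e a t' \<longleftrightarrow> rel a t t'"
  proof (rule SA.quotient_exists[OF G, of rel])
    fix a a' h t t' assume "h \<in> hom A a a'" "t \<in> on_obj G a" "t' \<in> on_obj G a" "rel a t t'"
    then show "rel a' (act G a a' h t) (act G a a' h t')" unfolding rel_def using val_act by metis
  qed (auto simp: rel_def)
  have L: "L \<in> obj SA.C" using SA.hom_objects[OF e] by blast
  have RL: "on_obj R L \<in> obj C" using functor_obj[OF R_functor L] .
  have idK: "idn A (on_obj K b) \<in> hom A (on_obj K b) (on_obj K b)" if "b \<in> obj B" for b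
    using idn_hom[OF SA.B K_obj[OF that]] .
  obtain \<theta> where \<theta>: "\<theta> \<in> hom C M (on_obj R L)"
    and \<theta>_ap: "\<And>b x. b \<in> obj B \<Longrightarrow> x \<in> on_obj M b \<Longrightarrow> ap \<theta> b x = ap e (on_obj K b) (tri b (idn A (on_obj K b)) x)"
  proof (rule map_exists[OF M RL, of "\<lambda>b x. ap e (on_obj K b) (tri b (idn A (on_obj K b)) x)"])
    fix b x assume b: "b \<in> obj B" and x: "x \<in> on_obj M b"
    show "ap e (on_obj K b) (tri b (idn A (on_obj K b)) x) \<in> on_obj (on_obj R L) b"
      using SA.ap_in[OF e K_obj[OF b] tri_in[OF b idK[OF b] x]] R_on_obj[OF b] by simp
  next
    fix b c f x assume f: "f \<in> hom B b c" and x: "x \<in> on_obj M b"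
    note b = hom_obj(1)[OF B f] and c = hom_obj(2)[OF B f]
    note fx = act_in[OF M f x]
    have "rel (on_obj K c) (tri c (idn A (on_obj K c)) (act M b c f x)) (tri b (on_arr K b c f) x)"
      unfolding rel_def
    proof (intro ballI)
      fix N \<sigma> assume N: "N \<in> obj SA.C" and s: "\<sigma> \<in> hom C M (on_obj R N)"
      show "val N \<sigma> (on_obj K c) (tri c (idn A (on_obj K c)) (act M b c f x)) =
            val N \<sigma> (on_obj K c) (tri b (on_arr K b c f) x)"
        using val_tri SA.act_idn[OF N K_obj[OF c] \<sigma>x[OF s c fx]] ap_act[OF s f x] R_act[OF f] by metis
    qed
    then have "ap e (on_obj K c) (tri c (idn A (on_obj K c)) (act M b c f x)) = ap e (on_obj K c) (tri b (on_arr K b c f) x)"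
      using ek[OF K_obj[OF c] tri_in[OF c idK[OF c] fx] tri_in[OF b K_hom[OF f] x]] by blast
    also have "tri b (on_arr K b c f) x = act G (on_obj K b) (on_obj K c) (on_arr K b c f) (tri b (idn A (on_obj K b)) x)"
      using act_tri[OF K_hom[OF f] b idK[OF b] x] cmp_idr[OF SA.B K_hom[OF f]] by metis
    finally show "ap e (on_obj K c) (tri c (idn A (on_obj K c)) (act M b c f x)) =
        act (on_obj R L) b c f (ap e (on_obj K b) (tri b (idn A (on_obj K b)) x))"
      using SA.ap_act[OF e K_hom[OF f] tri_in[OF b idK[OF b] x]] R_act[OF f] by metis
  qed blast
  have e_tri: "ap e a (tri b g x) = act L (on_obj K b) a g (ap \<theta> b x)"
    if b: "b \<in> obj B" and g: "g \<in> hom A (on_obj K b) a" and x: "x \<in> on_obj M b" for a b g x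
    using act_tri[OF g b idK[OF b] x] cmp_idr[OF SA.B g] SA.ap_act[OF e g tri_in[OF b idK[OF b] x]] \<theta>_ap[OF b x] by metis
  have "\<exists>!\<tau>. \<tau> \<in> hom SA.C L N \<and> cmp C (on_arr R L N \<tau>) \<theta> = \<sigma>"
    if N: "N \<in> obj SA.C" and s: "\<sigma> \<in> hom C M (on_obj R N)" for N \<sigma>
  proof -
    obtain v where v: "v \<in> hom SA.C G N" and vv: "\<And>a t. a \<in> obj A \<Longrightarrow> t \<in> on_obj G a \<Longrightarrow> ap v a t = val N \<sigma> a t"
      by (rule SA.map_exists[OF G N, of "val N \<sigma>"]) (use val_in[OF N s] val_act[OF N s] in auto)
    obtain \<tau> where t: "\<tau> \<in> hom SA.C L N" and tv: "\<And>a x. a \<in> obj A \<Longrightarrow> x \<in> on_obj G a \<Longrightarrow> ap \<tau> a (ap e a x) = ap v a x"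
    proof (rule SA.descend[OF e es v])
      fix a x y assume a: "a \<in> obj A" and x: "x \<in> on_obj G a" and y: "y \<in> on_obj G a" and "ap e a x = ap e a y"
      then have "rel a x y" using ek by blast
      then show "ap v a x = ap v a y" using vv[OF a x] vv[OF a y] N s unfolding rel_def by metis
    qed blast
    have Rt: "on_arr R L N \<tau> \<in> hom C (on_obj R L) (on_obj R N)" using functor_hom[OF R_functor t] .
    have t\<theta>: "cmp C (on_arr R L N \<tau>) \<theta> = \<sigma>"
    proof (rule map_eqI[OF cmp_hom[OF C \<theta> Rt] s])
      fix b x assume b: "b \<in> obj B" and x: "x \<in> on_obj M b"
      note ti = tri_in[OF b idK[OF b] x]
      have "ap (cmp C (on_arr R L N \<tau>) \<theta>) b x = ap \<tau> (on_obj K b) (ap e (on_obj K b) (tri b (idn A (on_obj K b)) x))"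
        using ap_cmp[OF \<theta> b x] R_ap[OF b] \<theta>_ap[OF b x] by metis
      also have "\<dots> = ap \<sigma> b x"
        using tv[OF K_obj[OF b] ti] vv[OF K_obj[OF b] ti] val_tri SA.act_idn[OF N K_obj[OF b] \<sigma>x[OF s b x]] by metis
      finally show "ap (cmp C (on_arr R L N \<tau>) \<theta>) b x = ap \<sigma> b x" .
    qed
    show ?thesis
    proof (intro ex1I conjI)
      show "\<tau> \<in> hom SA.C L N" "cmp C (on_arr R L N \<tau>) \<theta> = \<sigma>" using t t\<theta> by blast+
      fix \<rho> assume r: "\<rho> \<in> hom SA.C L N \<and> cmp C (on_arr R L N \<rho>) \<theta> = \<sigma>"
      then have rh: "\<rho> \<in> hom SA.C L N" by blast
      show "\<rho> = \<tau>"
      proof (rule SA.surj_cancel[OF e es rh t], rule SA.map_eqI[OF cmp_hom[OF SA.C e rh] cmp_hom[OF SA.C e t]])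
        fix a y assume a: "a \<in> obj A" and y: "y \<in> on_obj G a"
        obtain b g x where y_eq: "y = tri b g x" and b: "b \<in> obj B" and g: "g \<in> hom A (on_obj K b) a" and x: "x \<in> on_obj M b"
          using y unfolding G_iff[OF a] by blast
        have "ap w a (ap e a y) = act N (on_obj K b) a g (ap \<sigma> b x)"
          if w: "w \<in> hom SA.C L N" and w\<theta>: "cmp C (on_arr R L N w) \<theta> = \<sigma>" for w
          using SA.ap_act[OF w g \<sigma>x[OF \<theta> b x]] e_tri[OF b g x] y_eq ap_cmp[OF \<theta> b x, of "on_arr R L N w"] R_ap[OF b] w\<theta> by metis
        then show "ap (cmp SA.C \<rho> e) a y = ap (cmp SA.C \<tau> e) a y"
          using r t t\<theta> SA.ap_cmp[OF e a y] by metis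
      qed
    qed
  qed
  then show ?thesis unfolding is_left_Kan_extension_def using L \<theta> by blast
qed

lemma Lan_adjunction_exists: "\<exists>Lan \<theta> \<epsilon>. Lan_adjunction U B A K Lan \<theta> \<epsilon>"
proof -
  obtain L \<theta> where L: "\<And>M. M \<in> obj C \<Longrightarrow> is_left_Kan_extension B A (Set_cat U) K M (L M) (\<theta> M)"
    using left_Kan_extension_exists by metis
  have "\<exists>Lan \<epsilon>. on_obj Lan = L \<and> adjunction C SA.C Lan R \<theta> \<epsilon>"
  proof (rule adjunction_from_universal_arrows[OF C SA.C R_functor])
    show "L M \<in> obj SA.C" "\<theta> M \<in> hom C M (on_obj R (L M))" if "M \<in> obj C" for M
      using L[OF that] unfolding is_left_Kan_extension_def by blast+
    show "\<exists>!\<tau>. \<tau> \<in> hom SA.C (L M) N \<and> cmp C (on_arr R (L M) N \<tau>) (\<theta> M) = \<sigma>"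
      if "M \<in> obj C" "N \<in> obj SA.C" "\<sigma> \<in> hom C M (on_obj R N)" for M N \<sigma>
      using L[OF that(1)] that(2,3) unfolding is_left_Kan_extension_def by blast
  qed
  then show ?thesis unfolding Lan_adjunction_def using L by metis
qed

end

section \<open>Effective descent morphisms of set-valued functors are the surjections\<close>

lemma is_iso_sym:
  assumes "is_iso C x y f"
  obtains g where "is_iso C y x g"
  using assms unfolding is_iso_def by blast

text \<open>
  Pulling back along \<open>p\<close>, the inclusion of the image of \<open>p\<close> becomes an isomorphism, because
  all elements of the base that lie under \<open>E\<close> are in the image. As the pullback functor is monadic, the
  inclusion is an isomorphism itself.
\<close>

lemma (in copresheaves) effective_descent_imp_surj:
  assumes ed: "effective_descent C E Y p"
  shows "surj_map E Y p"
proof -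
  have p: "p \<in> hom C E Y" using ed unfolding effective_descent_def by blast
  obtain P q where P: "pullback_choice C E Y p P q" and mon: "monadic (slice_cat C Y) (slice_cat C E) P"
    using ed unfolding effective_descent_def is_pullback_functor_iff by blast
  have PF: "is_functor (slice_cat C Y) (slice_cat C E) P"
    and pb: "\<And>x. snd x \<in> hom C (fst x) Y \<Longrightarrow>
      is_pullback C E (fst x) Y p (snd x) (fst (on_obj P x)) (snd (on_obj P x)) (q x)"
    and qn: "\<And>x y h. h \<in> hom (slice_cat C Y) x y \<Longrightarrow> cmp C (q y) (on_arr P x y h) = cmp C h (q x)"
    using P unfolding pullback_choice_def by auto
  have E: "E \<in> obj C" and Y: "Y \<in> obj C" using hom_objects[OF p] by auto
  obtain N i where i: "i \<in> hom C N Y" and inj: "inj_map N i"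
    and im: "\<And>b. b \<in> obj B \<Longrightarrow> ap i b ` on_obj N b = ap p b ` on_obj E b"
  proof (rule subobject_exists[OF Y, of "\<lambda>b. ap p b ` on_obj E b"])
    show "ap p b ` on_obj E b \<subseteq> on_obj Y b" if "b \<in> obj B" for b using ap_in[OF p that] by blast
    show "act Y b c f y \<in> ap p c ` on_obj E c" if f: "f \<in> hom B b c" and y: "y \<in> ap p b ` on_obj E b" for b c f y
      using y ap_act[OF p f, symmetric] act_in[OF E f] by blast
  qed blast
  let ?x = "(N, i)" and ?y = "(Y, idn C Y)"
  have idY: "idn C Y \<in> hom C Y Y" using idn_hom[OF C Y] .
  have ih: "i \<in> hom (slice_cat C Y) ?x ?y" using i idY cmp_idl[OF C i] by (simp add: slice_hom)
  note Pi = functor_hom[OF PF ih]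
  have Pi': "on_arr P ?x ?y i \<in> hom C (fst (on_obj P ?x)) (fst (on_obj P ?y))"
    and \<pi>i: "cmp C (snd (on_obj P ?y)) (on_arr P ?x ?y i) = snd (on_obj P ?x)"
    using Pi by (auto simp: slice_hom)
  have pbx: "is_pullback C E N Y p i (fst (on_obj P ?x)) (snd (on_obj P ?x)) (q ?x)" using pb[of ?x] i by simp
  have pby: "is_pullback C E Y Y p (idn C Y) (fst (on_obj P ?y)) (snd (on_obj P ?y)) (q ?y)" using pb[of ?y] idY by simp
  note hx = pullback_hom[OF pbx] and hy = pullback_hom[OF pby]
  have e1: "ap (snd (on_obj P ?y)) b (ap (on_arr P ?x ?y i) b t) = ap (snd (on_obj P ?x)) b t"
    and e2: "ap (q ?y) b (ap (on_arr P ?x ?y i) b t) = ap i b (ap (q ?x) b t)"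
    if "b \<in> obj B" "t \<in> on_obj (fst (on_obj P ?x)) b" for b t
    using ap_cmp[OF Pi' that, of "snd (on_obj P ?y)"] \<pi>i ap_cmp[OF Pi' that, of "q ?y"] ap_cmp[OF hx(4) that, of i] qn[OF ih]
    by metis+
  have "inj_map (fst (on_obj P ?x)) (on_arr P ?x ?y i)"
    unfolding inj_map_def
  proof (intro ballI impI)
    fix b t t' assume b: "b \<in> obj B" and t: "t \<in> on_obj (fst (on_obj P ?x)) b" and t': "t' \<in> on_obj (fst (on_obj P ?x)) b"
      and eq: "ap (on_arr P ?x ?y i) b t = ap (on_arr P ?x ?y i) b t'"
    have "ap (q ?x) b t = ap (q ?x) b t'"
      using inj_mapD[OF inj b ap_in[OF hx(4) b t] ap_in[OF hx(4) b t']] e2[OF b t] e2[OF b t'] eq by metis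
    then show "t = t'" using pullback_elements(1)[OF pbx b t t'] e1[OF b t] e1[OF b t'] eq by metis
  qed
  moreover have "surj_map (fst (on_obj P ?x)) (fst (on_obj P ?y)) (on_arr P ?x ?y i)"
    unfolding surj_map_def
  proof (intro ballI)
    fix b s assume b: "b \<in> obj B" and s: "s \<in> on_obj (fst (on_obj P ?y)) b"
    note es = ap_in[OF hy(3) b s] and ys = ap_in[OF hy(4) b s]
    have py: "ap p b (ap (snd (on_obj P ?y)) b s) = ap (q ?y) b s"
      using pullback_elements(3)[OF pby b s] ap_idn[OF b ys] by metis
    have "ap p b (ap (snd (on_obj P ?y)) b s) \<in> ap i b ` on_obj N b"
      unfolding im[OF b] using es by (rule imageI)
    then obtain n where n: "ap p b (ap (snd (on_obj P ?y)) b s) = ap i b n" "n \<in> on_obj N b"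
      by (rule imageE)
    obtain t where t: "t \<in> on_obj (fst (on_obj P ?x)) b" "ap (snd (on_obj P ?x)) b t = ap (snd (on_obj P ?y)) b s" "ap (q ?x) b t = n"
      using pullback_elements(2)[OF pbx b es n(2) n(1)] by blast
    have "ap (on_arr P ?x ?y i) b t = s"
      by (rule pullback_elements(1)[OF pby b ap_in[OF Pi' b t(1)] s])
        (simp_all only: e1[OF b t(1)] e2[OF b t(1)] t(2,3) py[symmetric] n(1))
    then show "\<exists>t\<in>on_obj (fst (on_obj P ?x)) b. ap (on_arr P ?x ?y i) b t = s" using t(1) by blast
  qed
  ultimately have "is_iso (slice_cat C E) (on_obj P ?x) (on_obj P ?y) (on_arr P ?x ?y i)"
    using slice_iso[OF C Pi] iso_iff Pi' by blast
  then have "is_iso (slice_cat C Y) ?x ?y i"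
    using monadic_reflects_iso[OF category_slice_cat[OF C] category_slice_cat[OF C] mon ih] by blast
  then have si: "surj_map N Y i" using slice_iso[OF C ih] iso_iff by simp
  show ?thesis unfolding surj_map_def
  proof (intro ballI)
    fix b y assume b: "b \<in> obj B" and y: "y \<in> on_obj Y b"
    obtain n where "n \<in> on_obj N b" "ap i b n = y" using surj_mapE[OF si b y] .
    then have "y \<in> ap p b ` on_obj E b" unfolding im[OF b, symmetric] by blast
    then show "\<exists>x\<in>on_obj E b. ap p b x = y" by blast
  qed
qed

text \<open>
  The situation of a pullback functor along a surjection. The elements of \<open>W x\<close> are the pairs of an
  element of \<open>E\<close> (read off by \<open>\<pi> x\<close>) and an element of the domain of \<open>x\<close> (read off by \<open>q x\<close>)
  over the same point of \<open>Y\<close>.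
\<close>

locale surjection_descent = copresheaves U B for U :: "'u set set" and B :: "('b, 'u) cat" +
  fixes E Y p P q \<eta>
  assumes p: "p \<in> hom C E Y" and surj: "surj_map E Y p"
    and choice: "pullback_choice C E Y p P q"
    and adj: "adjunction (slice_cat C E) (slice_cat C Y) (postcomp_fun C p) P \<eta> q"
    and unit: "\<And>z. snd z \<in> hom C (fst z) E \<Longrightarrow>
      cmp C (snd (on_obj P (fst z, cmp C p (snd z)))) (\<eta> z) = snd z \<and>
      cmp C (q (fst z, cmp C p (snd z))) (\<eta> z) = idn C (fst z)"
begin

abbreviation "CY \<equiv> slice_cat C Y"
abbreviation "CE \<equiv> slice_cat C E"
abbreviation "W x \<equiv> fst (on_obj P x)"
abbreviation "\<pi> x \<equiv> snd (on_obj P x)"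
abbreviation "L z \<equiv> (fst z, cmp C p (snd z))"
abbreviation "T \<equiv> comp_fun P (postcomp_fun C p)"
abbreviation "\<mu> \<equiv> monad_mult (postcomp_fun C p) P q"
abbreviation "EM \<equiv> EM_cat CE T \<eta> \<mu>"
abbreviation "F \<equiv> comparison (postcomp_fun C p) P q"

lemma CE: "category CE" and CY: "category CY"
  using category_slice_cat[OF C] by blast+

lemma PF: "is_functor CY CE P"
  using choice unfolding pullback_choice_def by blast

lemma TF: "is_functor CE CE T"
  using is_functor_comp adjunctionD(1,2)[OF adj] by blast

lemma FF: "is_functor CY EM F"
  using comparison_functor[OF CY CE adj] .

lemma pb: "snd x \<in> hom C (fst x) Y \<Longrightarrow> is_pullback C E (fst x) Y p (snd x) (W x) (\<pi> x) (q x)"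
  using choice unfolding pullback_choice_def by blast

lemma \<pi>_hom: "snd x \<in> hom C (fst x) Y \<Longrightarrow> \<pi> x \<in> hom C (W x) E"
  using pullback_hom[OF pb] by blast

lemma q_hom: "snd x \<in> hom C (fst x) Y \<Longrightarrow> q x \<in> hom C (W x) (fst x)"
  using pullback_hom[OF pb] by blast

lemma L_hom: "snd z \<in> hom C (fst z) E \<Longrightarrow> snd (L z) \<in> hom C (fst (L z)) Y"
  using cmp_hom[OF C _ p] by simp

lemma p_\<pi>: "snd x \<in> hom C (fst x) Y \<Longrightarrow> b \<in> obj B \<Longrightarrow> t \<in> on_obj (W x) b \<Longrightarrow>
    ap p b (ap (\<pi> x) b t) = ap (snd x) b (ap (q x) b t)"
  using pullback_elements(3)[OF pb] .

lemma W_eqI: "snd x \<in> hom C (fst x) Y \<Longrightarrow> b \<in> obj B \<Longrightarrow> t \<in> on_obj (W x) b \<Longrightarrow> t' \<in> on_obj (W x) b \<Longrightarrow>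
    ap (\<pi> x) b t = ap (\<pi> x) b t' \<Longrightarrow> ap (q x) b t = ap (q x) b t' \<Longrightarrow> t = t'"
  using pullback_elements(1)[OF pb] .

lemma W_ex:
  assumes "snd x \<in> hom C (fst x) Y" "b \<in> obj B" "e \<in> on_obj E b" "y \<in> on_obj (fst x) b"
    "ap p b e = ap (snd x) b y"
  obtains t where "t \<in> on_obj (W x) b" "ap (\<pi> x) b t = e" "ap (q x) b t = y"
  using pullback_elements(2)[OF pb[OF assms(1)] assms(2-5)] by blast

lemma P_hom: "h \<in> hom CY x y \<Longrightarrow> on_arr P x y h \<in> hom C (W x) (W y)"
  using functor_hom[OF PF] by (simp add: slice_hom)

lemma \<pi>_P: "h \<in> hom CY x y \<Longrightarrow> b \<in> obj B \<Longrightarrow> t \<in> on_obj (W x) b \<Longrightarrow>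
    ap (\<pi> y) b (ap (on_arr P x y h) b t) = ap (\<pi> x) b t"
  using functor_hom[OF PF, of h x y] ap_cmp[OF P_hom, of h x y b t "\<pi> y"] by (simp add: slice_hom del: functor_cat_simps)

lemma q_P:
  assumes h: "h \<in> hom CY x y" and b: "b \<in> obj B" and t: "t \<in> on_obj (W x) b"
  shows "ap (q y) b (ap (on_arr P x y h) b t) = ap h b (ap (q x) b t)"
proof -
  have x: "snd x \<in> hom C (fst x) Y" using h by (simp add: slice_hom)
  have "cmp C (q y) (on_arr P x y h) = cmp C h (q x)"
    using choice h unfolding pullback_choice_def by blast
  then show ?thesis using ap_cmp[OF P_hom[OF h] b t, of "q y"] ap_cmp[OF q_hom[OF x] b t, of h] by metis
qed

lemma q_surj:
  assumes x: "snd x \<in> hom C (fst x) Y"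
  shows "surj_map (W x) (fst x) (q x)"
  unfolding surj_map_def
proof (intro ballI)
  fix b y assume b: "b \<in> obj B" and y: "y \<in> on_obj (fst x) b"
  obtain e where e: "e \<in> on_obj E b" "ap p b e = ap (snd x) b y"
    using surj_mapE[OF surj b ap_in[OF x b y]] .
  obtain t where "t \<in> on_obj (W x) b" "ap (\<pi> x) b t = e" "ap (q x) b t = y"
    using W_ex[OF x b e(1) y e(2)] .
  then show "\<exists>t\<in>on_obj (W x) b. ap (q x) b t = y" by blast
qed

lemma EM_hom: "h \<in> hom EM X X' \<longleftrightarrow> X \<in> EM_algebras CE T \<eta> \<mu> \<and> X' \<in> EM_algebras CE T \<eta> \<mu> \<and>
    h \<in> hom CE (fst X) (fst X') \<and>
    cmp C h (snd X) = cmp C (snd X') (on_arr P (L (fst X)) (L (fst X')) h)"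
  by (simp add: EM_cat_def)

lemma F_simps: "on_obj F x = (on_obj P x, on_arr P (L (on_obj P x)) x (q x))" "on_arr F = on_arr P"
  by (simp_all add: comparison_def)

lemma q_slice: "snd x \<in> hom C (fst x) Y \<Longrightarrow> q x \<in> hom CY (L (on_obj P x)) x"
  using adjunctionD(5)[OF adj, of x] by (simp add: slice_obj)

lemma comparison_fully_faithful:
  assumes x: "x \<in> obj CY" and y: "y \<in> obj CY" and h: "h \<in> hom EM (on_obj F x) (on_obj F y)"
  shows "\<exists>!g. g \<in> hom CY x y \<and> on_arr F x y g = h"
proof -
  have x': "snd x \<in> hom C (fst x) Y" and y': "snd y \<in> hom C (fst y) Y" using x y by (auto simp: slice_obj)
  have hE: "h \<in> hom CE (on_obj P x) (on_obj P y)"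
    and h_alg: "cmp C h (on_arr P (L (on_obj P x)) x (q x)) =
      cmp C (on_arr P (L (on_obj P y)) y (q y)) (on_arr P (L (on_obj P x)) (L (on_obj P y)) h)"
    using h unfolding EM_hom F_simps by auto
  have hh: "h \<in> hom C (W x) (W y)" and \<pi>h: "cmp C (\<pi> y) h = \<pi> x" using hE by (auto simp: slice_hom)
  have Lh: "h \<in> hom CY (L (on_obj P x)) (L (on_obj P y))"
    using functor_hom[OF adjunctionD(1)[OF adj] hE] by simp
  let ?Lx = "L (on_obj P x)" and ?Ly = "L (on_obj P y)"
  have Lx': "snd ?Lx \<in> hom C (fst ?Lx) Y" and Ly': "snd ?Ly \<in> hom C (fst ?Ly) Y"
    using L_hom \<pi>_hom[OF x'] \<pi>_hom[OF y'] by blast+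
  note qx = q_slice[OF x'] and qy = q_slice[OF y']
  have qh: "cmp C (q y) h \<in> hom C (W x) (fst y)" using cmp_hom[OF C hh q_hom[OF y']] .
  \<comment> \<open>The value of \<open>h\<close> on the fibre over a point of the base does not depend on the point of
    \<open>E\<close>: this is what compatibility with the free algebra structures says.\<close>
  have const: "ap (cmp C (q y) h) b t = ap (cmp C (q y) h) b t'"
    if b: "b \<in> obj B" and t: "t \<in> on_obj (W x) b" and t': "t' \<in> on_obj (W x) b" and eq: "ap (q x) b t = ap (q x) b t'" for b t t'
  proof -
    have "ap p b (ap (\<pi> x) b t) = ap p b (ap (\<pi> x) b t')"
      using p_\<pi>[OF x' b t] p_\<pi>[OF x' b t'] eq by simp
    then have "ap p b (ap (\<pi> x) b t) = ap (snd ?Lx) b t'"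
      using ap_cmp[OF \<pi>_hom[OF x'] b t', of p] by (simp del: functor_cat_simps)
    then obtain u where u: "u \<in> on_obj (W ?Lx) b" "ap (\<pi> ?Lx) b u = ap (\<pi> x) b t" "ap (q ?Lx) b u = t'"
      using W_ex[OF Lx' b ap_in[OF \<pi>_hom[OF x'] b t], of t'] t' by (metis fst_conv)
    let ?s = "on_arr P ?Lx x (q x)"
    have su: "ap ?s b u = t"
      using W_eqI[OF x' b ap_in[OF P_hom[OF qx] b u(1)] t] \<pi>_P[OF qx b u(1)] q_P[OF qx b u(1)] u eq by metis
    have "ap h b t = ap (on_arr P ?Ly y (q y)) b (ap (on_arr P ?Lx ?Ly h) b u)"
      using h_alg ap_cmp[OF P_hom[OF qx] b u(1), of h] su ap_cmp[OF P_hom[OF Lh] b u(1), of "on_arr P ?Ly y (q y)"] by metis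
    then have "ap (q y) b (ap h b t) = ap (q y) b (ap h b t')"
      using q_P[OF qy b ap_in[OF P_hom[OF Lh] b u(1)]] q_P[OF Lh b u(1)] u(3) by metis
    then show ?thesis using ap_cmp[OF hh b t, of "q y"] ap_cmp[OF hh b t', of "q y"] by metis
  qed
  obtain g where g: "g \<in> hom C (fst x) (fst y)" and gq: "cmp C g (q x) = cmp C (q y) h"
    by (rule descend[OF q_hom[OF x'] q_surj[OF x'] qh const])
  have "cmp C (snd y) g = snd x"
  proof (rule surj_cancel[OF q_hom[OF x'] q_surj[OF x'] cmp_hom[OF C g y'] x'])
    have "cmp C (cmp C (snd y) g) (q x) = cmp C (cmp C (snd y) (q y)) h"
      using cmp_assoc[OF C q_hom[OF x'] g y'] cmp_assoc[OF C hh q_hom[OF y'] y'] gq by metis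
    also have "\<dots> = cmp C p (\<pi> x)"
      using pullback_hom(5)[OF pb[OF y']] cmp_assoc[OF C hh \<pi>_hom[OF y'] p] \<pi>h by metis
    also have "\<dots> = cmp C (snd x) (q x)" using pullback_hom(5)[OF pb[OF x']] .
    finally show "cmp C (cmp C (snd y) g) (q x) = cmp C (snd x) (q x)" .
  qed
  then have gs: "g \<in> hom CY x y" using g x' y' by (simp add: slice_hom)
  have qP: "cmp C (q y) (on_arr P x y k) = cmp C k (q x)" if "k \<in> hom CY x y" for k
    using choice that unfolding pullback_choice_def by blast
  have \<pi>P: "cmp C (\<pi> y) (on_arr P x y k) = \<pi> x" if "k \<in> hom CY x y" for k
    using functor_hom[OF PF that] by (simp add: slice_hom)
  show ?thesis
  proof (intro ex1I conjI)
    show "g \<in> hom CY x y" by fact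
    show "on_arr F x y g = h" unfolding F_simps
      by (rule pullback_joint_mono[OF C pb[OF y'] P_hom[OF gs] hh]) (use qP[OF gs] \<pi>P[OF gs] \<pi>h gq in metis)+
    fix k assume k: "k \<in> hom CY x y \<and> on_arr F x y k = h"
    then have "cmp C k (q x) = cmp C g (q x)" using qP[of k] gq unfolding F_simps by metis
    moreover have "k \<in> hom C (fst x) (fst y)" using k by (simp add: slice_hom)
    ultimately show "k = g" using surj_cancel[OF q_hom[OF x'] q_surj[OF x'] _ g] by blast
  qed
qed

text \<open>
  Read the structure map \<open>a\<close> of an algebra \<open>(Z, d)\<close> as transport: \<open>a (e, y)\<close> moves \<open>y\<close> from the
  fibre over \<open>d y\<close> to the fibre over \<open>e\<close>, whenever \<open>e\<close> and \<open>d y\<close> lie over the same point. The unit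
  and associativity laws say that transport is trivial on the spot and transitive, so \<open>y\<close> being a
  transport of \<open>y'\<close> is an equivalence relation, and \<open>Z\<close> is the pullback of the quotient by it.
\<close>

lemma comparison_essentially_surjective:
  assumes X: "X \<in> obj EM"
  shows "\<exists>x\<in>obj CY. \<exists>t. is_iso EM (on_obj F x) X t"
proof -
  obtain z a where Xza: "X = (z, a)" by (cases X)
  obtain Z d where z_def: "z = (Z, d)" by (cases z)
  have alg: "(z, a) \<in> EM_algebras CE T \<eta> \<mu>" using X Xza by (simp add: EM_cat_def)
  have z: "snd z \<in> hom C (fst z) E" and aE: "a \<in> hom CE (on_obj T z) z"
    and a_unit: "cmp C a (\<eta> z) = idn C (fst z)"
    and a_assoc: "cmp C a (on_arr T (on_obj T z) z a) = cmp C a (\<mu> z)"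
    using alg by (auto simp: EM_algebras_def slice_obj slice_idn)
  have d: "d \<in> hom C Z E" using z z_def by simp
  let ?z = "L z"
  have Lz: "snd ?z \<in> hom C (fst ?z) Y" using L_hom[OF z] .
  have ah: "a \<in> hom C (W ?z) Z" and da: "cmp C d a = \<pi> ?z" using aE z_def by (auto simp: slice_hom)
  have qz: "q ?z \<in> hom C (W ?z) Z" using q_hom[OF Lz] z_def by simp
  have \<pi>z: "\<pi> ?z \<in> hom C (W ?z) E" using \<pi>_hom[OF Lz] .
  have sndz: "ap (snd ?z) b y = ap p b (ap d b y)" if "b \<in> obj B" "y \<in> on_obj Z b" for b y
    using ap_cmp[OF d that, of p] z_def by (simp del: functor_cat_simps)
  have da': "ap d b (ap a b t) = ap (\<pi> ?z) b t" if "b \<in> obj B" "t \<in> on_obj (W ?z) b" for b t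
    using ap_cmp[OF ah that, of d] da by metis
  have p\<pi>: "ap p b (ap (\<pi> ?z) b t) = ap p b (ap d b (ap (q ?z) b t))" if "b \<in> obj B" "t \<in> on_obj (W ?z) b" for b t
    using p_\<pi>[OF Lz that] sndz[OF that(1) ap_in[OF qz that]] by simp
  have ex: "\<exists>t\<in>on_obj (W ?z) b. ap (\<pi> ?z) b t = e \<and> ap (q ?z) b t = y"
    if "b \<in> obj B" "e \<in> on_obj E b" "y \<in> on_obj Z b" "ap p b e = ap p b (ap d b y)" for b e y
    using W_ex[OF Lz that(1,2), of y] that(3,4) sndz[OF that(1,3)] z_def by (metis fst_conv)
  have eqI: "t = t'" if "b \<in> obj B" "t \<in> on_obj (W ?z) b" "t' \<in> on_obj (W ?z) b"
    "ap (\<pi> ?z) b t = ap (\<pi> ?z) b t'" "ap (q ?z) b t = ap (q ?z) b t'" for b t t'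
    using W_eqI[OF Lz] that by blast
  have \<eta>h: "\<eta> z \<in> hom C Z (W ?z)" "cmp C (\<pi> ?z) (\<eta> z) = d" "cmp C (q ?z) (\<eta> z) = idn C Z"
    using adjunctionD(3)[OF adj, of z] unit[OF z] z z_def by (auto simp: slice_obj slice_hom)
  have unit_law: "ap a b t = y"
    if b: "b \<in> obj B" and t: "t \<in> on_obj (W ?z) b" and y: "y \<in> on_obj Z b"
      and "ap (\<pi> ?z) b t = ap d b y" "ap (q ?z) b t = y" for b t y
  proof -
    have "t = ap (\<eta> z) b y"
      by (rule eqI[OF b t ap_in[OF \<eta>h(1) b y]])
        (metis that(4,5) \<eta>h(2,3) ap_cmp[OF \<eta>h(1) b y] ap_idn[OF b y])+
    then show ?thesis using a_unit ap_cmp[OF \<eta>h(1) b y, of a] ap_idn[OF b y] z_def by (metis fst_conv)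
  qed
  let ?zz = "L (on_obj P ?z)"
  have Lzz: "snd ?zz \<in> hom C (fst ?zz) Y" using L_hom \<pi>z by blast
  have aY: "a \<in> hom CY ?zz ?z" using functor_hom[OF adjunctionD(1)[OF adj] aE] by simp
  have qY: "q ?z \<in> hom CY ?zz ?z" using q_slice[OF Lz] .
  have a_assoc': "cmp C a (on_arr P ?zz ?z a) = cmp C a (on_arr P ?zz ?z (q ?z))"
    using a_assoc by (simp add: monad_mult_def del: functor_cat_simps)
  have assoc_law: "ap a b t' = ap a b t''"
    if b: "b \<in> obj B" and t: "t \<in> on_obj (W ?z) b" and t': "t' \<in> on_obj (W ?z) b" and t'': "t'' \<in> on_obj (W ?z) b"
      and \<pi>t: "ap (\<pi> ?z) b t' = ap (\<pi> ?z) b t''" and qt': "ap (q ?z) b t' = ap a b t" and qt'': "ap (q ?z) b t'' = ap (q ?z) b t"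
    for b t t' t''
  proof -
    have "ap p b (ap (\<pi> ?z) b t') = ap p b (ap (\<pi> ?z) b t)"
      using p\<pi>[OF b t'] qt' da'[OF b t] by simp
    then have "ap p b (ap (\<pi> ?z) b t') = ap (snd ?zz) b t"
      using ap_cmp[OF \<pi>z b t, of p] by (simp del: functor_cat_simps)
    then obtain u where u: "u \<in> on_obj (W ?zz) b" "ap (\<pi> ?zz) b u = ap (\<pi> ?z) b t'" "ap (q ?zz) b u = t"
      using W_ex[OF Lzz b ap_in[OF \<pi>z b t'], of t] t by (metis fst_conv)
    have "ap (on_arr P ?zz ?z a) b u = t'"
      by (rule eqI[OF b ap_in[OF P_hom[OF aY] b u(1)] t']) (metis \<pi>_P[OF aY b u(1)] q_P[OF aY b u(1)] u qt')+
    moreover have "ap (on_arr P ?zz ?z (q ?z)) b u = t''"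
      by (rule eqI[OF b ap_in[OF P_hom[OF qY] b u(1)] t'']) (metis \<pi>_P[OF qY b u(1)] q_P[OF qY b u(1)] u \<pi>t qt'')+
    ultimately show ?thesis
      using a_assoc' ap_cmp[OF P_hom[OF aY] b u(1), of a] ap_cmp[OF P_hom[OF qY] b u(1), of a] by metis
  qed
  \<comment> \<open>The descended object identifies \<open>y\<close> with its translates \<open>a (e, y)\<close> along all \<open>e\<close> over the
    same point of the base.\<close>
  define rel where "rel b y y' \<longleftrightarrow> (\<exists>t\<in>on_obj (W ?z) b. ap (\<pi> ?z) b t = ap d b y' \<and> ap (q ?z) b t = y \<and> ap a b t = y')" for b y y'
  have rel_base: "ap p b (ap d b y) = ap p b (ap d b y')" if "b \<in> obj B" "rel b y y'" for b y y'
    using that p\<pi> unfolding rel_def by metis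
  have rel_a: "rel b (ap (q ?z) b t) (ap a b t)" if "b \<in> obj B" "t \<in> on_obj (W ?z) b" for b t
    unfolding rel_def using that da' by metis
  have rel_eq: "y = y'" if b: "b \<in> obj B" and y: "y \<in> on_obj Z b" and "rel b y y'" "ap d b y = ap d b y'" for b y y'
    using that(3,4) unit_law[OF b _ y] unfolding rel_def by metis
  obtain X0 k where k: "k \<in> hom C Z X0" and ks: "surj_map Z X0 k"
    and kr: "\<And>b y y'. b \<in> obj B \<Longrightarrow> y \<in> on_obj Z b \<Longrightarrow> y' \<in> on_obj Z b \<Longrightarrow> ap k b y = ap k b y' \<longleftrightarrow> rel b y y'"
  proof (rule quotient_exists[of Z rel])
    show "Z \<in> obj C" using hom_objects[OF d] by blast
    show "rel b y y" if "b \<in> obj B" "y \<in> on_obj Z b" for b y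
      using ex[OF that(1) ap_in[OF d that] that(2) HOL.refl] unit_law[OF that(1) _ that(2)] unfolding rel_def by metis
  next
    fix b y y' assume b: "b \<in> obj B" and y: "y \<in> on_obj Z b" and y': "y' \<in> on_obj Z b" and r: "rel b y y'"
    obtain t where t: "t \<in> on_obj (W ?z) b" "ap (\<pi> ?z) b t = ap d b y'" "ap (q ?z) b t = y" "ap a b t = y'"
      using r unfolding rel_def by blast
    obtain s where s: "s \<in> on_obj (W ?z) b" "ap (\<pi> ?z) b s = ap d b y" "ap (q ?z) b s = y'"
      using ex[OF b ap_in[OF d b y] y' rel_base[OF b r]] by blast
    obtain u where u: "u \<in> on_obj (W ?z) b" "ap (\<pi> ?z) b u = ap d b y" "ap (q ?z) b u = y"
      using ex[OF b ap_in[OF d b y] y HOL.refl] by blast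
    have "ap a b s = y"
      using assoc_law[OF b t(1) s(1) u(1)] s u t unit_law[OF b u(1) y u(2,3)] by metis
    then show "rel b y' y" unfolding rel_def using s by blast
  next
    fix b y y' y'' assume b: "b \<in> obj B" and y: "y \<in> on_obj Z b" and y': "y' \<in> on_obj Z b"
      and y'': "y'' \<in> on_obj Z b" and r: "rel b y y'" and r': "rel b y' y''"
    obtain t where t: "t \<in> on_obj (W ?z) b" "ap (\<pi> ?z) b t = ap d b y'" "ap (q ?z) b t = y" "ap a b t = y'"
      using r unfolding rel_def by blast
    obtain s where s: "s \<in> on_obj (W ?z) b" "ap (\<pi> ?z) b s = ap d b y''" "ap (q ?z) b s = y'" "ap a b s = y''"
      using r' unfolding rel_def by blast
    obtain u where u: "u \<in> on_obj (W ?z) b" "ap (\<pi> ?z) b u = ap d b y''" "ap (q ?z) b u = y"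
      using ex[OF b ap_in[OF d b y''] y] rel_base[OF b r] rel_base[OF b r'] by metis
    have "ap a b u = y''"
      using assoc_law[OF b t(1) s(1) u(1)] s u t by metis
    then show "rel b y y''" unfolding rel_def using u by blast
  next
    fix b c f y y' assume f: "f \<in> hom B b c" and y: "y \<in> on_obj Z b" and y': "y' \<in> on_obj Z b" and r: "rel b y y'"
    obtain t where t: "t \<in> on_obj (W ?z) b" "ap (\<pi> ?z) b t = ap d b y'" "ap (q ?z) b t = y" "ap a b t = y'"
      using r unfolding rel_def by blast
    have "W ?z \<in> obj C" using hom_objects[OF ah] by blast
    from act_in[OF this f t(1)] show "rel c (act Z b c f y) (act Z b c f y')"
      unfolding rel_def
      using ap_act[OF \<pi>z f t(1)] ap_act[OF d f y'] ap_act[OF qz f t(1)] ap_act[OF ah f t(1)] t by metis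
  qed blast
  have pd: "cmp C p d \<in> hom C Z Y" using cmp_hom[OF C d p] .
  obtain f where f: "f \<in> hom C X0 Y" and fk: "cmp C f k = cmp C p d"
  proof (rule descend[OF k ks pd])
    fix b y y' assume "b \<in> obj B" "y \<in> on_obj Z b" "y' \<in> on_obj Z b" "ap k b y = ap k b y'"
    then show "ap (cmp C p d) b y = ap (cmp C p d) b y'"
      using kr rel_base ap_cmp[OF d] by metis
  qed blast
  let ?x = "(X0, f)"
  have x: "snd ?x \<in> hom C (fst ?x) Y" using f by simp
  have xo: "?x \<in> obj CY" using f by (simp add: slice_obj)
  have pbx: "is_pullback C E X0 Y p f (W ?x) (\<pi> ?x) (q ?x)" using pb[OF x] by simp
  have qx: "q ?x \<in> hom C (W ?x) X0" using q_hom[OF x] by simp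
  obtain h where h: "h \<in> hom C Z (W ?x)" and \<pi>h: "cmp C (\<pi> ?x) h = d" and qh: "cmp C (q ?x) h = k"
    using pullback_lift[OF pbx d k fk[symmetric]] .
  have \<pi>h': "ap (\<pi> ?x) b (ap h b y) = ap d b y" and qh': "ap (q ?x) b (ap h b y) = ap k b y"
    if "b \<in> obj B" "y \<in> on_obj Z b" for b y
    using ap_cmp[OF h that, of "\<pi> ?x"] ap_cmp[OF h that, of "q ?x"] \<pi>h qh by metis+
  have "inj_map Z h" unfolding inj_map_def
  proof (intro ballI impI)
    fix b y y' assume b: "b \<in> obj B" and y: "y \<in> on_obj Z b" and y': "y' \<in> on_obj Z b" and eq: "ap h b y = ap h b y'"
    have "rel b y y'" "ap d b y = ap d b y'" using \<pi>h' qh' eq kr[OF b y y'] b y y' by metis+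
    then show "y = y'" using rel_eq[OF b y] by blast
  qed
  moreover have "surj_map Z (W ?x) h" unfolding surj_map_def
  proof (intro ballI)
    fix b w assume b: "b \<in> obj B" and w: "w \<in> on_obj (W ?x) b"
    obtain y where y: "y \<in> on_obj Z b" "ap k b y = ap (q ?x) b w" using surj_mapE[OF ks b ap_in[OF qx b w]] .
    have "ap p b (ap (\<pi> ?x) b w) = ap p b (ap d b y)"
      using p_\<pi>[OF x b w] y(2) ap_cmp[OF k b y(1), of f] ap_cmp[OF d b y(1), of p] fk by (metis snd_conv)
    then obtain t where t: "t \<in> on_obj (W ?z) b" "ap (\<pi> ?z) b t = ap (\<pi> ?x) b w" "ap (q ?z) b t = y"
      using ex[OF b ap_in[OF \<pi>_hom[OF x] b w] y(1)] by blast
    note at = ap_in[OF ah b t(1)]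
    have "ap k b (ap a b t) = ap k b y" using kr[OF b y(1) at] rel_a[OF b t(1)] t(3) by metis
    then have "ap h b (ap a b t) = w"
      using pullback_elements(1)[OF pbx b ap_in[OF h b at] w] \<pi>h'[OF b at] qh'[OF b at] da'[OF b t(1)] t(2) y(2) by metis
    then show "\<exists>y\<in>on_obj Z b. ap h b y = w" using at by blast
  qed
  ultimately have "is_iso C Z (W ?x) h" using iso_iff h by blast
  moreover have hE: "h \<in> hom CE z (on_obj P ?x)" using h \<pi>h d \<pi>_hom[OF x] z_def by (simp add: slice_hom)
  ultimately have isoE: "is_iso CE z (on_obj P ?x) h" using slice_iso[OF C hE] z_def by simp
  have hY: "h \<in> hom CY ?z (L (on_obj P ?x))" using functor_hom[OF adjunctionD(1)[OF adj] hE] by simp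
  have sY: "q ?x \<in> hom CY (L (on_obj P ?x)) ?x" using q_slice[OF x] .
  let ?s = "on_arr P (L (on_obj P ?x)) ?x (q ?x)" and ?Ph = "on_arr P ?z (L (on_obj P ?x)) h"
  have "cmp C h a = cmp C ?s ?Ph"
  proof (rule map_eqI[OF cmp_hom[OF C ah h] cmp_hom[OF C P_hom[OF hY] P_hom[OF sY]]])
    fix b t assume b: "b \<in> obj B" and t: "t \<in> on_obj (W ?z) b"
    note at = ap_in[OF ah b t] and Pt = ap_in[OF P_hom[OF hY] b t]
    have "ap h b (ap a b t) = ap ?s b (ap ?Ph b t)"
    proof (rule pullback_elements(1)[OF pbx b ap_in[OF h b at] ap_in[OF P_hom[OF sY] b Pt]])
      show "ap (\<pi> ?x) b (ap h b (ap a b t)) = ap (\<pi> ?x) b (ap ?s b (ap ?Ph b t))"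
        using \<pi>h'[OF b at] da'[OF b t] \<pi>_P[OF sY b Pt] \<pi>_P[OF hY b t] by metis
      have "ap k b (ap (q ?z) b t) = ap k b (ap a b t)"
        using kr[OF b ap_in[OF qz b t] at] rel_a[OF b t] by blast
      then show "ap (q ?x) b (ap h b (ap a b t)) = ap (q ?x) b (ap ?s b (ap ?Ph b t))"
        using qh'[OF b at] q_P[OF sY b Pt] q_P[OF hY b t] qh'[OF b ap_in[OF qz b t]] by metis
    qed
    then show "ap (cmp C h a) b t = ap (cmp C ?s ?Ph) b t"
      using ap_cmp[OF ah b t, of h] ap_cmp[OF P_hom[OF hY] b t, of ?s] by metis
  qed
  then have "h \<in> hom EM X (on_obj F ?x)"
    unfolding EM_hom using Xza alg hE functor_obj[OF FF xo] by (simp add: F_simps EM_cat_def del: functor_cat_simps)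
  then have "is_iso EM X (on_obj F ?x) h"
    using EM_iso_if_iso[OF CE TF] isoE Xza by (simp add: F_simps del: functor_cat_simps)
  then show ?thesis using xo by (metis is_iso_sym)
qed

lemma pullback_functor_monadic: "monadic CY CE P"
proof -
  have "is_equivalence CY EM F"
    using equivalence_if_fully_faithful_and_essentially_surjective[OF CY category_EM_cat[OF CE TF] FF]
      comparison_fully_faithful comparison_essentially_surjective by blast
  then show ?thesis unfolding monadic_def using adj by blast
qed

end

lemma (in copresheaves) surj_imp_effective_descent:
  assumes p: "p \<in> hom C E Y" and surj: "surj_map E Y p"
  shows "effective_descent C E Y p"
proof -
  obtain P q where P: "pullback_choice C E Y p P q"
    using pullback_functor_exists[OF C p] is_pullback_exists[OF p] by metis
  obtain \<eta> where "adjunction (slice_cat C E) (slice_cat C Y) (postcomp_fun C p) P \<eta> q"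
    "\<And>z. snd z \<in> hom C (fst z) E \<Longrightarrow>
      cmp C (snd (on_obj P (fst z, cmp C p (snd z)))) (\<eta> z) = snd z \<and>
      cmp C (q (fst z, cmp C p (snd z))) (\<eta> z) = idn C (fst z)"
    by (rule postcomp_pullback_adjunction[OF C p P]) blast
  then interpret surjection_descent U B E Y p P q \<eta>
    using p surj P by unfold_locales
  show ?thesis
    unfolding effective_descent_def is_pullback_functor_iff using p P pullback_functor_monadic by blast
qed

section \<open>The kernel congruence of the unit\<close>

text \<open>
  The map \<open>g\<close> is recovered from its transpose \<open>R g \<circ> \<eta>\<close> as \<open>\<epsilon> \<circ> L (R g \<circ> \<eta>)\<close>.
\<close>

lemma adjunct_inj:
  assumes C: "category C" and D: "category D" and adj: "adjunction C D L R \<eta> \<epsilon>" and x: "x \<in> obj C"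
    and g: "g \<in> hom D (on_obj L x) y" and h: "h \<in> hom D (on_obj L x) y"
    and eq: "cmp C (on_arr R (on_obj L x) y g) (\<eta> x) = cmp C (on_arr R (on_obj L x) y h) (\<eta> x)"
  shows "g = h"
proof -
  note a = adjunctionD[OF adj]
  note Lx = functor_obj[OF a(1) x] and \<eta> = a(3)[OF x] and y = hom_obj(2)[OF D g]
  have "k = cmp D (\<epsilon> y) (on_arr L x (on_obj R y) (cmp C (on_arr R (on_obj L x) y k) (\<eta> x)))"
    if k: "k \<in> hom D (on_obj L x) y" for k
  proof -
    note Rk = functor_hom[OF a(2) k]
    have "cmp D (\<epsilon> y) (on_arr L x (on_obj R y) (cmp C (on_arr R (on_obj L x) y k) (\<eta> x))) =
      cmp D (cmp D (\<epsilon> y) (on_arr L (on_obj R (on_obj L x)) (on_obj R y) (on_arr R (on_obj L x) y k)))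
        (on_arr L x (on_obj R (on_obj L x)) (\<eta> x))"
      using functor_cmp[OF a(1) \<eta> Rk] cmp_assoc[OF D functor_hom[OF a(1) \<eta>] functor_hom[OF a(1) Rk] a(5)[OF y]]
      by metis
    also have "\<dots> = cmp D k (cmp D (\<epsilon> (on_obj L x)) (on_arr L x (on_obj R (on_obj L x)) (\<eta> x)))"
      using a(6)[OF k] cmp_assoc[OF D functor_hom[OF a(1) \<eta>] a(5)[OF Lx] k] by metis
    also have "\<dots> = k" using a(7)[OF x] cmp_idr[OF D k] by metis
    finally show ?thesis by simp
  qed
  then show ?thesis using g h eq by metis
qed

locale pullback_preserving_kan = kan_setting U B A K
  for U :: "'u set set" and B :: "('u, 'u) cat" and A :: "('a, 'u) cat" and K :: "('u, 'u, 'a, 'u) fnctr" +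
  fixes Lan :: "('u, 'a, 'u) Kan_functor" and \<theta> \<epsilon>
  assumes adj: "adjunction (Set_pow U B) (Set_pow U A) Lan (precomp B K) \<theta> \<epsilon>"
    and pres: "preserves_pullbacks (Set_pow U B) (Set_pow U A) Lan"
    and faith: "faithful (op_cat B) (comp_fun Lan (yoneda B))"
begin

abbreviation T where "T M \<equiv> on_obj R (on_obj Lan M)"

definition Tm where "Tm M N f = on_arr R (on_obj Lan M) (on_obj Lan N) (on_arr Lan M N f)"

text \<open>
  Equality of \<open>k M b x\<close> and \<open>k M b x'\<close> is the congruence of indistinguishability on \<open>M\<close>.
\<close>

definition k where "k M b x = ap (\<theta> M) b x"

definition separated where "separated M \<longleftrightarrow> M \<in> obj C \<and> inj_map M (\<theta> M)"

lemma Lan_hom: "f \<in> hom C M N \<Longrightarrow> on_arr Lan M N f \<in> hom SA.C (on_obj Lan M) (on_obj Lan N)"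
  using functor_hom[OF adjunctionD(1)[OF adj]] .

lemma Lan_obj: "M \<in> obj C \<Longrightarrow> on_obj Lan M \<in> obj SA.C"
  using functor_obj[OF adjunctionD(1)[OF adj]] .

lemma \<theta>_hom: "M \<in> obj C \<Longrightarrow> \<theta> M \<in> hom C M (T M)"
  using adjunctionD(3)[OF adj] .

lemma \<theta>_nat: "f \<in> hom C M N \<Longrightarrow> cmp C (\<theta> N) f = cmp C (Tm M N f) (\<theta> M)"
  unfolding Tm_def using adjunctionD(4)[OF adj] .

lemma k_in: "M \<in> obj C \<Longrightarrow> b \<in> obj B \<Longrightarrow> x \<in> on_obj M b \<Longrightarrow> k M b x \<in> on_obj (T M) b"
  unfolding k_def using ap_in[OF \<theta>_hom] .

lemma k_nat:
  assumes f: "f \<in> hom C M N" and b: "b \<in> obj B" and x: "x \<in> on_obj M b"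
  shows "k N b (ap f b x) = ap (Tm M N f) b (k M b x)"
proof -
  have M: "M \<in> obj C" using hom_objects[OF f] by blast
  show ?thesis
    unfolding k_def
    using ap_cmp[OF f b x, of "\<theta> N"] ap_cmp[OF \<theta>_hom[OF M] b x, of "Tm M N f"] \<theta>_nat[OF f] by metis
qed

lemma k_cong:
  assumes "f \<in> hom C M N" "b \<in> obj B" "x \<in> on_obj M b" "x' \<in> on_obj M b" "k M b x = k M b x'"
  shows "k N b (ap f b x) = k N b (ap f b x')"
  using k_nat[OF assms(1-3)] k_nat[OF assms(1,2,4)] assms(5) by simp

lemma k_act:
  assumes "M \<in> obj C" "f \<in> hom B b c" "x \<in> on_obj M b" "x' \<in> on_obj M b" "k M b x = k M b x'"
  shows "k M c (act M b c f x) = k M c (act M b c f x')"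
  unfolding k_def using ap_act[OF \<theta>_hom[OF assms(1)] assms(2)] assms(3-5) unfolding k_def by simp

lemma separatedD:
  "separated M \<Longrightarrow> b \<in> obj B \<Longrightarrow> x \<in> on_obj M b \<Longrightarrow> x' \<in> on_obj M b \<Longrightarrow> k M b x = k M b x' \<Longrightarrow> x = x'"
  unfolding separated_def k_def using inj_mapD by blast

lemma separatedI:
  "M \<in> obj C \<Longrightarrow> (\<And>b x x'. b \<in> obj B \<Longrightarrow> x \<in> on_obj M b \<Longrightarrow> x' \<in> on_obj M b \<Longrightarrow> k M b x = k M b x' \<Longrightarrow> x = x') \<Longrightarrow>
   separated M"
  unfolding separated_def k_def inj_map_def by blast

lemma separated_obj: "separated M \<Longrightarrow> M \<in> obj C"
  unfolding separated_def by blast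

text \<open>
  By a triangle identity the unit has a left inverse at a functor of the form \<open>N K\<close>.
\<close>

lemma separated_restriction:
  assumes N: "N \<in> obj SA.C"
  shows "separated (on_obj R N)"
proof (rule separatedI)
  have RN: "on_obj R N \<in> obj C" using functor_obj[OF R_functor N] .
  show "on_obj R N \<in> obj C" by fact
  fix b x x' assume b: "b \<in> obj B" and x: "x \<in> on_obj (on_obj R N) b" and x': "x' \<in> on_obj (on_obj R N) b"
    and eq: "k (on_obj R N) b x = k (on_obj R N) b x'"
  let ?r = "on_arr R (on_obj Lan (on_obj R N)) N (\<epsilon> N)"
  have "cmp C ?r (\<theta> (on_obj R N)) = idn C (on_obj R N)" using adjunctionD(8)[OF adj N] .
  then have "ap ?r b (k (on_obj R N) b y) = y" if "y \<in> on_obj (on_obj R N) b" for y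
    unfolding k_def using ap_cmp[OF \<theta>_hom[OF RN] b that, of ?r] ap_idn[OF b that] by metis
  then show "x = x'" using x x' eq by metis
qed

lemma T_pullback:
  assumes pb: "is_pullback C X Y Z f g P p q" and b: "b \<in> obj B"
  shows "t \<in> on_obj (T P) b \<Longrightarrow> t' \<in> on_obj (T P) b \<Longrightarrow> ap (Tm P X p) b t = ap (Tm P X p) b t' \<Longrightarrow>
      ap (Tm P Y q) b t = ap (Tm P Y q) b t' \<Longrightarrow> t = t'"
    and "x \<in> on_obj (T X) b \<Longrightarrow> y \<in> on_obj (T Y) b \<Longrightarrow> ap (Tm X Z f) b x = ap (Tm Y Z g) b y \<Longrightarrow>
      \<exists>t\<in>on_obj (T P) b. ap (Tm P X p) b t = x \<and> ap (Tm P Y q) b t = y"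
proof -
  have "is_pullback SA.C (on_obj Lan X) (on_obj Lan Y) (on_obj Lan Z) (on_arr Lan X Z f) (on_arr Lan Y Z g)
          (on_obj Lan P) (on_arr Lan P X p) (on_arr Lan P Y q)"
    using pres pb unfolding preserves_pullbacks_def by blast
  note e = SA.pullback_elements[OF this K_obj[OF b]]
  show "t \<in> on_obj (T P) b \<Longrightarrow> t' \<in> on_obj (T P) b \<Longrightarrow> ap (Tm P X p) b t = ap (Tm P X p) b t' \<Longrightarrow>
      ap (Tm P Y q) b t = ap (Tm P Y q) b t' \<Longrightarrow> t = t'"
    using e(1) unfolding Tm_def R_ap[OF b] R_on_obj[OF b] .
  show "x \<in> on_obj (T X) b \<Longrightarrow> y \<in> on_obj (T Y) b \<Longrightarrow> ap (Tm X Z f) b x = ap (Tm Y Z g) b y \<Longrightarrow>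
      \<exists>t\<in>on_obj (T P) b. ap (Tm P X p) b t = x \<and> ap (Tm P Y q) b t = y"
    using e(2) unfolding Tm_def R_ap[OF b] R_on_obj[OF b] .
qed

lemma k_pullback:
  assumes pb: "is_pullback C X Y Z f g P p q" and b: "b \<in> obj B"
    and t: "t \<in> on_obj P b" and t': "t' \<in> on_obj P b"
    and "k X b (ap p b t) = k X b (ap p b t')" "k Y b (ap q b t) = k Y b (ap q b t')"
  shows "k P b t = k P b t'"
proof -
  note h = pullback_hom[OF pb]
  have P: "P \<in> obj C" using hom_objects[OF h(3)] by blast
  show ?thesis
    by (rule T_pullback(1)[OF pb b k_in[OF P b t] k_in[OF P b t']])
      (use assms(5,6) k_nat[OF h(3) b] k_nat[OF h(4) b] t t' in metis)+
qed

text \<open>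
  A map is injective if and only if the identities form a pullback of it with itself, so injections
  are preserved along with pullbacks.
\<close>

lemma T_inj:
  assumes m: "m \<in> hom C M N" and inj: "inj_map M m"
  shows "inj_map (T M) (Tm M N m)"
proof -
  have M: "M \<in> obj C" using hom_objects[OF m] by blast
  have i: "idn C M \<in> hom C M M" using idn_hom[OF C M] .
  have "is_pullback C M M N m m M (idn C M) (idn C M)"
  proof (rule is_pullbackI[OF m m i i HOL.refl])
    show "pointwise_pullback M M m m M (idn C M) (idn C M)"
      unfolding pointwise_pullback_def
    proof (intro ballI conjI impI)
      fix b t t' assume "b \<in> obj B" "t \<in> on_obj M b" "t' \<in> on_obj M b" "ap (idn C M) b t = ap (idn C M) b t'"
      then show "t = t'" using ap_idn by metis
    next
      fix b x y assume b: "b \<in> obj B" and x: "x \<in> on_obj M b" and y: "y \<in> on_obj M b" and "ap m b x = ap m b y"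
      then have "x = y" using inj_mapD[OF inj] by blast
      then show "\<exists>t\<in>on_obj M b. ap (idn C M) b t = x \<and> ap (idn C M) b t = y"
        using ap_idn[OF b x] x by metis
    qed
  qed
  from T_pullback(2)[OF this] show ?thesis unfolding inj_map_def by metis
qed

text \<open>
  By hypothesis \<open>\<theta>\<^sub>X\<close> equalises the projections of the kernel pair of \<open>e\<close>. By adjointness \<open>Lan\<^sub>K\<close>, and
  hence \<open>T\<close>, takes the two projections to one and the same map. These images are the kernel pair
  of \<open>T e\<close>, which is therefore trivial.
\<close>

lemma T_inj_of_tame:
  assumes e: "e \<in> hom C X Y"
    and ker: "\<And>b x x'. b \<in> obj B \<Longrightarrow> x \<in> on_obj X b \<Longrightarrow> x' \<in> on_obj X b \<Longrightarrow> ap e b x = ap e b x' \<Longrightarrow> k X b x = k X b x'"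
  shows "inj_map (T X) (Tm X Y e)"
proof -
  have X: "X \<in> obj C" using hom_objects[OF e] by blast
  obtain P p q where pb: "is_pullback C X X Y e e P p q" using is_pullback_exists[OF e e] .
  note h = pullback_hom[OF pb]
  have P: "P \<in> obj C" using hom_objects[OF h(3)] by blast
  have "cmp C (\<theta> X) p = cmp C (\<theta> X) q"
  proof (rule map_eqI[OF cmp_hom[OF C h(3) \<theta>_hom[OF X]] cmp_hom[OF C h(4) \<theta>_hom[OF X]]])
    fix b t assume b: "b \<in> obj B" and t: "t \<in> on_obj P b"
    show "ap (cmp C (\<theta> X) p) b t = ap (cmp C (\<theta> X) q) b t"
      using ap_cmp[OF h(3) b t, of "\<theta> X"] ap_cmp[OF h(4) b t, of "\<theta> X"]
        ker[OF b ap_in[OF h(3) b t] ap_in[OF h(4) b t] pullback_elements(3)[OF pb b t]]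
      unfolding k_def by metis
  qed
  then have "cmp C (Tm P X p) (\<theta> P) = cmp C (Tm P X q) (\<theta> P)" using \<theta>_nat[OF h(3)] \<theta>_nat[OF h(4)] by metis
  then have "on_arr Lan P X p = on_arr Lan P X q"
    using adjunct_inj[OF C SA.C adj P Lan_hom[OF h(3)] Lan_hom[OF h(4)]] unfolding Tm_def by blast
  then have "Tm P X p = Tm P X q" unfolding Tm_def by simp
  then show ?thesis unfolding inj_map_def using T_pullback(2)[OF pb] by metis
qed

lemma k_reflect:
  assumes e: "e \<in> hom C X Y"
    and ker: "\<And>b x x'. b \<in> obj B \<Longrightarrow> x \<in> on_obj X b \<Longrightarrow> x' \<in> on_obj X b \<Longrightarrow> ap e b x = ap e b x' \<Longrightarrow> k X b x = k X b x'"
    and b: "b \<in> obj B" and x: "x \<in> on_obj X b" and x': "x' \<in> on_obj X b"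
    and eq: "k Y b (ap e b x) = k Y b (ap e b x')"
  shows "k X b x = k X b x'"
proof -
  have X: "X \<in> obj C" using hom_objects[OF e] by blast
  have "inj_map (T X) (Tm X Y e)" by (rule T_inj_of_tame[OF e ker])
  then show ?thesis
    using inj_mapD[OF _ b k_in[OF X b x] k_in[OF X b x']] k_nat[OF e b x] k_nat[OF e b x'] eq by metis
qed

section \<open>Separated covers\<close>

lemma hom_B_U: "b \<in> obj B \<Longrightarrow> c \<in> obj B \<Longrightarrow> hom B b c \<in> U"
  using small by (simp add: small_category_def)

abbreviation Y where "Y b \<equiv> on_obj (yoneda B) b"

lemma Y_on_obj: "c \<in> obj B \<Longrightarrow> on_obj (Y b) c = hom B b c"
  by (simp add: yoneda_def restrict_fun_def)

lemma Y_act: "f \<in> hom B c d \<Longrightarrow> g \<in> hom B b c \<Longrightarrow> act (Y b) c d f g = cmp B f g"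
  by (simp add: yoneda_def restrict_fun_def act_def)

lemma Y_obj:
  assumes b: "b \<in> obj B"
  shows "Y b \<in> obj C"
proof -
  let ?F = "\<lparr> on_obj = (\<lambda>c. hom B b c),
           on_arr = (\<lambda>c d f. (\<lambda>g. if g \<in> hom B b c then Some (cmp B f g) else None)) \<rparr>"
  have "is_functor B (Set_cat U) ?F"
    unfolding is_functor_def
  proof (intro conjI allI impI ballI)
    fix c assume c: "c \<in> obj B"
    show "on_obj ?F c \<in> obj (Set_cat U)" using hom_B_U[OF b c] by simp
    show "on_arr ?F c c (idn B c) = idn (Set_cat U) (on_obj ?F c)"
      using cmp_idl[OF B] by (auto simp: restrict_map_def)
  next
    fix c d f assume f: "f \<in> hom B c d"
    then show "on_arr ?F c d f \<in> hom (Set_cat U) (on_obj ?F c) (on_obj ?F d)"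
      using hom_B_U[OF b] hom_obj[OF B f] cmp_hom[OF B _ f]
      by (auto simp: Set_cat_hom dom_def ran_def split: if_splits)
  next
    fix c d e f g assume f: "f \<in> hom B c d" and g: "g \<in> hom B d e"
    show "on_arr ?F c e (cmp B g f) = cmp (Set_cat U) (on_arr ?F d e g) (on_arr ?F c d f)"
      using cmp_hom[OF B _ f] cmp_assoc[OF B _ f g] by (auto simp: map_comp_def)
  qed
  then have "restrict_fun B ?F \<in> obj C" using restrict_fun_functors[OF B] by simp
  then show ?thesis by (simp add: yoneda_def)
qed

lemma Y_map:
  assumes g: "g \<in> hom B b c"
  shows "on_arr (yoneda B) c b g \<in> hom C (Y c) (Y b)"
    and "d \<in> obj B \<Longrightarrow> h \<in> hom B c d \<Longrightarrow> ap (on_arr (yoneda B) c b g) d h = cmp B h g"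
proof -
  note b = hom_obj(1)[OF B g] and c = hom_obj(2)[OF B g]
  show ap: "ap (on_arr (yoneda B) c b g) d h = cmp B h g" if "d \<in> obj B" "h \<in> hom B c d" for d h
    using that by (simp add: yoneda_def ap_def)
  obtain \<tau> where t: "\<tau> \<in> hom C (Y c) (Y b)" and th: "\<And>d h. d \<in> obj B \<Longrightarrow> h \<in> on_obj (Y c) d \<Longrightarrow> ap \<tau> d h = cmp B h g"
  proof (rule map_exists[OF Y_obj[OF c] Y_obj[OF b], of "\<lambda>d h. cmp B h g"])
    show "cmp B h g \<in> on_obj (Y b) d" if "d \<in> obj B" "h \<in> on_obj (Y c) d" for d h
      using that cmp_hom[OF B g] by (simp add: Y_on_obj)
    show "cmp B (act (Y c) d e f h) g = act (Y b) d e f (cmp B h g)"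
      if f: "f \<in> hom B d e" and h: "h \<in> on_obj (Y c) d" for d e f h
    proof -
      have h': "h \<in> hom B c d" using h Y_on_obj[OF hom_obj(1)[OF B f]] by simp
      show ?thesis using Y_act[OF f h'] Y_act[OF f cmp_hom[OF B g h']] cmp_assoc[OF B g h' f] by simp
    qed
  qed blast
  have "\<tau> = on_arr (yoneda B) c b g"
  proof
    fix d
    show "\<tau> d = on_arr (yoneda B) c b g d"
    proof (cases "d \<in> obj B")
      case True
      have "nat_trans B (Set_cat U) (Y c) (Y b) \<tau>" using t by (simp add: functor_cat_hom)
      from nat_transD(1)[OF this True] have d: "dom (\<tau> d) = hom B c d" by (simp add: Set_cat_hom Y_on_obj[OF True])
      show ?thesis
      proof
        fix h
        show "\<tau> d h = on_arr (yoneda B) c b g d h"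
        proof (cases "h \<in> hom B c d")
          case h: True
          then have "h \<in> on_obj (Y c) d" by (simp add: Y_on_obj[OF True])
          then show ?thesis
            using ap_Some(1)[OF t True] th[OF True] h True by (simp add: yoneda_def)
        next
          case False
          then have "\<tau> d h = None" using d by blast
          then show ?thesis using False True by (simp add: yoneda_def)
        qed
      qed
    next
      case False
      then show ?thesis using t by (simp add: functor_cat_hom yoneda_def extensional_def)
    qed
  qed
  then show "on_arr (yoneda B) c b g \<in> hom C (Y c) (Y b)" using t by simp
qed

text \<open>
  Let \<open>\<theta>\<close> identify \<open>g\<close> and \<open>g' : b \<rightarrow> c\<close>. By the Yoneda lemma it then equalises the maps
  \<open>y c \<rightarrow> y b\<close> that they induce, so \<open>Lan\<^sub>K\<close> identifies these maps, and faithfulness gives \<open>g = g'\<close>.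
\<close>

lemma separated_representable:
  assumes b: "b \<in> obj B"
  shows "separated (Y b)"
proof (rule separatedI[OF Y_obj[OF b]])
  fix c g g' assume c: "c \<in> obj B" and "g \<in> on_obj (Y b) c" "g' \<in> on_obj (Y b) c"
    and eq: "k (Y b) c g = k (Y b) c g'"
  then have g: "g \<in> hom B b c" and g': "g' \<in> hom B b c" by (auto simp: Y_on_obj)
  let ?g = "on_arr (yoneda B) c b g" and ?g' = "on_arr (yoneda B) c b g'"
  note gh = Y_map(1)[OF g] and gh' = Y_map(1)[OF g']
  have "cmp C (\<theta> (Y b)) ?g = cmp C (\<theta> (Y b)) ?g'"
  proof (rule map_eqI[OF cmp_hom[OF C gh \<theta>_hom[OF Y_obj[OF b]]] cmp_hom[OF C gh' \<theta>_hom[OF Y_obj[OF b]]]])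
    fix d h assume d: "d \<in> obj B" and h: "h \<in> on_obj (Y c) d"
    then have h': "h \<in> hom B c d" by (simp add: Y_on_obj)
    have "k (Y b) d (cmp B h g) = k (Y b) d (cmp B h g')"
      using k_act[OF Y_obj[OF b] h' _ _ eq] Y_on_obj[OF c] g g' Y_act[OF h'] by simp
    then show "ap (cmp C (\<theta> (Y b)) ?g) d h = ap (cmp C (\<theta> (Y b)) ?g') d h"
      using ap_cmp[OF gh d h, of "\<theta> (Y b)"] ap_cmp[OF gh' d h, of "\<theta> (Y b)"]
        Y_map(2)[OF g d h'] Y_map(2)[OF g' d h'] unfolding k_def by metis
  qed
  then have "cmp C (Tm (Y c) (Y b) ?g) (\<theta> (Y c)) = cmp C (Tm (Y c) (Y b) ?g') (\<theta> (Y c))"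
    using \<theta>_nat[OF gh] \<theta>_nat[OF gh'] by metis
  then have "on_arr Lan (Y c) (Y b) ?g = on_arr Lan (Y c) (Y b) ?g'"
    using adjunct_inj[OF C SA.C adj Y_obj[OF c] Lan_hom[OF gh] Lan_hom[OF gh']] unfolding Tm_def by blast
  moreover have "inj_on (on_arr (comp_fun Lan (yoneda B)) c b) (hom B b c)"
    using faith b c unfolding faithful_def by (simp add: op_cat_def)
  ultimately show "g = g'" using g g' inj_onD[of "on_arr (comp_fun Lan (yoneda B)) c b" "hom B b c" g g'] by simp
qed

text \<open>
  The cover is the coproduct of the representables \<open>y b\<close> over all elements \<open>y \<in> M b\<close>, mapped to \<open>M\<close>
  by the Yoneda lemma; its elements are the triples \<open>(b, y, g)\<close> with \<open>g : b \<rightarrow> c\<close>.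
\<close>

lemma separated_cover:
  assumes M: "M \<in> obj C"
  obtains E p where "p \<in> hom C E M" "surj_map E M p" "separated E"
proof -
  define tri :: "'u \<Rightarrow> 'u \<Rightarrow> 'u \<Rightarrow> 'u" where "tri b y g = pair b (pair y g)" for b y g
  define X where "X c = sigma (obj B) (\<lambda>b. sigma (on_obj M b) (\<lambda>_. hom B b c))" for c
  define \<alpha> where "\<alpha> c d f t = tri (left t) (left (right t)) (cmp B f (right (right t)))" for c d :: 'u and f t
  have BU: "obj B \<in> U" using small by (simp add: small_category_def)
  have X_iff: "t \<in> X c \<longleftrightarrow> (\<exists>b y g. t = tri b y g \<and> b \<in> obj B \<and> y \<in> on_obj M b \<and> g \<in> hom B b c)" for t c
    unfolding X_def tri_def in_sigma by blast
  have tri_inj: "tri b y g = tri b' y' g' \<longleftrightarrow> b = b' \<and> y = y' \<and> g = g'" for b y g b' y' g'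
    unfolding tri_def by simp
  have \<alpha>_tri: "\<alpha> c d f (tri b y g) = tri b y (cmp B f g)" for c d f b y g
    unfolding \<alpha>_def tri_def by simp
  obtain E where E: "E \<in> obj C" and Eo: "\<And>c. c \<in> obj B \<Longrightarrow> on_obj E c = X c"
    and Ea: "\<And>c d f t. f \<in> hom B c d \<Longrightarrow> t \<in> X c \<Longrightarrow> act E c d f t = \<alpha> c d f t"
  proof (rule obj_exists[of X \<alpha>])
    show "X c \<in> U" if "c \<in> obj B" for c unfolding X_def
      using on_obj_U[OF M] hom_B_U[OF _ that] BU by (intro set_universe_sigma[OF universe]) auto
    show "\<alpha> c d f t \<in> X d" if "f \<in> hom B c d" "t \<in> X c" for c d f t
      using that unfolding X_iff using \<alpha>_tri cmp_hom[OF B _ that(1)] by metis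
    show "\<alpha> c c (idn B c) t = t" if "c \<in> obj B" "t \<in> X c" for c t
      using that unfolding X_iff using \<alpha>_tri cmp_idl[OF B] by metis
    show "\<alpha> c e (cmp B g f) t = \<alpha> d e g (\<alpha> c d f t)" if "f \<in> hom B c d" "g \<in> hom B d e" "t \<in> X c" for c d e f g t
      using that unfolding X_iff using \<alpha>_tri cmp_assoc[OF B] by metis
  qed blast
  have E_iff: "t \<in> on_obj E c \<longleftrightarrow> (\<exists>b y g. t = tri b y g \<and> b \<in> obj B \<and> y \<in> on_obj M b \<and> g \<in> hom B b c)"
    if "c \<in> obj B" for t c using Eo[OF that] X_iff by simp
  have tri_in: "tri b y g \<in> on_obj E c" if "y \<in> on_obj M b" "g \<in> hom B b c" for b y g c
    using E_iff[OF hom_obj(2)[OF B that(2)]] that hom_obj(1)[OF B that(2)] by blast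
  have act_tri: "act E c d f (tri b y g) = tri b y (cmp B f g)"
    if "f \<in> hom B c d" "y \<in> on_obj M b" "g \<in> hom B b c" for c d f b y g
    using Ea[OF that(1)] X_iff \<alpha>_tri that hom_obj(1)[OF B that(3)] by metis
  obtain p where p: "p \<in> hom C E M" and pv: "\<And>c t. c \<in> obj B \<Longrightarrow> t \<in> on_obj E c \<Longrightarrow>
      ap p c t = act M (left t) c (right (right t)) (left (right t))"
  proof (rule map_exists[OF E M, of "\<lambda>c t. act M (left t) c (right (right t)) (left (right t))"])
    fix c t assume "c \<in> obj B" "t \<in> on_obj E c"
    then show "act M (left t) c (right (right t)) (left (right t)) \<in> on_obj M c"
      using act_in[OF M] by (auto simp: E_iff tri_def)
  next
    fix c d f t assume f: "f \<in> hom B c d" and "t \<in> on_obj E c"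
    then obtain b y g where t: "t = tri b y g" and y: "y \<in> on_obj M b" and g: "g \<in> hom B b c"
      using E_iff[OF hom_obj(1)[OF B f]] by blast
    show "act M (left (act E c d f t)) d (right (right (act E c d f t))) (left (right (act E c d f t))) =
      act M c d f (act M (left t) c (right (right t)) (left (right t)))"
      using act_tri[OF f y g] act_cmp[OF M g f y] unfolding t by (simp add: tri_def)
  qed blast
  have "surj_map E M p"
    unfolding surj_map_def
  proof (intro ballI)
    fix c y assume c: "c \<in> obj B" and y: "y \<in> on_obj M c"
    note t = tri_in[OF y idn_hom[OF B c]]
    have "ap p c (tri c y (idn B c)) = y" using pv[OF c t] act_idn[OF M c y] by (simp add: tri_def)
    then show "\<exists>t\<in>on_obj E c. ap p c t = y" using t by blast
  qed
  moreover have "separated E"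
  proof (rule separatedI[OF E])
    fix c t t' assume c: "c \<in> obj B" and t: "t \<in> on_obj E c" and t': "t' \<in> on_obj E c" and eq: "k E c t = k E c t'"
    obtain b y g where t_eq: "t = tri b y g" and b: "b \<in> obj B" and y: "y \<in> on_obj M b" and g: "g \<in> hom B b c"
      using t E_iff[OF c] by blast
    obtain b' y' g' where t'_eq: "t' = tri b' y' g'" and b': "b' \<in> obj B" and y': "y' \<in> on_obj M b'" and g': "g' \<in> hom B b' c"
      using t' E_iff[OF c] by blast
    \<comment> \<open>The map to the constant functor on the index set separates the summands, because constant
      functors are restrictions along \<open>K\<close>.\<close>
    define D where "D = sigma (obj B) (on_obj M)"
    have "D \<in> U" unfolding D_def using set_universe_sigma[OF universe BU on_obj_U[OF M]] .
    then obtain N where N: "N \<in> obj SA.C" and No: "\<And>a. a \<in> obj A \<Longrightarrow> on_obj N a = D"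
      and Na: "\<And>a a' h x. h \<in> hom A a a' \<Longrightarrow> x \<in> D \<Longrightarrow> act N a a' h x = x"
      by (rule SA.obj_exists[of "\<lambda>_. D" "\<lambda>_ _ _ x. x"]) auto
    have RN: "on_obj R N \<in> obj C" using functor_obj[OF R_functor N] .
    have RNo: "on_obj (on_obj R N) c = D" if "c \<in> obj B" for c using R_on_obj[OF that] No[OF K_obj[OF that]] by simp
    have inD: "pair (left t) (left (right t)) \<in> D" if "c \<in> obj B" "t \<in> on_obj E c" for c t
      using that by (auto simp: E_iff tri_def D_def in_sigma)
    obtain r where r: "r \<in> hom C E (on_obj R N)"
      and rv: "\<And>c t. c \<in> obj B \<Longrightarrow> t \<in> on_obj E c \<Longrightarrow> ap r c t = pair (left t) (left (right t))"
    proof (rule map_exists[OF E RN, of "\<lambda>c t. pair (left t) (left (right t))"])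
      show "pair (left t) (left (right t)) \<in> on_obj (on_obj R N) c" if "c \<in> obj B" "t \<in> on_obj E c" for c t
        using inD[OF that] RNo[OF that(1)] by simp
    next
      fix c d f t assume f: "f \<in> hom B c d" and t: "t \<in> on_obj E c"
      then obtain b y g where t_eq: "t = tri b y g" and y: "y \<in> on_obj M b" and g: "g \<in> hom B b c"
        using E_iff[OF hom_obj(1)[OF B f]] by blast
      have "act E c d f t = tri b y (cmp B f g)" using act_tri[OF f y g] t_eq by simp
      then have "pair (left (act E c d f t)) (left (right (act E c d f t))) = pair (left t) (left (right t))"
        using t_eq by (simp add: tri_def)
      then show "pair (left (act E c d f t)) (left (right (act E c d f t))) =
          act (on_obj R N) c d f (pair (left t) (left (right t)))"
        using R_act[OF f] Na[OF K_hom[OF f] inD[OF hom_obj(1)[OF B f] t]] by simp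
    qed blast
    have "ap r c t = ap r c t'"
      using separatedD[OF separated_restriction[OF N] c ap_in[OF r c t] ap_in[OF r c t'] k_cong[OF r c t t' eq]] .
    then have byb: "b' = b" "y' = y" using rv[OF c t] rv[OF c t'] t_eq t'_eq by (auto simp: tri_def)
    obtain i where i: "i \<in> hom C (Y b) E" and iv: "\<And>c g. c \<in> obj B \<Longrightarrow> g \<in> on_obj (Y b) c \<Longrightarrow> ap i c g = tri b y g"
    proof (rule map_exists[OF Y_obj[OF b] E, of "\<lambda>c g. tri b y g"])
      show "tri b y g \<in> on_obj E c" if "c \<in> obj B" "g \<in> on_obj (Y b) c" for c g
        using tri_in[OF y] that Y_on_obj by simp
      show "tri b y (act (Y b) c d f g) = act E c d f (tri b y g)"
        if f: "f \<in> hom B c d" and g: "g \<in> on_obj (Y b) c" for c d f g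
      proof -
        have "g \<in> hom B b c" using g Y_on_obj[OF hom_obj(1)[OF B f]] by simp
        then show ?thesis using act_tri[OF f y] Y_act[OF f] by simp
      qed
    qed blast
    have "inj_map (Y b) i" unfolding inj_map_def using iv tri_inj by metis
    note Ti = T_inj[OF i this]
    have gY: "g \<in> on_obj (Y b) c" "g' \<in> on_obj (Y b) c" using g g' byb Y_on_obj[OF c] by auto
    have "ap i c g = t" "ap i c g' = t'" using iv[OF c] gY t_eq t'_eq byb by auto
    then have "ap (Tm (Y b) E i) c (k (Y b) c g) = ap (Tm (Y b) E i) c (k (Y b) c g')"
      using k_nat[OF i c gY(1)] k_nat[OF i c gY(2)] eq by simp
    then have "k (Y b) c g = k (Y b) c g'"
      using inj_mapD[OF Ti c k_in[OF Y_obj[OF b] c gY(1)] k_in[OF Y_obj[OF b] c gY(2)]] by blast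
    then have "g = g'" using separatedD[OF separated_representable[OF b] c gY] by blast
    then show "t = t'" using t_eq t'_eq byb by simp
  qed
  ultimately show ?thesis using that p by blast
qed

section \<open>The induced reflection\<close>

abbreviation MC where "MC \<equiv> Mono_cat U B K Lan \<theta>"

lemma MC_obj: "M \<in> obj MC \<longleftrightarrow> separated M"
  unfolding Mono_cat_def full_sub_def separated_def using mono_iff \<theta>_hom by auto

lemma MC_hom: "f \<in> hom MC M N \<longleftrightarrow> separated M \<and> separated N \<and> f \<in> hom C M N"
proof -
  have "f \<in> hom MC M N \<longleftrightarrow> is_mono C M (T M) (\<theta> M) \<and> is_mono C N (T N) (\<theta> N) \<and> f \<in> hom C M N"
    unfolding Mono_cat_def full_sub_def by auto
  also have "\<dots> \<longleftrightarrow> separated M \<and> separated N \<and> f \<in> hom C M N"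
    unfolding separated_def using mono_iff \<theta>_hom hom_objects by metis
  finally show ?thesis .
qed

lemma MC_simps: "idn MC = idn C" "cmp MC = cmp C"
  unfolding Mono_cat_def full_sub_def by simp_all

lemma category_MC: "category MC"
  unfolding category_def
proof (intro conjI allI impI ballI)
  fix x y f assume "f \<in> hom MC x y"
  then show "x \<in> obj MC" "y \<in> obj MC" "cmp MC f (idn MC x) = f" "cmp MC (idn MC y) f = f"
    using cmp_idl[OF C] cmp_idr[OF C] unfolding MC_hom MC_obj MC_simps by blast+
next
  fix x assume "x \<in> obj MC"
  then show "idn MC x \<in> hom MC x x"
    unfolding MC_hom MC_obj MC_simps using idn_hom[OF C separated_obj] by blast
next
  fix x y z f g assume "f \<in> hom MC x y" "g \<in> hom MC y z"
  then show "cmp MC g f \<in> hom MC x z"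
    unfolding MC_hom MC_simps using cmp_hom[OF C] by blast
next
  fix w x y z f g h assume "f \<in> hom MC w x" "g \<in> hom MC x y" "h \<in> hom MC y z"
  then show "cmp MC h (cmp MC g f) = cmp MC (cmp MC h g) f"
    unfolding MC_hom MC_simps using cmp_assoc[OF C] by metis
qed

lemma MC_iso: "separated M \<Longrightarrow> separated N \<Longrightarrow> is_iso MC M N f \<longleftrightarrow> is_iso C M N f"
  unfolding is_iso_def by (simp add: Bex_def MC_hom MC_simps del: functor_cat_simps)

lemma MC_inclusion: "is_functor MC C id_fun"
  unfolding is_functor_def by (simp add: MC_hom MC_obj MC_simps separated_obj del: functor_cat_simps)

text \<open>
  The quotient map identifies only indistinguishable elements, so by \<open>k_reflect\<close> elements of the
  quotient are indistinguishable only if they have indistinguishable representatives.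
\<close>
lemma separated_quotient:
  assumes M: "M \<in> obj C"
  shows "\<exists>Q e. e \<in> hom C M Q \<and> surj_map M Q e \<and> separated Q \<and>
    (\<forall>b\<in>obj B. \<forall>x\<in>on_obj M b. \<forall>x'\<in>on_obj M b. ap e b x = ap e b x' \<longleftrightarrow> k M b x = k M b x')"
proof -
  obtain Q e where e: "e \<in> hom C M Q" and es: "surj_map M Q e"
    and ek: "\<And>b x x'. b \<in> obj B \<Longrightarrow> x \<in> on_obj M b \<Longrightarrow> x' \<in> on_obj M b \<Longrightarrow> ap e b x = ap e b x' \<longleftrightarrow> k M b x = k M b x'"
    by (rule quotient_exists[OF M, of "\<lambda>b x x'. k M b x = k M b x'"]) (auto intro: k_act[OF M])
  have Q: "Q \<in> obj C" using hom_objects[OF e] by blast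
  have "separated Q"
  proof (rule separatedI[OF Q])
    fix b y y' assume b: "b \<in> obj B" and y: "y \<in> on_obj Q b" and y': "y' \<in> on_obj Q b" and eq: "k Q b y = k Q b y'"
    obtain x where x: "x \<in> on_obj M b" "ap e b x = y" using surj_mapE[OF es b y] .
    obtain x' where x': "x' \<in> on_obj M b" "ap e b x' = y'" using surj_mapE[OF es b y'] .
    have "k M b x = k M b x'" by (rule k_reflect[OF e _ b x(1) x'(1)]) (use ek x x' eq in auto)
    then show "y = y'" using ek[OF b x(1) x'(1)] x x' by simp
  qed
  then show ?thesis using e es ek by blast
qed

end

text \<open>
  Beyond the adjunction, only two properties of the units enter the argument: they are surjective,
  and they identify exactly the indistinguishable elements.
\<close>

locale kan_reflection = pullback_preserving_kan U B A K Lan \<theta> \<epsilon>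
  for U :: "'u set set" and B :: "('u, 'u) cat" and A :: "('a, 'u) cat" and K :: "('u, 'u, 'a, 'u) fnctr"
    and Lan \<theta> \<epsilon> +
  fixes I \<eta> \<epsilon>'
  assumes refl: "adjunction (Set_pow U B) (Mono_cat U B K Lan \<theta>) I id_fun \<eta> \<epsilon>'"
    and \<eta>_surj: "\<And>M. M \<in> obj (Set_pow U B) \<Longrightarrow> surj_map M (on_obj I M) (\<eta> M)"
    and \<eta>_ker: "\<And>M b x x'. M \<in> obj (Set_pow U B) \<Longrightarrow> b \<in> obj B \<Longrightarrow> x \<in> on_obj M b \<Longrightarrow> x' \<in> on_obj M b \<Longrightarrow>
      ap (\<eta> M) b x = ap (\<eta> M) b x' \<longleftrightarrow> k M b x = k M b x'"

lemma (in pullback_preserving_kan) kan_reflection_exists: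
  "\<exists>I \<eta> \<epsilon>'. kan_reflection U B A K Lan \<theta> \<epsilon> I \<eta> \<epsilon>'"
proof -
  have "\<forall>M. \<exists>Q e. M \<in> obj C \<longrightarrow> e \<in> hom C M Q \<and> surj_map M Q e \<and> separated Q \<and>
    (\<forall>b\<in>obj B. \<forall>x\<in>on_obj M b. \<forall>x'\<in>on_obj M b. ap e b x = ap e b x' \<longleftrightarrow> k M b x = k M b x')"
    using separated_quotient by blast
  then obtain Q \<eta> where Q: "\<And>M. M \<in> obj C \<Longrightarrow> \<eta> M \<in> hom C M (Q M) \<and> surj_map M (Q M) (\<eta> M) \<and> separated (Q M) \<and>
    (\<forall>b\<in>obj B. \<forall>x\<in>on_obj M b. \<forall>x'\<in>on_obj M b. ap (\<eta> M) b x = ap (\<eta> M) b x' \<longleftrightarrow> k M b x = k M b x')"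
    by metis
  have \<eta>: "\<eta> M \<in> hom C M (Q M)" and s: "surj_map M (Q M) (\<eta> M)" and QM: "separated (Q M)" if "M \<in> obj C" for M
    using Q[OF that] by blast+
  have ker: "ap (\<eta> M) b x = ap (\<eta> M) b x' \<longleftrightarrow> k M b x = k M b x'"
    if "M \<in> obj C" "b \<in> obj B" "x \<in> on_obj M b" "x' \<in> on_obj M b" for M b x x'
    using Q[OF that(1)] that(2-4) by blast
  have "\<exists>I \<epsilon>'. on_obj I = Q \<and> adjunction C MC I id_fun \<eta> \<epsilon>'"
  proof (rule adjunction_from_universal_arrows[OF C category_MC MC_inclusion])
    fix M assume M: "M \<in> obj C"
    show "Q M \<in> obj MC" using QM[OF M] by (simp add: MC_obj)
    show "\<eta> M \<in> hom C M (on_obj id_fun (Q M))" using \<eta>[OF M] by simp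
    fix N f assume N: "N \<in> obj MC" and "f \<in> hom C M (on_obj id_fun N)"
    then have f: "f \<in> hom C M N" and N': "separated N" by (auto simp: MC_obj)
    obtain g where g: "g \<in> hom C (Q M) N" "cmp C g (\<eta> M) = f"
    proof (rule descend[OF \<eta>[OF M] s[OF M] f])
      fix b x y assume b: "b \<in> obj B" and x: "x \<in> on_obj M b" and y: "y \<in> on_obj M b" and "ap (\<eta> M) b x = ap (\<eta> M) b y"
      then have "k M b x = k M b y" using ker[OF M b x y] by blast
      then show "ap f b x = ap f b y"
        using separatedD[OF N' b ap_in[OF f b x] ap_in[OF f b y] k_cong[OF f b x y]] by blast
    qed blast
    show "\<exists>!g. g \<in> hom MC (Q M) N \<and> cmp C (on_arr id_fun (Q M) N g) (\<eta> M) = f"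
    proof (intro ex1I conjI)
      show "g \<in> hom MC (Q M) N" using g QM[OF M] N' MC_hom by blast
      show "cmp C (on_arr id_fun (Q M) N g) (\<eta> M) = f" unfolding id_fun_simps by (rule g)
      fix h assume h: "h \<in> hom MC (Q M) N \<and> cmp C (on_arr id_fun (Q M) N h) (\<eta> M) = f"
      have h1: "h \<in> hom C (Q M) N" using conjunct1[OF h] MC_hom by blast
      have h2: "cmp C h (\<eta> M) = cmp C g (\<eta> M)" using conjunct2[OF h] unfolding id_fun_simps g(2) .
      show "h = g" by (rule surj_cancel[OF \<eta>[OF M] s[OF M] h1 g(1) h2])
    qed
  qed
  then obtain I \<epsilon>' where "on_obj I = Q" "adjunction C MC I id_fun \<eta> \<epsilon>'" by blast
  then have "kan_reflection U B A K Lan \<theta> \<epsilon> I \<eta> \<epsilon>'"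
    using s ker by unfold_locales (simp_all del: functor_cat_simps)
  then show ?thesis by blast
qed

context kan_reflection
begin

lemma I_separated: "M \<in> obj C \<Longrightarrow> separated (on_obj I M)"
  using functor_obj[OF adjunctionD(1)[OF refl]] MC_obj by blast

lemma \<eta>_hom: "M \<in> obj C \<Longrightarrow> \<eta> M \<in> hom C M (on_obj I M)"
  using adjunctionD(3)[OF refl] by simp

lemma reflection_is_induced: "induced_reflection U B K Lan \<theta> I \<eta> \<epsilon>'"
  unfolding induced_reflection_def
proof (intro conjI ballI refl)
  fix M assume M: "M \<in> obj C"
  note h = \<eta>_hom[OF M]
  obtain \<mu> where \<mu>: "\<mu> \<in> hom C (on_obj I M) (T M)" "cmp C \<mu> (\<eta> M) = \<theta> M"
    and \<mu>\<eta>: "\<And>b x. b \<in> obj B \<Longrightarrow> x \<in> on_obj M b \<Longrightarrow> ap \<mu> b (ap (\<eta> M) b x) = ap (\<theta> M) b x"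
    by (rule descend[OF h \<eta>_surj[OF M] \<theta>_hom[OF M]]) (use \<eta>_ker[OF M] k_def in auto)
  have "ran (\<eta> M b) = on_obj (on_obj I M) b \<and> inj_on (\<mu> b) (on_obj (on_obj I M) b)" if b: "b \<in> obj B" for b
  proof
    have r: "ran (\<eta> M b) \<subseteq> on_obj (on_obj I M) b"
      using nat_transD(1)[of B "Set_cat U" M "on_obj I M" "\<eta> M" b] h b by (auto simp: functor_cat_hom Set_cat_hom)
    have "y \<in> ran (\<eta> M b)" if y: "y \<in> on_obj (on_obj I M) b" for y
    proof -
      obtain x where "x \<in> on_obj M b" "ap (\<eta> M) b x = y" using surj_mapE[OF \<eta>_surj[OF M] b y] .
      then show ?thesis using ap_Some(1)[OF h b] by (auto simp: ran_def)
    qed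
    then show "ran (\<eta> M b) = on_obj (on_obj I M) b" using r by blast
    show "inj_on (\<mu> b) (on_obj (on_obj I M) b)"
    proof (rule inj_onI)
      fix y y' assume y: "y \<in> on_obj (on_obj I M) b" and y': "y' \<in> on_obj (on_obj I M) b" and eq: "\<mu> b y = \<mu> b y'"
      obtain x where x: "x \<in> on_obj M b" "ap (\<eta> M) b x = y" using surj_mapE[OF \<eta>_surj[OF M] b y] .
      obtain x' where x': "x' \<in> on_obj M b" "ap (\<eta> M) b x' = y'" using surj_mapE[OF \<eta>_surj[OF M] b y'] .
      have "ap \<mu> b y = ap \<mu> b y'" using eq by (simp add: ap_def)
      then have "k M b x = k M b x'" using \<mu>\<eta>[OF b x(1)] \<mu>\<eta>[OF b x'(1)] x x' unfolding k_def by simp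
      then show "y = y'" using \<eta>_ker[OF M b x(1) x'(1)] x x' by simp
    qed
  qed
  then show "\<exists>\<mu>\<in>hom C (on_obj I M) (T M). \<theta> M = cmp C \<mu> (\<eta> M) \<and>
      (\<forall>b\<in>obj B. ran (\<eta> M b) = on_obj (on_obj I M) b \<and> inj_on (\<mu> b) (on_obj (on_obj I M) b))"
    using \<mu> by metis
qed

section \<open>The classes of the monotone-light factorization\<close>

abbreviation "EE \<equiv> E_cls C MC I"
abbreviation "MM \<equiv> M_cls C MC I"
abbreviation "EE' \<equiv> E'_cls C MC I"
abbreviation "MMstar \<equiv> Mstar_cls C MC I"

text \<open>
  The reflection of \<open>f\<close> is the map that \<open>f\<close> induces between the quotients by indistinguishability;
  the two conditions are its injectivity and its surjectivity.
\<close>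

lemma E_iff:
  "EE M N f \<longleftrightarrow> f \<in> hom C M N \<and>
     (\<forall>b\<in>obj B. \<forall>x\<in>on_obj M b. \<forall>x'\<in>on_obj M b. k N b (ap f b x) = k N b (ap f b x') \<longrightarrow> k M b x = k M b x') \<and>
     (\<forall>b\<in>obj B. \<forall>y\<in>on_obj N b. \<exists>x\<in>on_obj M b. k N b (ap f b x) = k N b y)"
proof (cases "f \<in> hom C M N")
  case f: True
  have M: "M \<in> obj C" and N: "N \<in> obj C" using hom_objects[OF f] by auto
  let ?f = "on_arr I M N f" and ?IM = "on_obj I M" and ?IN = "on_obj I N"
  have If: "?f \<in> hom C ?IM ?IN" using functor_hom[OF adjunctionD(1)[OF refl] f] MC_hom by blast
  have nat: "ap ?f b (ap (\<eta> M) b x) = ap (\<eta> N) b (ap f b x)" if "b \<in> obj B" "x \<in> on_obj M b" for b x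
  proof -
    have "cmp C (\<eta> N) f = cmp C ?f (\<eta> M)" using adjunctionD(4)[OF refl f] by (simp del: functor_cat_simps)
    then show ?thesis
      using ap_cmp[OF f that, of "\<eta> N"] ap_cmp[OF \<eta>_hom[OF M] that, of ?f] by metis
  qed
  have "is_iso MC ?IM ?IN ?f \<longleftrightarrow> inj_map ?IM ?f \<and> surj_map ?IM ?IN ?f"
    using MC_iso[OF I_separated[OF M] I_separated[OF N]] iso_iff If by blast
  moreover have "inj_map ?IM ?f \<longleftrightarrow>
    (\<forall>b\<in>obj B. \<forall>x\<in>on_obj M b. \<forall>x'\<in>on_obj M b. k N b (ap f b x) = k N b (ap f b x') \<longrightarrow> k M b x = k M b x')"
  proof (intro iffI ballI impI)
    fix b x x' assume inj: "inj_map ?IM ?f" and b: "b \<in> obj B" and x: "x \<in> on_obj M b" and x': "x' \<in> on_obj M b"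
      and "k N b (ap f b x) = k N b (ap f b x')"
    then have "ap ?f b (ap (\<eta> M) b x) = ap ?f b (ap (\<eta> M) b x')"
      using nat[OF b x] nat[OF b x'] \<eta>_ker[OF N b ap_in[OF f b x] ap_in[OF f b x']] by simp
    then show "k M b x = k M b x'"
      using inj_mapD[OF inj b ap_in[OF \<eta>_hom[OF M] b x] ap_in[OF \<eta>_hom[OF M] b x']] \<eta>_ker[OF M b x x'] by blast
  next
    assume a: "\<forall>b\<in>obj B. \<forall>x\<in>on_obj M b. \<forall>x'\<in>on_obj M b. k N b (ap f b x) = k N b (ap f b x') \<longrightarrow> k M b x = k M b x'"
    show "inj_map ?IM ?f"
      unfolding inj_map_def
    proof (intro ballI impI)
      fix b y y' assume b: "b \<in> obj B" and y: "y \<in> on_obj ?IM b" and y': "y' \<in> on_obj ?IM b" and eq: "ap ?f b y = ap ?f b y'"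
      obtain x where x: "x \<in> on_obj M b" "ap (\<eta> M) b x = y" using surj_mapE[OF \<eta>_surj[OF M] b y] .
      obtain x' where x': "x' \<in> on_obj M b" "ap (\<eta> M) b x' = y'" using surj_mapE[OF \<eta>_surj[OF M] b y'] .
      have "k N b (ap f b x) = k N b (ap f b x')"
        using eq nat[OF b x(1)] nat[OF b x'(1)] x x' \<eta>_ker[OF N b ap_in[OF f b x(1)] ap_in[OF f b x'(1)]] by simp
      then show "y = y'" using a b x x' \<eta>_ker[OF M b x(1) x'(1)] by blast
    qed
  qed
  moreover have "surj_map ?IM ?IN ?f \<longleftrightarrow> (\<forall>b\<in>obj B. \<forall>y\<in>on_obj N b. \<exists>x\<in>on_obj M b. k N b (ap f b x) = k N b y)"
  proof (intro iffI ballI)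
    fix b y assume s: "surj_map ?IM ?IN ?f" and b: "b \<in> obj B" and y: "y \<in> on_obj N b"
    obtain u where u: "u \<in> on_obj ?IM b" "ap ?f b u = ap (\<eta> N) b y"
      using surj_mapE[OF s b ap_in[OF \<eta>_hom[OF N] b y]] .
    obtain x where x: "x \<in> on_obj M b" "ap (\<eta> M) b x = u" using surj_mapE[OF \<eta>_surj[OF M] b u(1)] .
    have "k N b (ap f b x) = k N b y"
      using nat[OF b x(1)] u(2) x(2) \<eta>_ker[OF N b ap_in[OF f b x(1)] y] by simp
    then show "\<exists>x\<in>on_obj M b. k N b (ap f b x) = k N b y" using x(1) by blast
  next
    assume a: "\<forall>b\<in>obj B. \<forall>y\<in>on_obj N b. \<exists>x\<in>on_obj M b. k N b (ap f b x) = k N b y"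
    show "surj_map ?IM ?IN ?f"
      unfolding surj_map_def
    proof (intro ballI)
      fix b v assume b: "b \<in> obj B" and v: "v \<in> on_obj ?IN b"
      obtain y where y: "y \<in> on_obj N b" "ap (\<eta> N) b y = v" using surj_mapE[OF \<eta>_surj[OF N] b v] .
      obtain x where x: "x \<in> on_obj M b" "k N b (ap f b x) = k N b y" using a b y(1) by blast
      have "ap ?f b (ap (\<eta> M) b x) = v"
        using nat[OF b x(1)] x(2) y(2) \<eta>_ker[OF N b ap_in[OF f b x(1)] y(1)] by simp
      then show "\<exists>u\<in>on_obj ?IM b. ap ?f b u = v" using ap_in[OF \<eta>_hom[OF M] b x(1)] by blast
    qed
  qed
  ultimately show ?thesis unfolding E_cls_def using f by blast
next
  case False
  then show ?thesis unfolding E_cls_def by blast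
qed

text \<open>
  Below, the surjective tame maps turn out to be the class \<open>E'\<close> and the light maps the class \<open>M*\<close>.
\<close>
definition tame where
  "tame M f \<longleftrightarrow> (\<forall>b\<in>obj B. \<forall>x\<in>on_obj M b. \<forall>x'\<in>on_obj M b. ap f b x = ap f b x' \<longrightarrow> k M b x = k M b x')"

definition light where
  "light M f \<longleftrightarrow> (\<forall>b\<in>obj B. \<forall>x\<in>on_obj M b. \<forall>x'\<in>on_obj M b.
     ap f b x = ap f b x' \<longrightarrow> k M b x = k M b x' \<longrightarrow> x = x')"

lemma tameD: "tame M f \<Longrightarrow> b \<in> obj B \<Longrightarrow> x \<in> on_obj M b \<Longrightarrow> x' \<in> on_obj M b \<Longrightarrow> ap f b x = ap f b x' \<Longrightarrow>
    k M b x = k M b x'"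
  unfolding tame_def by blast

lemma lightD: "light M f \<Longrightarrow> b \<in> obj B \<Longrightarrow> x \<in> on_obj M b \<Longrightarrow> x' \<in> on_obj M b \<Longrightarrow> ap f b x = ap f b x' \<Longrightarrow>
    k M b x = k M b x' \<Longrightarrow> x = x'"
  unfolding light_def by blast

lemma tame_reflect:
  assumes "f \<in> hom C M N" "tame M f" "b \<in> obj B" "x \<in> on_obj M b" "x' \<in> on_obj M b"
    "k N b (ap f b x) = k N b (ap f b x')"
  shows "k M b x = k M b x'"
  using k_reflect[OF assms(1) tameD[OF assms(2)] assms(3-6)] by blast

text \<open>
  If all pullbacks of \<open>f\<close> are inverted by the reflection, then so is the one along a separated cover
  \<open>c : E \<rightarrow> N\<close>; there indistinguishability in \<open>E\<close> is equality, and the two conditions of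
  \<open>E_iff\<close> turn into the surjectivity and the tameness of \<open>f\<close>. Conversely, if elements \<open>(z, x)\<close> and
  \<open>(z', x')\<close> of a pullback of \<open>f\<close> have indistinguishable first components, then the images of \<open>x\<close> and
  \<open>x'\<close> in \<open>N\<close> are indistinguishable, hence so are \<open>x\<close> and \<open>x'\<close> by \<open>k_reflect\<close>, and the two pairs
  by \<open>k_pullback\<close>.
\<close>

lemma E'_iff: "EE' M N f \<longleftrightarrow> f \<in> hom C M N \<and> surj_map M N f \<and> tame M f"
proof
  assume a: "EE' M N f"
  then have f: "f \<in> hom C M N" unfolding E'_cls_def by blast
  have M: "M \<in> obj C" and N: "N \<in> obj C" using hom_objects[OF f] by auto
  obtain E c where c: "c \<in> hom C E N" and cs: "surj_map E N c" and sep: "separated E"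
    using separated_cover[OF N] .
  obtain P p q where pb: "is_pullback C E M N c f P p q" using is_pullback_exists[OF c f] .
  note h = pullback_hom[OF pb]
  have pE: "EE P E p" using a pb unfolding E'_cls_def by blast
  have "surj_map M N f"
    unfolding surj_map_def
  proof (intro ballI)
    fix b y assume b: "b \<in> obj B" and y: "y \<in> on_obj N b"
    obtain e where e: "e \<in> on_obj E b" "ap c b e = y" using surj_mapE[OF cs b y] .
    obtain t where t: "t \<in> on_obj P b" "k E b (ap p b t) = k E b e" using pE b e(1) unfolding E_iff by blast
    have "ap p b t = e" using separatedD[OF sep b ap_in[OF h(3) b t(1)] e(1) t(2)] .
    then have "ap f b (ap q b t) = y" using pullback_elements(3)[OF pb b t(1)] e(2) by simp
    then show "\<exists>x\<in>on_obj M b. ap f b x = y" using ap_in[OF h(4) b t(1)] by blast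
  qed
  moreover have "tame M f"
    unfolding tame_def
  proof (intro ballI impI)
    fix b x x' assume b: "b \<in> obj B" and x: "x \<in> on_obj M b" and x': "x' \<in> on_obj M b" and eq: "ap f b x = ap f b x'"
    obtain e where e: "e \<in> on_obj E b" "ap c b e = ap f b x" using surj_mapE[OF cs b ap_in[OF f b x]] .
    obtain t where t: "t \<in> on_obj P b" "ap p b t = e" "ap q b t = x"
      using pullback_elements(2)[OF pb b e(1) x e(2)] by blast
    obtain t' where t': "t' \<in> on_obj P b" "ap p b t' = e" "ap q b t' = x'"
      using pullback_elements(2)[OF pb b e(1) x'] e(2) eq by metis
    have "k P b t = k P b t'" using pE b t(1,2) t'(1,2) unfolding E_iff by metis
    then show "k M b x = k M b x'" using k_cong[OF h(4) b t(1) t'(1)] t(3) t'(3) by simp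
  qed
  ultimately show "f \<in> hom C M N \<and> surj_map M N f \<and> tame M f" using f by blast
next
  assume "f \<in> hom C M N \<and> surj_map M N f \<and> tame M f"
  then have f: "f \<in> hom C M N" and s: "surj_map M N f" and tf: "tame M f" by blast+
  have "EE P Z p" if pb: "is_pullback C Z M N g f P p q" for Z g P p q
    unfolding E_iff
  proof (intro conjI ballI impI)
    note h = pullback_hom[OF pb]
    show "p \<in> hom C P Z" using h by blast
    fix b assume b: "b \<in> obj B"
    {
      fix t t' assume t: "t \<in> on_obj P b" and t': "t' \<in> on_obj P b" and eq: "k Z b (ap p b t) = k Z b (ap p b t')"
      note pt = ap_in[OF h(3) b t] ap_in[OF h(3) b t'] and qt = ap_in[OF h(4) b t] ap_in[OF h(4) b t']
      have "k N b (ap f b (ap q b t)) = k N b (ap f b (ap q b t'))"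
        using k_cong[OF h(1) b pt eq] pullback_elements(3)[OF pb b] t t' by metis
      then have "k M b (ap q b t) = k M b (ap q b t')" using tame_reflect[OF f tf b qt] by blast
      then show "k P b t = k P b t'" using k_pullback[OF pb b t t' eq] by blast
    next
      fix z assume z: "z \<in> on_obj Z b"
      obtain x where x: "x \<in> on_obj M b" "ap f b x = ap g b z" using surj_mapE[OF s b ap_in[OF h(1) b z]] .
      obtain t where "t \<in> on_obj P b" "ap p b t = z" using pullback_elements(2)[OF pb b z x(1)] x(2) by metis
      then show "\<exists>t\<in>on_obj P b. k Z b (ap p b t) = k Z b z" by blast
    }
  qed
  then show "EE' M N f" unfolding E'_cls_def using f by blast
qed

lemma reflection_has_stable_units: "stable_units C MC I \<eta>"
  unfolding stable_units_def E'_iff tame_def using \<eta>_hom \<eta>_surj \<eta>_ker by blast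

text \<open>
  The middle object is the quotient of \<open>M\<close> by the intersection of the kernel of \<open>f\<close> with
  indistinguishability. Since the quotient map reflects indistinguishability, elements of the quotient
  that are indistinguishable and have the same image come from such elements of \<open>M\<close>.
\<close>

lemma light_factorization:
  assumes f: "f \<in> hom C M N"
  obtains Z e m where "EE' M Z e" "m \<in> hom C Z N" "light Z m" "f = cmp C m e"
proof -
  have M: "M \<in> obj C" using hom_objects[OF f] by blast
  obtain Z e where e: "e \<in> hom C M Z" and es: "surj_map M Z e"
    and ek: "\<And>b x x'. b \<in> obj B \<Longrightarrow> x \<in> on_obj M b \<Longrightarrow> x' \<in> on_obj M b \<Longrightarrow>
      ap e b x = ap e b x' \<longleftrightarrow> ap f b x = ap f b x' \<and> k M b x = k M b x'"
    by (rule quotient_exists[OF M, of "\<lambda>b x x'. ap f b x = ap f b x' \<and> k M b x = k M b x'"])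
      (auto intro: k_act[OF M] simp: ap_act[OF f])
  obtain m where m: "m \<in> hom C Z N" "cmp C m e = f"
    and me: "\<And>b x. b \<in> obj B \<Longrightarrow> x \<in> on_obj M b \<Longrightarrow> ap m b (ap e b x) = ap f b x"
    by (rule descend[OF e es f]) (use ek in auto)
  have te: "tame M e" unfolding tame_def using ek by blast
  have "light Z m"
    unfolding light_def
  proof (intro ballI impI)
    fix b z z' assume b: "b \<in> obj B" and z: "z \<in> on_obj Z b" and z': "z' \<in> on_obj Z b"
      and eq: "ap m b z = ap m b z'" and keq: "k Z b z = k Z b z'"
    obtain x where x: "x \<in> on_obj M b" "ap e b x = z" using surj_mapE[OF es b z] .
    obtain x' where x': "x' \<in> on_obj M b" "ap e b x' = z'" using surj_mapE[OF es b z'] .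
    have "k M b x = k M b x'" using tame_reflect[OF e te b x(1) x'(1)] x x' keq by simp
    moreover have "ap f b x = ap f b x'" using me[OF b x(1)] me[OF b x'(1)] x x' eq by simp
    ultimately show "z = z'" using ek[OF b x(1) x'(1)] x x' by simp
  qed
  moreover have "EE' M Z e" using E'_iff e es te by blast
  ultimately show ?thesis using that m by blast
qed

text \<open>
  The top map \<open>u\<close> respects the kernel of \<open>e\<close>: if \<open>e s = e s'\<close>, then \<open>s\<close> and \<open>s'\<close> are
  indistinguishable, so \<open>u s\<close> and \<open>u s'\<close> are indistinguishable and have the same image under \<open>m\<close>.
\<close>

lemma orthogonal_light:
  assumes e: "EE' a b e" and m: "m \<in> hom C x y" and lm: "light x m"
  shows "orthogonal C a b e x y m"
  unfolding orthogonal_def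
proof (intro ballI impI)
  fix u v assume u: "u \<in> hom C a x" and v: "v \<in> hom C b y" and sq: "cmp C v e = cmp C m u"
  have eh: "e \<in> hom C a b" and es: "surj_map a b e" and te: "tame a e" using e E'_iff by blast+
  obtain w where w: "w \<in> hom C b x" "cmp C w e = u"
  proof (rule descend[OF eh es u])
    fix c s s' assume c: "c \<in> obj B" and s: "s \<in> on_obj a c" and s': "s' \<in> on_obj a c" and eq: "ap e c s = ap e c s'"
    have "ap m c (ap u c s) = ap m c (ap u c s')"
      using ap_cmp[OF eh c s, of v] ap_cmp[OF eh c s', of v] ap_cmp[OF u c s, of m] ap_cmp[OF u c s', of m] sq eq
      by metis
    then show "ap u c s = ap u c s'"
      using lightD[OF lm c ap_in[OF u c s] ap_in[OF u c s']] k_cong[OF u c s s' tameD[OF te c s s' eq]] by blast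
  qed blast
  have "cmp C m w = v"
    by (rule surj_cancel[OF eh es cmp_hom[OF C w(1) m] v])
      (metis cmp_assoc[OF C eh w(1) m] w(2) sq)
  then show "\<exists>!w. w \<in> hom C b x \<and> cmp C w e = u \<and> cmp C m w = v"
    using w surj_cancel[OF eh es] by metis
qed

text \<open>
  Maps into separated objects do not see the difference between indistinguishable elements, and a map
  \<open>e\<close> inverted by the reflection is bijective up to indistinguishability. Thus the diagonal sends
  \<open>y\<close> to \<open>u s\<close> for any \<open>s\<close> with \<open>e s\<close> indistinguishable from \<open>y\<close>.
\<close>

lemma M_if_separated:
  assumes r: "r \<in> hom C P E" and P: "separated P" and E: "separated E"
  shows "MM P E r"
  unfolding M_cls_def orthogonal_def
proof (intro conjI allI impI ballI r)
  fix a b e u v assume e: "EE a b e" and u: "u \<in> hom C a P" and v: "v \<in> hom C b E" and sq: "cmp C v e = cmp C r u"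
  have eh: "e \<in> hom C a b"
    and e1: "\<And>c s s'. c \<in> obj B \<Longrightarrow> s \<in> on_obj a c \<Longrightarrow> s' \<in> on_obj a c \<Longrightarrow> k b c (ap e c s) = k b c (ap e c s') \<Longrightarrow> k a c s = k a c s'"
    and e2: "\<And>c y. c \<in> obj B \<Longrightarrow> y \<in> on_obj b c \<Longrightarrow> \<exists>s\<in>on_obj a c. k b c (ap e c s) = k b c y"
    using e unfolding E_iff by blast+
  have bo: "b \<in> obj C" and Po: "P \<in> obj C" using hom_objects[OF eh] hom_objects[OF u] by auto
  have "\<forall>c y. \<exists>s. c \<in> obj B \<longrightarrow> y \<in> on_obj b c \<longrightarrow> s \<in> on_obj a c \<and> k b c (ap e c s) = k b c y"
    using e2 by metis
  then obtain s where s: "\<And>c y. c \<in> obj B \<Longrightarrow> y \<in> on_obj b c \<Longrightarrow> s c y \<in> on_obj a c"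
    and ks: "\<And>c y. c \<in> obj B \<Longrightarrow> y \<in> on_obj b c \<Longrightarrow> k b c (ap e c (s c y)) = k b c y" by metis
  have u_eq: "ap u c t = ap u c t'"
    if c: "c \<in> obj B" and t: "t \<in> on_obj a c" and t': "t' \<in> on_obj a c" and "k b c (ap e c t) = k b c (ap e c t')" for c t t'
    using separatedD[OF P c ap_in[OF u c t] ap_in[OF u c t'] k_cong[OF u c t t' e1[OF that]]] .
  obtain w where w: "w \<in> hom C b P" and wv: "\<And>c y. c \<in> obj B \<Longrightarrow> y \<in> on_obj b c \<Longrightarrow> ap w c y = ap u c (s c y)"
  proof (rule map_exists[OF bo Po, of "\<lambda>c y. ap u c (s c y)"])
    show "ap u c (s c y) \<in> on_obj P c" if "c \<in> obj B" "y \<in> on_obj b c" for c y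
      using ap_in[OF u that(1) s[OF that]] .
    fix c d f y assume f: "f \<in> hom B c d" and y: "y \<in> on_obj b c"
    note c = hom_obj(1)[OF B f] and d = hom_obj(2)[OF B f]
    have ao: "a \<in> obj C" using hom_objects[OF u] by blast
    note sy = s[OF c y] and fy = act_in[OF bo f y]
    have "k b d (ap e d (act a c d f (s c y))) = k b d (act b c d f y)"
      using ap_act[OF eh f sy] k_act[OF bo f ap_in[OF eh c sy] y ks[OF c y]] by simp
    then have "ap u d (s d (act b c d f y)) = ap u d (act a c d f (s c y))"
      using u_eq[OF d s[OF d fy] act_in[OF ao f sy]] ks[OF d fy] by simp
    then show "ap u d (s d (act b c d f y)) = act P c d f (ap u c (s c y))"
      using ap_act[OF u f sy] by simp
  qed blast
  have we: "cmp C w e = u"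
  proof (rule map_eqI[OF cmp_hom[OF C eh w] u])
    fix c t assume c: "c \<in> obj B" and t: "t \<in> on_obj a c"
    note et = ap_in[OF eh c t]
    show "ap (cmp C w e) c t = ap u c t"
      using ap_cmp[OF eh c t, of w] wv[OF c et] u_eq[OF c s[OF c et] t ks[OF c et]] by metis
  qed
  have rw: "cmp C r w = v"
  proof (rule map_eqI[OF cmp_hom[OF C w r] v])
    fix c y assume c: "c \<in> obj B" and y: "y \<in> on_obj b c"
    note sy = s[OF c y] and ey = ap_in[OF eh c s[OF c y]]
    have "ap v c (ap e c (s c y)) = ap v c y"
      using separatedD[OF E c ap_in[OF v c ey] ap_in[OF v c y] k_cong[OF v c ey y ks[OF c y]]] .
    then show "ap (cmp C r w) c y = ap v c y"
      using ap_cmp[OF w c y, of r] wv[OF c y] ap_cmp[OF u c sy, of r] ap_cmp[OF eh c sy, of v] sq by metis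
  qed
  show "\<exists>!w. w \<in> hom C b P \<and> cmp C w e = u \<and> cmp C r w = v"
  proof (intro ex1I conjI)
    show "w \<in> hom C b P" "cmp C w e = u" "cmp C r w = v" using w we rw by blast+
    fix w' assume w': "w' \<in> hom C b P \<and> cmp C w' e = u \<and> cmp C r w' = v"
    then have w'h: "w' \<in> hom C b P" by blast
    show "w' = w"
    proof (rule map_eqI[OF w'h w])
      fix c y assume c: "c \<in> obj B" and y: "y \<in> on_obj b c"
      note sy = s[OF c y] and ey = ap_in[OF eh c s[OF c y]]
      have "ap w' c (ap e c (s c y)) = ap w' c y"
        using separatedD[OF P c ap_in[OF w'h c ey] ap_in[OF w'h c y] k_cong[OF w'h c ey y ks[OF c y]]] .
      then show "ap w' c y = ap w c y" using ap_cmp[OF eh c sy, of w'] w' wv[OF c y] by metis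
    qed
  qed
qed

text \<open>
  In the factorization of \<open>r\<close> through a light map, the first factor is inverted by the reflection,
  so orthogonality to it provides a left inverse of this factor.
\<close>

lemma light_if_M:
  assumes r: "MM P E r"
  shows "light P r"
proof -
  have rh: "r \<in> hom C P E" using r unfolding M_cls_def by blast
  obtain Z e m where e: "EE' P Z e" and m: "m \<in> hom C Z E" "light Z m" and rme: "r = cmp C m e"
    using light_factorization[OF rh] .
  have eh: "e \<in> hom C P Z" using e E'_iff by blast
  have P: "P \<in> obj C" using hom_objects[OF eh] by blast
  have "EE P Z e"
    using e tame_reflect[OF eh] unfolding E'_iff E_iff surj_map_def by metis
  then have "orthogonal C P Z e P E r" using r unfolding M_cls_def by blast
  moreover have "cmp C m e = cmp C r (idn C P)" using cmp_idr[OF C rh] rme by metis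
  ultimately obtain w where w: "w \<in> hom C Z P" "cmp C w e = idn C P"
    using idn_hom[OF C P] m(1) unfolding orthogonal_def by blast
  have winv: "ap w b (ap e b x) = x" if "b \<in> obj B" "x \<in> on_obj P b" for b x
    using ap_cmp[OF eh that, of w] w(2) ap_idn[OF that] by metis
  show ?thesis
    unfolding light_def
  proof (intro ballI impI)
    fix b x x' assume b: "b \<in> obj B" and x: "x \<in> on_obj P b" and x': "x' \<in> on_obj P b"
      and eq: "ap r b x = ap r b x'" and keq: "k P b x = k P b x'"
    have "ap m b (ap e b x) = ap m b (ap e b x')"
      using ap_cmp[OF eh b x, of m] ap_cmp[OF eh b x', of m] eq rme by metis
    then have "ap e b x = ap e b x'"
      using lightD[OF m(2) b ap_in[OF eh b x] ap_in[OF eh b x']] k_cong[OF eh b x x' keq] by blast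
    then show "x = x'" using winv[OF b x] winv[OF b x'] by metis
  qed
qed

text \<open>
  An effective descent morphism is surjective, so lightness can be checked after pulling back along it,
  in the fibre over a chosen preimage. Conversely, the pullback of a light map along a separated cover
  is a map between separated objects.
\<close>

lemma Mstar_iff: "MMstar M N f \<longleftrightarrow> f \<in> hom C M N \<and> light M f"
proof
  assume "MMstar M N f"
  then obtain E p P r q where f: "f \<in> hom C M N" and ed: "effective_descent C E N p"
    and pb: "is_pullback C E M N p f P r q" and r: "MM P E r" unfolding Mstar_cls_def by blast
  note h = pullback_hom[OF pb]
  have s: "surj_map E N p" using effective_descent_imp_surj[OF ed] .
  have "light M f"
    unfolding light_def
  proof (intro ballI impI)
    fix b x x' assume b: "b \<in> obj B" and x: "x \<in> on_obj M b" and x': "x' \<in> on_obj M b"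
      and eq: "ap f b x = ap f b x'" and keq: "k M b x = k M b x'"
    obtain e where e: "e \<in> on_obj E b" "ap p b e = ap f b x" using surj_mapE[OF s b ap_in[OF f b x]] .
    obtain t where t: "t \<in> on_obj P b" "ap r b t = e" "ap q b t = x"
      using pullback_elements(2)[OF pb b e(1) x e(2)] by blast
    obtain t' where t': "t' \<in> on_obj P b" "ap r b t' = e" "ap q b t' = x'"
      using pullback_elements(2)[OF pb b e(1) x'] e(2) eq by metis
    have "k P b t = k P b t'" using k_pullback[OF pb b t(1) t'(1)] t t' keq by simp
    then have "t = t'" using lightD[OF light_if_M[OF r] b t(1) t'(1)] t t' by simp
    then show "x = x'" using t t' by simp
  qed
  then show "f \<in> hom C M N \<and> light M f" using f by blast
next
  assume "f \<in> hom C M N \<and> light M f"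
  then have f: "f \<in> hom C M N" and lf: "light M f" by blast+
  obtain E p where p: "p \<in> hom C E N" and ps: "surj_map E N p" and E: "separated E"
    using separated_cover hom_objects[OF f] by metis
  obtain P r q where pb: "is_pullback C E M N p f P r q" using is_pullback_exists[OF p f] .
  note h = pullback_hom[OF pb]
  have "separated P"
  proof (rule separatedI)
    show "P \<in> obj C" using hom_objects[OF h(3)] by blast
    fix b t t' assume b: "b \<in> obj B" and t: "t \<in> on_obj P b" and t': "t' \<in> on_obj P b" and eq: "k P b t = k P b t'"
    note rt = ap_in[OF h(3) b t] ap_in[OF h(3) b t'] and qt = ap_in[OF h(4) b t] ap_in[OF h(4) b t']
    have r: "ap r b t = ap r b t'" using separatedD[OF E b rt k_cong[OF h(3) b t t' eq]] .
    then have "ap f b (ap q b t) = ap f b (ap q b t')" using pullback_elements(3)[OF pb b] t t' by metis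
    then have "ap q b t = ap q b t'" using lightD[OF lf b qt] k_cong[OF h(4) b t t' eq] by blast
    then show "t = t'" using pullback_elements(1)[OF pb b t t' r] by blast
  qed
  then have "MM P E r" using M_if_separated[OF h(3)] E by blast
  moreover have "effective_descent C E N p" using surj_imp_effective_descent[OF p ps] .
  ultimately show "MMstar M N f" unfolding Mstar_cls_def using f pb by blast
qed

lemma monotone_light_factorization_system: "factorization_system C EE' MMstar"
  unfolding factorization_system_def
proof (intro conjI allI impI)
  fix x y f
  show "EE' x y f \<Longrightarrow> f \<in> hom C x y" using E'_iff by blast
  show "MMstar x y f \<Longrightarrow> f \<in> hom C x y" using Mstar_iff by blast
  show "is_iso C x y f \<Longrightarrow> EE' x y f"
    unfolding iso_iff E'_iff tame_def inj_map_def by metis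
  show "is_iso C x y f \<Longrightarrow> MMstar x y f"
    unfolding iso_iff Mstar_iff light_def inj_map_def by metis
  show "f \<in> hom C x y \<Longrightarrow> \<exists>z e m. EE' x z e \<and> MMstar z y m \<and> f = cmp C m e"
    using light_factorization[of f x y] Mstar_iff by metis
next
  fix x y z f g assume f: "EE' x y f" and g: "EE' y z g"
  have fh: "f \<in> hom C x y" and fs: "surj_map x y f" and tf: "tame x f" using f E'_iff by blast+
  have gh: "g \<in> hom C y z" and gs: "surj_map y z g" and tg: "tame y g" using g E'_iff by blast+
  have "surj_map x z (cmp C g f)"
    unfolding surj_map_def
  proof (intro ballI)
    fix b w assume b: "b \<in> obj B" and w: "w \<in> on_obj z b"
    obtain v where v: "v \<in> on_obj y b" "ap g b v = w" using surj_mapE[OF gs b w] .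
    obtain u where u: "u \<in> on_obj x b" "ap f b u = v" using surj_mapE[OF fs b v(1)] .
    show "\<exists>u\<in>on_obj x b. ap (cmp C g f) b u = w" using u v ap_cmp[OF fh b u(1), of g] by metis
  qed
  moreover have "tame x (cmp C g f)"
    unfolding tame_def
  proof (intro ballI impI)
    fix b u u' assume b: "b \<in> obj B" and u: "u \<in> on_obj x b" and u': "u' \<in> on_obj x b"
      and eq: "ap (cmp C g f) b u = ap (cmp C g f) b u'"
    have "ap g b (ap f b u) = ap g b (ap f b u')"
      using eq ap_cmp[OF fh b u, of g] ap_cmp[OF fh b u', of g] by metis
    then have "k y b (ap f b u) = k y b (ap f b u')"
      using tameD[OF tg b ap_in[OF fh b u] ap_in[OF fh b u']] by blast
    then show "k x b u = k x b u'" using tame_reflect[OF fh tf b u u'] by blast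
  qed
  ultimately show "EE' x z (cmp C g f)" using E'_iff cmp_hom[OF C fh gh] by blast
next
  fix x y z f g assume f: "MMstar x y f" and g: "MMstar y z g"
  have fh: "f \<in> hom C x y" and lf: "light x f" using f Mstar_iff by blast+
  have gh: "g \<in> hom C y z" and lg: "light y g" using g Mstar_iff by blast+
  have "light x (cmp C g f)"
    unfolding light_def
  proof (intro ballI impI)
    fix b u u' assume b: "b \<in> obj B" and u: "u \<in> on_obj x b" and u': "u' \<in> on_obj x b"
      and eq: "ap (cmp C g f) b u = ap (cmp C g f) b u'" and keq: "k x b u = k x b u'"
    have "ap g b (ap f b u) = ap g b (ap f b u')"
      using eq ap_cmp[OF fh b u, of g] ap_cmp[OF fh b u', of g] by metis
    then have "ap f b u = ap f b u'"
      using lightD[OF lg b ap_in[OF fh b u] ap_in[OF fh b u']] k_cong[OF fh b u u' keq] by blast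
    then show "u = u'" using lightD[OF lf b u u'] keq by blast
  qed
  then show "MMstar x z (cmp C g f)" using Mstar_iff cmp_hom[OF C fh gh] by blast
next
  fix a b e x y m assume "EE' a b e" "MMstar x y m"
  then show "orthogonal C a b e x y m" using orthogonal_light Mstar_iff by blast
qed

end

theorem theorem3p1:
  fixes U :: "'u set set"
    and B :: "('u, 'u) cat"
    and A :: "('a, 'u) cat"
    and K :: "('u, 'u, 'a, 'u) fnctr"
  assumes "set_universe U"
    and "small_category U B"
    and "locally_small_category U A"
    and "is_functor B A K"
  shows "(\<exists>Lan \<theta> \<epsilon>. Lan_adjunction U B A K Lan \<theta> \<epsilon>) \<and>
    (\<forall>Lan \<theta> \<epsilon>.
       Lan_adjunction U B A K Lan \<theta> \<epsilon> \<longrightarrow>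
       preserves_pullbacks (Set_pow U B) (Set_pow U A) Lan \<longrightarrow>
       faithful (op_cat B) (comp_fun Lan (yoneda B)) \<longrightarrow>
       (\<exists>I \<eta> \<epsilon>'.
          induced_reflection U B K Lan \<theta> I \<eta> \<epsilon>' \<and>
          stable_units (Set_pow U B) (Mono_cat U B K Lan \<theta>) I \<eta> \<and>
          factorization_system (Set_pow U B)
            (E'_cls (Set_pow U B) (Mono_cat U B K Lan \<theta>) I)
            (Mstar_cls (Set_pow U B) (Mono_cat U B K Lan \<theta>) I)))"
proof (intro conjI allI impI)
  interpret kan_setting U B A K using assms by unfold_locales
  show "\<exists>Lan \<theta> \<epsilon>. Lan_adjunction U B A K Lan \<theta> \<epsilon>"
    by (rule Lan_adjunction_exists)
  fix Lan \<theta> \<epsilon>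
  assume "Lan_adjunction U B A K Lan \<theta> \<epsilon>"
    and "preserves_pullbacks (Set_pow U B) (Set_pow U A) Lan"
    and "faithful (op_cat B) (comp_fun Lan (yoneda B))"
  then interpret pullback_preserving_kan U B A K Lan \<theta> \<epsilon>
    by unfold_locales (auto simp: Lan_adjunction_def)
  obtain I \<eta> \<epsilon>' where "kan_reflection U B A K Lan \<theta> \<epsilon> I \<eta> \<epsilon>'"
    using kan_reflection_exists by blast
  then interpret kan_reflection U B A K Lan \<theta> \<epsilon> I \<eta> \<epsilon>' .
  show "\<exists>I \<eta> \<epsilon>'.
          induced_reflection U B K Lan \<theta> I \<eta> \<epsilon>' \<and>
          stable_units (Set_pow U B) (Mono_cat U B K Lan \<theta>) I \<eta> \<and>
          factorization_system (Set_pow U B)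
            (E'_cls (Set_pow U B) (Mono_cat U B K Lan \<theta>) I)
            (Mstar_cls (Set_pow U B) (Mono_cat U B K Lan \<theta>) I)"
    using reflection_is_induced reflection_has_stable_units monotone_light_factorization_system by blast
qed

end
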